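(* Let $(W^5,g)$ be an oriented Riemannian five-manifold with a vector field $v$ of pointwise unit norm, let $G$ be a compact Lie group, let $P\to W$ be a principal $G$-bundle, and let $(A,B)\in\mathcal A(P)\times\Omega^2_+(\mathrm{ad}\,P)$. Then the deformation complex $$0\to\Omega^0(\mathrm{ad}\,P)\xrightarrow{\ K\ }\Omega^1(\mathrm{ad}\,P)\oplus\Omega^2_+(\mathrm{ad}\,P)\xrightarrow{\ \delta\Phi\ }\Omega^1_h(\mathrm{ad}\,P)\oplus\Omega^2_+(\mathrm{ad}\,P)\to 0$$ at the point $(A,B)$ is elliptic (that is, its principal symbol sequence is exact for every nonzero covector), where $\delta\Phi=\delta\Phi_{(A,B)}$ is the linearization at $(A,B)$ of the map $$\Phi(A,B)=\bigl(\imath_vF_A-\delta_A^+B,\ F_A^+-\nabla^A_vB-\sigma(B,B)\bigr)$$ and $K(\xi)=(d_A\xi,[B,\xi])$ is the infinitesimal action of the gauge group.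
   Context: Put $\eta=g(v,\cdot)\in\Omega^1(W)$ and $\mathcal H=\ker\eta\subset TW$. The map $\omega\mapsto *(\omega\wedge\eta)$ on $\Lambda^2T^*W$ has eigenvalues $-1,0,+1$; this gives $\Omega^2(W)=\Omega^2_-(W)\oplus\Omega^2_0(W)\oplus\Omega^2_+(W)$, with $\Lambda^2_\pm T^*W\cong\Lambda^2_\pm\mathcal H^*$ (the four-dimensional self-dual/anti-self-dual forms on $\mathcal H$) and $\Lambda^2_0\cong\mathcal H^*$. Also $\Omega^1_h(W)=\Gamma(\mathcal H^* )$, and $\Omega^1(W)=\Omega^1_h(W)\oplus\Omega^0(W)\eta$. The same notation is used for forms with values in the adjoint bundle $\mathrm{ad}\,P$. $\mathcal A(P)$ is the space of connections on $P$; $F_A$ is the curvature and $F_A^+$ its component in $\Omega^2_+(\mathrm{ad}\,P)$. The operator $\delta_A^+\colon\Omega^2_+(\mathrm{ad}\,P)\to\Omega^1_h(\mathrm{ad}\,P)$ is the composition $$\Gamma(\Lambda^2_+\mathcal H^*\otimes\mathrm{ad}\,P)\xrightarrow{\nabla^{LC,A}}\Gamma(T^*W\otimes\Lambda^2_+\mathcal H^*\otimes\mathrm{ad}\,P)\xrightarrow{Cl'\otimes\mathrm{id}}\Gamma(\mathcal H^*\otimes\mathrm{ad}\,P),$$ where $\nabla^{LC,A}$ is the tensor product of $A$ and the connection on $\Lambda^2_+\mathcal H^*$ induced by the Levi-Civita connection, and $Cl'$ is the contraction $e\otimes\omega\mapsto-\imath_e\omega$ (with $T^*W\cong TW$ via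 $g$). $\nabla^A_v$ is the covariant derivative of sections of $\Lambda^2_+\mathcal H^*\otimes\mathrm{ad}\,P$ in direction $v$ with respect to $\nabla^{LC,A}$. The bundle $\Lambda^2_+\mathcal H^*$ is a bundle of Lie algebras, since it is a three-dimensional oriented Euclidean vector bundle (cross product), and $\sigma=\tfrac12[\cdot,\cdot]_{\Lambda^2_+\mathcal H^*}\otimes[\cdot,\cdot]_{\mathfrak g}$. In an identification $\Lambda^2_+\mathcal H^*\cong\mathbb R^3$, for $\xi=\sum e_i\otimes\xi_i$ one has $\sigma(\xi,\xi)=e_1\otimes[\xi_2,\xi_3]+e_2\otimes[\xi_3,\xi_1]+e_3\otimes[\xi_1,\xi_2]$. *)

theory Defs
  imports "HOL-Analysis.Analysis" "HOL-Algebra.Group"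
begin

section \<open>Smooth functions between normed spaces\<close>

text \<open>Used on open sets of finite-dimensional spaces only; there a function is of class
  \<open>C\<^sup>k\<^sup>+\<^sup>1\<close> iff it is differentiable with all directional derivatives of class \<open>C\<^sup>k\<close>.\<close>

primrec ck_on :: "nat \<Rightarrow> 'a::real_normed_vector set \<Rightarrow> ('a \<Rightarrow> 'b::real_normed_vector) \<Rightarrow> bool" where
  "ck_on 0 S f \<longleftrightarrow> continuous_on S f"
| "ck_on (Suc k) S f \<longleftrightarrow>
     f differentiable_on S \<and> (\<forall>u. ck_on k S (\<lambda>x. frechet_derivative f (at x) u))"

definition smooth_on :: "'a::real_normed_vector set \<Rightarrow> ('a \<Rightarrow> 'b::real_normed_vector) \<Rightarrow> bool" where
  "smooth_on S f \<longleftrightarrow> (\<forall>k. ck_on k S f)"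

text \<open>Finite-dimensional inner product spaces; unlike \<^class>\<open>euclidean_space\<close> this includes
  dimension zero, so that finite groups count as compact Lie groups.\<close>

class finite_dim_inner = real_inner +
  assumes finite_dim: "\<exists>B. finite B \<and> (\<forall>x. \<exists>c. x = (\<Sum>b\<in>B. c b *\<^sub>R b))"

instance euclidean_space \<subseteq> finite_dim_inner
  by standard (metis finite_Basis euclidean_representation)


section \<open>Manifolds\<close>

text \<open>A chart is a pair of its domain and its map; a manifold is a topological space (a type)
  with a smooth atlas.\<close>

type_synonym ('m, 'e) chart = "'m set \<times> ('m \<Rightarrow> 'e)"

abbreviation cinv :: "('m, 'e) chart \<Rightarrow> 'e \<Rightarrow> 'm" where
  "cinv c \<equiv> inv_into (fst c) (snd c)"

definition smooth_atlas ::
  "('m::{t2_space,second_countable_topology}, 'e::finite_dim_inner) chart set \<Rightarrow> bool" where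
  "smooth_atlas M \<longleftrightarrow>
     (\<Union>c\<in>M. fst c) = UNIV \<and>
     (\<forall>c\<in>M. open (fst c) \<and> open (snd c ` fst c) \<and>
        homeomorphism (fst c) (snd c ` fst c) (snd c) (cinv c)) \<and>
     (\<forall>c\<in>M. \<forall>d\<in>M. smooth_on (snd c ` (fst c \<inter> fst d)) (snd d \<circ> cinv c))"

definition oriented_atlas ::
  "('m::{t2_space,second_countable_topology}, real^5) chart set \<Rightarrow> bool" where
  "oriented_atlas M \<longleftrightarrow> smooth_atlas M \<and>
     (\<forall>c\<in>M. \<forall>d\<in>M. \<forall>x\<in>fst c \<inter> fst d.
        det (matrix (frechet_derivative (snd d \<circ> cinv c) (at (snd c x)))) > 0)"

text \<open>A tangent vector at \<open>x\<close> is an equivalence class of pairs (chart around \<open>x\<close>, vector of the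
  model space). Each class has exactly one representative in a preferred chart around \<open>x\<close>, so
  that \<open>T\<^sub>xM\<close> is identified with the model space through \<open>chart_at M x\<close>. In general the preferred
  chart does not vary continuously with \<open>x\<close>; smoothness of tensor fields is therefore
  tested on the coordinate fields of the charts.\<close>

definition chart_at :: "('m, 'e) chart set \<Rightarrow> 'm \<Rightarrow> ('m, 'e) chart" where
  "chart_at M x = (SOME c. c \<in> M \<and> x \<in> fst c)"

definition deriv_fun ::
  "('m, 'e::real_normed_vector) chart set \<Rightarrow> ('m \<Rightarrow> 'b::real_normed_vector) \<Rightarrow> 'm \<Rightarrow> 'e \<Rightarrow> 'b" where
  "deriv_fun M f x =
     frechet_derivative (f \<circ> cinv (chart_at M x)) (at (snd (chart_at M x) x))"

definition tangent_map ::
  "('m, 'e::real_normed_vector) chart set \<Rightarrow> ('n, 'f::real_normed_vector) chart set \<Rightarrow>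
   ('m \<Rightarrow> 'n) \<Rightarrow> 'm \<Rightarrow> 'e \<Rightarrow> 'f" where
  "tangent_map M N f x = deriv_fun M (snd (chart_at N (f x)) \<circ> f) x"

text \<open>The value at \<open>x\<close> of the coordinate vector field of the chart \<open>c\<close> in the constant direction \<open>u\<close>.\<close>

definition coord_field ::
  "('m, 'e::real_normed_vector) chart set \<Rightarrow> ('m, 'e) chart \<Rightarrow> 'e \<Rightarrow> 'm \<Rightarrow> 'e" where
  "coord_field M c u x = frechet_derivative (snd (chart_at M x) \<circ> cinv c) (at (snd c x)) u"

definition smooth_fun_on ::
  "('m, 'e::real_normed_vector) chart set \<Rightarrow> 'm set \<Rightarrow> ('m \<Rightarrow> 'b::real_normed_vector) \<Rightarrow> bool" where
  "smooth_fun_on M S f \<longleftrightarrow> (\<forall>c\<in>M. smooth_on (snd c ` (fst c \<inter> S)) (f \<circ> cinv c))"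

definition smooth_map_on ::
  "('m::topological_space, 'e::real_normed_vector) chart set \<Rightarrow>
   ('n::topological_space, 'f::real_normed_vector) chart set \<Rightarrow> 'm set \<Rightarrow> ('m \<Rightarrow> 'n) \<Rightarrow> bool" where
  "smooth_map_on M N S f \<longleftrightarrow> continuous_on S f \<and>
     (\<forall>c\<in>M. \<forall>d\<in>N. smooth_on (snd c ` (fst c \<inter> S \<inter> f -` fst d)) (snd d \<circ> f \<circ> cinv c))"

definition prod_atlas ::
  "('m, 'e) chart set \<Rightarrow> ('n, 'f) chart set \<Rightarrow> ('m \<times> 'n, 'e \<times> 'f) chart set" where
  "prod_atlas M N = {(fst c \<times> fst d, map_prod (snd c) (snd d)) |c d. c \<in> M \<and> d \<in> N}"

definition riemannian_metric ::
  "('m, 'e::real_normed_vector) chart set \<Rightarrow> ('m \<Rightarrow> 'e \<Rightarrow> 'e \<Rightarrow> real) \<Rightarrow> bool" where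
  "riemannian_metric M g \<longleftrightarrow>
     (\<forall>x. bilinear (g x) \<and> (\<forall>u w. g x u w = g x w u) \<and> (\<forall>u. u \<noteq> 0 \<longrightarrow> g x u u > 0)) \<and>
     (\<forall>c\<in>M. \<forall>u w. smooth_fun_on M (fst c) (\<lambda>x. g x (coord_field M c u x) (coord_field M c w x)))"

definition smooth_vector_field ::
  "('m, 'e::real_normed_vector) chart set \<Rightarrow> ('m \<Rightarrow> 'e) \<Rightarrow> bool" where
  "smooth_vector_field M v \<longleftrightarrow>
     (\<forall>c\<in>M. smooth_fun_on M (fst c) (\<lambda>x. deriv_fun M (snd c) x (v x)))"

text \<open>The Levi-Civita connection at \<open>x\<close>: \<open>\<nabla>\<^sub>u \<partial>\<^sub>w\<close> for the coordinate fields of the preferred chart.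
  Since these commute, vanishing torsion is symmetry in \<open>u, w\<close>; the last clause is
  compatibility with the metric.\<close>

definition christoffel ::
  "('m, 'e::real_normed_vector) chart set \<Rightarrow> ('m \<Rightarrow> 'e \<Rightarrow> 'e \<Rightarrow> real) \<Rightarrow> 'm \<Rightarrow> 'e \<Rightarrow> 'e \<Rightarrow> 'e" where
  "christoffel M g x = (THE \<Gamma>. bilinear \<Gamma> \<and> (\<forall>u w. \<Gamma> u w = \<Gamma> w u) \<and>
     (\<forall>u w z. deriv_fun M (\<lambda>y. g y (coord_field M (chart_at M x) w y)
                                    (coord_field M (chart_at M x) z y)) x u
               = g x (\<Gamma> u w) z + g x w (\<Gamma> u z)))"


section \<open>Lie groups\<close>

definition lie_group ::
  "('g::{t2_space,second_countable_topology}) monoid \<Rightarrow> ('g, 'l::finite_dim_inner) chart set \<Rightarrow> bool" where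
  "lie_group G L \<longleftrightarrow> group G \<and> carrier G = UNIV \<and> smooth_atlas L \<and>
     smooth_map_on (prod_atlas L L) L UNIV (\<lambda>(a, b). a \<otimes>\<^bsub>G\<^esub> b) \<and>
     smooth_map_on L L UNIV (\<lambda>a. inv\<^bsub>G\<^esub> a)"

text \<open>The Lie algebra is the tangent space at the identity, i.e. the model space; its bracket is
  the derivative at the identity of the adjoint representation.\<close>

definition Ad :: "'g monoid \<Rightarrow> ('g, 'l::real_normed_vector) chart set \<Rightarrow> 'g \<Rightarrow> 'l \<Rightarrow> 'l" where
  "Ad G L a = tangent_map L L (\<lambda>b. a \<otimes>\<^bsub>G\<^esub> b \<otimes>\<^bsub>G\<^esub> inv\<^bsub>G\<^esub> a) \<one>\<^bsub>G\<^esub>"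

definition lie_bracket ::
  "'g monoid \<Rightarrow> ('g, 'l::real_normed_vector) chart set \<Rightarrow> 'l \<Rightarrow> 'l \<Rightarrow> 'l" where
  "lie_bracket G L X Y = deriv_fun L (\<lambda>a. Ad G L a Y) \<one>\<^bsub>G\<^esub> X"


section \<open>Principal bundles\<close>

definition principal_bundle ::
  "('w::{t2_space,second_countable_topology}, 'e::finite_dim_inner) chart set \<Rightarrow>
   ('g::{t2_space,second_countable_topology}) monoid \<Rightarrow> ('g, 'l::finite_dim_inner) chart set \<Rightarrow>
   ('p::{t2_space,second_countable_topology}, 'k::finite_dim_inner) chart set \<Rightarrow>
   ('p \<Rightarrow> 'w) \<Rightarrow> ('p \<Rightarrow> 'g \<Rightarrow> 'p) \<Rightarrow> bool" where
  "principal_bundle W G L P \<pi> act \<longleftrightarrow>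
     smooth_atlas P \<and> smooth_map_on P W UNIV \<pi> \<and>
     smooth_map_on (prod_atlas P L) P UNIV (\<lambda>(p, a). act p a) \<and>
     (\<forall>p. act p \<one>\<^bsub>G\<^esub> = p) \<and> (\<forall>p a b. act (act p a) b = act p (a \<otimes>\<^bsub>G\<^esub> b)) \<and>
     (\<forall>p a. \<pi> (act p a) = \<pi> p) \<and>
     (\<forall>x. \<exists>U \<phi> \<psi>. open U \<and> x \<in> U \<and>
        smooth_map_on P L (\<pi> -` U) \<phi> \<and> smooth_map_on (prod_atlas W L) P (U \<times> UNIV) \<psi> \<and>
        (\<forall>q\<in>\<pi> -` U. \<psi> (\<pi> q, \<phi> q) = q \<and> (\<forall>a. \<phi> (act q a) = \<phi> q \<otimes>\<^bsub>G\<^esub> a)) \<and>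
        (\<forall>y\<in>U. \<forall>a. \<pi> (\<psi> (y, a)) = y \<and> \<phi> (\<psi> (y, a)) = a))"


section \<open>Two-forms on an oriented Euclidean five-space with a unit vector\<close>

text \<open>In this section \<open>h\<close> is an inner product on \<open>\<real>\<^sup>5\<close>, and \<open>n\<close> a vector with \<open>h n n = 1\<close>.\<close>

type_synonym 'b form1 = "(real^5) \<Rightarrow>\<^sub>L 'b"
type_synonym 'b form2 = "(real^5) \<Rightarrow>\<^sub>L (real^5) \<Rightarrow>\<^sub>L 'b"

definition Form2 :: "(real^5 \<Rightarrow> real^5 \<Rightarrow> 'b::real_normed_vector) \<Rightarrow> 'b form2" where
  "Form2 f = Blinfun (\<lambda>X. Blinfun (f X))"

definition alternating :: "'b::real_normed_vector form2 \<Rightarrow> bool" where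
  "alternating \<omega> \<longleftrightarrow> (\<forall>X. \<omega> X X = 0)"

definition oriented_frame :: "(real^5 \<Rightarrow> real^5 \<Rightarrow> real) \<Rightarrow> real^5^5 \<Rightarrow> bool" where
  "oriented_frame h e \<longleftrightarrow> (\<forall>i j. h (e $ i) (e $ j) = (if i = j then 1 else 0)) \<and> det e > 0"

text \<open>The volume form: the multiple of the determinant with value 1 on the oriented
  orthonormal frame \<open>e\<close>.\<close>

definition vol :: "real^5^5 \<Rightarrow> real^5 \<Rightarrow> real^5 \<Rightarrow> real^5 \<Rightarrow> real^5 \<Rightarrow> real^5 \<Rightarrow> real" where
  "vol e X1 X2 X3 X4 X5 =
     det (\<chi> r. if r = 1 then X1 else if r = 2 then X2 else if r = 3 then X3
               else if r = 4 then X4 else X5) / det e"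

text \<open>\<open>*\<theta> = \<Sum>\<^sub>i\<^sub><\<^sub>j\<^sub><\<^sub>k \<theta>(e\<^sub>i,e\<^sub>j,e\<^sub>k) *(e\<^sup>i\<and>e\<^sup>j\<and>e\<^sup>k)\<close>, where \<open>\<alpha> \<and> *\<beta> = \<langle>\<alpha>,\<beta>\<rangle> vol\<close> gives
  \<open>*(e\<^sup>i\<and>e\<^sup>j\<and>e\<^sup>k) = vol(e\<^sub>i,e\<^sub>j,e\<^sub>k,\<cdot>,\<cdot>)\<close>; the sum below runs over all triples.\<close>

definition hodge3 ::
  "(real^5 \<Rightarrow> real^5 \<Rightarrow> real) \<Rightarrow> (real^5 \<Rightarrow> real^5 \<Rightarrow> real^5 \<Rightarrow> 'b) \<Rightarrow> 'b::real_normed_vector form2" where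
  "hodge3 h \<theta> = (let e = SOME e. oriented_frame h e in
     Form2 (\<lambda>X Y. (1/6) *\<^sub>R (\<Sum>i\<in>UNIV. \<Sum>j\<in>UNIV. \<Sum>k\<in>UNIV.
        vol e (e $ i) (e $ j) (e $ k) X Y *\<^sub>R \<theta> (e $ i) (e $ j) (e $ k))))"

definition wedge21 ::
  "'b::real_normed_vector form2 \<Rightarrow> (real^5 \<Rightarrow> real) \<Rightarrow> real^5 \<Rightarrow> real^5 \<Rightarrow> real^5 \<Rightarrow> 'b" where
  "wedge21 \<omega> \<eta> X Y Z = \<eta> Z *\<^sub>R \<omega> X Y + \<eta> X *\<^sub>R \<omega> Y Z + \<eta> Y *\<^sub>R \<omega> Z X"

text \<open>The \<open>\<mu>\<close>-eigenspace of \<open>\<omega> \<mapsto> *(\<omega> \<and> \<eta>)\<close>, where \<open>\<eta> = h(n, \<cdot>)\<close>.\<close>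

definition star_eigenforms ::
  "(real^5 \<Rightarrow> real^5 \<Rightarrow> real) \<Rightarrow> real^5 \<Rightarrow> real \<Rightarrow> 'b::real_normed_vector form2 set" where
  "star_eigenforms h n \<mu> = {\<omega>. alternating \<omega> \<and> hodge3 h (wedge21 \<omega> (h n)) = \<mu> *\<^sub>R \<omega>}"

definition plus_part ::
  "(real^5 \<Rightarrow> real^5 \<Rightarrow> real) \<Rightarrow> real^5 \<Rightarrow> 'b::real_normed_vector form2 \<Rightarrow> 'b form2" where
  "plus_part h n \<omega> = (THE \<alpha>. \<alpha> \<in> star_eigenforms h n 1 \<and>
     (\<exists>\<beta>\<in>star_eigenforms h n (-1). \<exists>\<gamma>\<in>star_eigenforms h n 0. \<omega> = \<beta> + \<gamma> + \<alpha>))"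

definition wedge11 :: "(real^5 \<Rightarrow> real) \<Rightarrow> (real^5 \<Rightarrow> real) \<Rightarrow> real^5 \<Rightarrow> real^5 \<Rightarrow> real" where
  "wedge11 \<alpha> \<beta> X Y = \<alpha> X * \<beta> Y - \<alpha> Y * \<beta> X"

text \<open>For an oriented orthonormal frame \<open>e\<close> with \<open>e\<^sub>5 = n\<close>: the basis
  \<open>e\<^sup>1\<^sup>2+e\<^sup>3\<^sup>4, e\<^sup>1\<^sup>3+e\<^sup>4\<^sup>2, e\<^sup>1\<^sup>4+e\<^sup>2\<^sup>3\<close> of the self-dual forms on \<open>n\<^sup>\<bottom>\<close>, positive by convention and
  normalized for the inner product of 2-forms in which the \<open>e\<^sup>i\<^sup>j\<close>, \<open>i < j\<close>, are orthonormal.\<close>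

definition sd_basis ::
  "(real^5 \<Rightarrow> real^5 \<Rightarrow> real) \<Rightarrow> real^5^5 \<Rightarrow> 3 \<Rightarrow> real^5 \<Rightarrow> real^5 \<Rightarrow> real" where
  "sd_basis h e k X Y = (let w = (\<lambda>i j. wedge11 (h (e $ i)) (h (e $ j)) X Y) in
     (if k = 1 then w 1 2 + w 3 4 else if k = 2 then w 1 3 + w 4 2 else w 1 4 + w 2 3) / sqrt 2)"

definition sd_component ::
  "(real^5 \<Rightarrow> real^5 \<Rightarrow> real) \<Rightarrow> real^5^5 \<Rightarrow> 3 \<Rightarrow> 'b::real_normed_vector form2 \<Rightarrow> 'b" where
  "sd_component h e k \<xi> = (1/2) *\<^sub>R (\<Sum>i\<in>UNIV. \<Sum>j\<in>UNIV.
     sd_basis h e k (e $ i) (e $ j) *\<^sub>R \<xi> (e $ i) (e $ j))"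

text \<open>\<open>\<sigma>(\<xi>,\<zeta>) = \<onehalf> \<Sum>\<^sub>i\<^sub>j (\<omega>\<^sub>i \<times> \<omega>\<^sub>j) \<otimes> [\<xi>\<^sub>i, \<zeta>\<^sub>j]\<close> for \<open>\<xi> = \<Sum> \<omega>\<^sub>i \<otimes> \<xi>\<^sub>i\<close> and \<open>\<zeta> = \<Sum> \<omega>\<^sub>j \<otimes> \<zeta>\<^sub>j\<close>, with \<open>br\<close> the
  bracket of the coefficients.\<close>

definition sigma ::
  "(real^5 \<Rightarrow> real^5 \<Rightarrow> real) \<Rightarrow> real^5 \<Rightarrow> ('b \<Rightarrow> 'b \<Rightarrow> 'b) \<Rightarrow>
   'b::real_normed_vector form2 \<Rightarrow> 'b form2 \<Rightarrow> 'b form2" where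
  "sigma h n br \<xi> \<zeta> = (let e = SOME e. oriented_frame h e \<and> e $ 5 = n in
     Form2 (\<lambda>X Y. (1/2) *\<^sub>R (\<Sum>i\<in>UNIV. \<Sum>j\<in>UNIV. \<Sum>k\<in>UNIV.
        (cross3 (axis i 1) (axis j 1) $ k * sd_basis h e k X Y) *\<^sub>R
          br (sd_component h e i \<xi>) (sd_component h e j \<zeta>))))"


section \<open>Symbols of first-order operators\<close>

text \<open>Let \<open>E\<close> be a vector bundle over \<open>W\<close> with fibre over \<open>\<pi> p\<close> identified through \<open>p \<in> P\<close> with a
  fixed space, and \<open>\<Gamma>\<close> its space of smooth sections, given as functions on \<open>P\<close>. The symbol of
  \<open>D\<close> at the covector \<open>\<zeta> = (df)\<^sub>x\<close>, \<open>x = \<pi> p\<close>, sends \<open>s(p)\<close> to \<open>[D, f] s (p)\<close>.\<close>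

definition principal_symbol ::
  "('w, 'e::real_normed_vector) chart set \<Rightarrow> ('p \<Rightarrow> 'w) \<Rightarrow> ('p \<Rightarrow> 'a::real_normed_vector) set \<Rightarrow>
   (('p \<Rightarrow> 'a) \<Rightarrow> 'p \<Rightarrow> 'b::real_normed_vector) \<Rightarrow> 'p \<Rightarrow> ('e \<Rightarrow>\<^sub>L real) \<Rightarrow> 'a \<Rightarrow> 'b" where
  "principal_symbol W \<pi> \<Gamma> D p \<zeta> e = (THE y. \<forall>f s.
     smooth_fun_on W UNIV f \<and> deriv_fun W f (\<pi> p) = blinfun_apply \<zeta> \<and> s \<in> \<Gamma> \<and> s p = e \<longrightarrow>
       D (\<lambda>q. f (\<pi> q) *\<^sub>R s q) p - f (\<pi> p) *\<^sub>R D s p = y)"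

text \<open>Ellipticity of \<open>0 \<rightarrow> \<Gamma>\<^sub>0 \<rightarrow> \<Gamma>\<^sub>1 \<rightarrow> \<Gamma>(E\<^sub>2) \<rightarrow> 0\<close>, the maps being \<open>D\<^sub>0\<close> and \<open>D\<^sub>1\<close>; here \<open>E\<^sub>i p\<close> is the
  fibre at \<open>p\<close>.\<close>

definition elliptic_complex ::
  "('w, 'e::real_normed_vector) chart set \<Rightarrow> ('p \<Rightarrow> 'w) \<Rightarrow>
   ('p \<Rightarrow> 'a::real_normed_vector set) \<Rightarrow> ('p \<Rightarrow> 'b::real_normed_vector set) \<Rightarrow>
   ('p \<Rightarrow> 'c::real_normed_vector set) \<Rightarrow> ('p \<Rightarrow> 'a) set \<Rightarrow> ('p \<Rightarrow> 'b) set \<Rightarrow>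
   (('p \<Rightarrow> 'a) \<Rightarrow> 'p \<Rightarrow> 'b) \<Rightarrow> (('p \<Rightarrow> 'b) \<Rightarrow> 'p \<Rightarrow> 'c) \<Rightarrow> bool" where
  "elliptic_complex W \<pi> E0 E1 E2 \<Gamma>0 \<Gamma>1 D0 D1 \<longleftrightarrow> (\<forall>p. \<forall>\<zeta>. \<zeta> \<noteq> 0 \<longrightarrow>
     (let s0 = principal_symbol W \<pi> \<Gamma>0 D0 p \<zeta>; s1 = principal_symbol W \<pi> \<Gamma>1 D1 p \<zeta> in
       {e \<in> E0 p. s0 e = 0} = {0} \<and>
       {e \<in> E1 p. s1 e = 0} = s0 ` E0 p \<and>
       s1 ` E1 p = E2 p))"


section \<open>Gauge theory on a five-manifold with a unit vector field\<close>

locale gauge_five_manifold =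
  fixes W :: "('w::{t2_space,second_countable_topology}, real^5) chart set"
    and g :: "'w \<Rightarrow> real^5 \<Rightarrow> real^5 \<Rightarrow> real"
    and v :: "'w \<Rightarrow> real^5"
    and G :: "('g::{t2_space,second_countable_topology}) monoid"
    and L :: "('g, 'l::finite_dim_inner) chart set"
    and P :: "('p::{t2_space,second_countable_topology}, 'k::finite_dim_inner) chart set"
    and \<pi> :: "'p \<Rightarrow> 'w"
    and act :: "'p \<Rightarrow> 'g \<Rightarrow> 'p"
  assumes oriented_base: "oriented_atlas W"
    and metric_base: "riemannian_metric W g"
    and smooth_field: "smooth_vector_field W v"
    and unit_length: "\<And>x. g x (v x) (v x) = 1"
    and structure_group: "lie_group G L"
    and compact_group: "compact (UNIV :: 'g set)"
    and principal: "principal_bundle W G L P \<pi> act"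
begin

abbreviation bracket :: "'l \<Rightarrow> 'l \<Rightarrow> 'l" where
  "bracket \<equiv> lie_bracket G L"

subsection \<open>Forms with values in the adjoint bundle\<close>

text \<open>Since \<open>ad P = P \<times>\<^sub>A\<^sub>d \<gg>\<close>, a section of \<open>\<Lambda>\<^sup>kT\<^sup>*W \<otimes> ad P\<close> is a function assigning to \<open>p \<in> P\<close> a
  \<open>\<gg>\<close>-valued \<open>k\<close>-form on \<open>T\<^sub>\<pi>\<^sub>pW\<close>, equivariantly for the right action on \<open>P\<close> and \<open>Ad\<close> on \<open>\<gg>\<close>.
  Horizontal forms are those annihilated by contraction with \<open>v\<close>.\<close>

definition Omega0 :: "('p \<Rightarrow> 'l) set" where
  "Omega0 = {\<xi>. smooth_fun_on P UNIV \<xi> \<and> (\<forall>p a. \<xi> (act p a) = Ad G L (inv\<^bsub>G\<^esub> a) (\<xi> p))}"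

definition Omega1 :: "('p \<Rightarrow> 'l form1) set" where
  "Omega1 = {\<alpha> :: 'p \<Rightarrow> 'l form1.
     (\<forall>c\<in>W. \<forall>u. smooth_fun_on P (\<pi> -` fst c) (\<lambda>q. \<alpha> q (coord_field W c u (\<pi> q)))) \<and>
     (\<forall>p a X. \<alpha> (act p a) X = Ad G L (inv\<^bsub>G\<^esub> a) (\<alpha> p X))}"

definition Omega2 :: "('p \<Rightarrow> 'l form2) set" where
  "Omega2 = {\<omega> :: 'p \<Rightarrow> 'l form2. (\<forall>p. alternating (\<omega> p)) \<and>
     (\<forall>c\<in>W. \<forall>u w. smooth_fun_on P (\<pi> -` fst c)
        (\<lambda>q. \<omega> q (coord_field W c u (\<pi> q)) (coord_field W c w (\<pi> q)))) \<and>
     (\<forall>p a X Y. \<omega> (act p a) X Y = Ad G L (inv\<^bsub>G\<^esub> a) (\<omega> p X Y))}"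

definition Lambda1_h :: "'p \<Rightarrow> 'l form1 set" where
  "Lambda1_h p = {\<alpha> :: 'l form1. \<alpha> (v (\<pi> p)) = 0}"

definition Lambda2_plus :: "'p \<Rightarrow> 'l form2 set" where
  "Lambda2_plus p = star_eigenforms (g (\<pi> p)) (v (\<pi> p)) 1"

definition Omega2_plus :: "('p \<Rightarrow> 'l form2) set" where
  "Omega2_plus = {\<omega> \<in> Omega2. \<forall>p. \<omega> p \<in> Lambda2_plus p}"

definition Omega1_Omega2_plus :: "('p \<Rightarrow> 'l form1 \<times> 'l form2) set" where
  "Omega1_Omega2_plus = {s. fst \<circ> s \<in> Omega1 \<and> snd \<circ> s \<in> Omega2_plus}"

subsection \<open>Connections and curvature\<close>

definition fundamental_field :: "'l \<Rightarrow> 'p \<Rightarrow> 'k" where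
  "fundamental_field X p = tangent_map L P (act p) \<one>\<^bsub>G\<^esub> X"

definition connections :: "('p \<Rightarrow> 'k \<Rightarrow>\<^sub>L 'l) set" where
  "connections = {A :: 'p \<Rightarrow> 'k \<Rightarrow>\<^sub>L 'l.
     (\<forall>c\<in>P. \<forall>u. smooth_fun_on P (fst c) (\<lambda>q. A q (coord_field P c u q))) \<and>
     (\<forall>p X. A p (fundamental_field X p) = X) \<and>
     (\<forall>p a u. A (act p a) (tangent_map P P (\<lambda>q. act q a) p u) = Ad G L (inv\<^bsub>G\<^esub> a) (A p u))}"

definition horizontal_lift :: "('p \<Rightarrow> 'k \<Rightarrow>\<^sub>L 'l) \<Rightarrow> 'p \<Rightarrow> real^5 \<Rightarrow> 'k" where
  "horizontal_lift A p X = (THE u. tangent_map P W \<pi> p u = X \<and> A p u = 0)"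

definition ext_deriv :: "('p \<Rightarrow> 'k \<Rightarrow>\<^sub>L 'l) \<Rightarrow> 'p \<Rightarrow> 'k \<Rightarrow> 'k \<Rightarrow> 'l" where
  "ext_deriv A p u w = (let c = chart_at P p in
     deriv_fun P (\<lambda>q. A q (coord_field P c w q)) p u -
     deriv_fun P (\<lambda>q. A q (coord_field P c u q)) p w)"

definition curvature :: "('p \<Rightarrow> 'k \<Rightarrow>\<^sub>L 'l) \<Rightarrow> 'p \<Rightarrow> 'l form2" where
  "curvature A p = Form2 (\<lambda>X Y.
     let u = horizontal_lift A p X; w = horizontal_lift A p Y
     in ext_deriv A p u w + bracket (A p u) (A p w))"

definition translate ::
  "('p \<Rightarrow> 'k \<Rightarrow>\<^sub>L 'l) \<Rightarrow> ('p \<Rightarrow> 'l form1) \<Rightarrow> 'p \<Rightarrow> 'k \<Rightarrow>\<^sub>L 'l" where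
  "translate A \<alpha> p = A p + (\<alpha> p o\<^sub>L Blinfun (tangent_map P W \<pi> p))"

definition d_conn :: "('p \<Rightarrow> 'k \<Rightarrow>\<^sub>L 'l) \<Rightarrow> ('p \<Rightarrow> 'l) \<Rightarrow> 'p \<Rightarrow> 'l form1" where
  "d_conn A \<xi> p = Blinfun (\<lambda>X. deriv_fun P \<xi> p (horizontal_lift A p X))"

subsection \<open>Covariant derivative of sections of \<open>\<Lambda>\<^sup>2\<^sub>+H\<^sup>* \<otimes> ad P\<close>\<close>

definition h_proj :: "'w \<Rightarrow> real^5 \<Rightarrow> real^5" where
  "h_proj x X = X - g x (v x) X *\<^sub>R v x"

definition nabla_form :: "('p \<Rightarrow> 'k \<Rightarrow>\<^sub>L 'l) \<Rightarrow> ('p \<Rightarrow> 'l form2) \<Rightarrow> 'p \<Rightarrow> real^5 \<Rightarrow> 'l form2" where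
  "nabla_form A B p X = Form2 (\<lambda>Y Z. let x = \<pi> p; c = chart_at W x in
     deriv_fun P (\<lambda>q. B q (coord_field W c Y (\<pi> q)) (coord_field W c Z (\<pi> q))) p
       (horizontal_lift A p X)
     - B p (christoffel W g x X Y) Z - B p Y (christoffel W g x X Z))"

text \<open>The Levi-Civita connection induces on \<open>H\<close> the connection \<open>pr\<^sub>H \<circ> \<nabla>\<close>, and thereby one on
  \<open>\<Lambda>\<^sup>2H\<^sup>*\<close>, which preserves \<open>\<Lambda>\<^sup>2\<^sub>+H\<^sup>*\<close>. For \<open>\<omega>\<close> with \<open>\<iota>\<^sub>v \<omega> = 0\<close> and \<open>Y, Z\<close> in \<open>H\<close> it is
  \<open>X(\<omega>(Y,Z)) - \<omega>(pr\<^sub>H \<nabla>\<^sub>X Y, Z) - \<omega>(Y, pr\<^sub>H \<nabla>\<^sub>X Z) = (\<nabla>\<^sub>X \<omega>)(Y,Z)\<close>; forms on \<open>H\<close> are extended by zero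
  on \<open>v\<close>.\<close>

definition nabla :: "('p \<Rightarrow> 'k \<Rightarrow>\<^sub>L 'l) \<Rightarrow> ('p \<Rightarrow> 'l form2) \<Rightarrow> 'p \<Rightarrow> real^5 \<Rightarrow> 'l form2" where
  "nabla A B p X = Form2 (\<lambda>Y Z. nabla_form A B p X (h_proj (\<pi> p) Y) (h_proj (\<pi> p) Z))"

definition delta_plus :: "('p \<Rightarrow> 'k \<Rightarrow>\<^sub>L 'l) \<Rightarrow> ('p \<Rightarrow> 'l form2) \<Rightarrow> 'p \<Rightarrow> 'l form1" where
  "delta_plus A B p = (let e = SOME e. oriented_frame (g (\<pi> p)) e in
     - (\<Sum>i\<in>UNIV. blinfun_apply (nabla A B p (e $ i)) (e $ i)))"

subsection \<open>The map \<open>\<Phi>\<close> and the deformation complex\<close>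

definition Phi :: "('p \<Rightarrow> 'k \<Rightarrow>\<^sub>L 'l) \<Rightarrow> ('p \<Rightarrow> 'l form2) \<Rightarrow> 'p \<Rightarrow> 'l form1 \<times> 'l form2" where
  "Phi A B p = (let x = \<pi> p in
     (blinfun_apply (curvature A p) (v x) - delta_plus A B p,
      plus_part (g x) (v x) (curvature A p) - nabla A B p (v x)
        - sigma (g x) (v x) bracket (B p) (B p)))"

definition dPhi ::
  "('p \<Rightarrow> 'k \<Rightarrow>\<^sub>L 'l) \<Rightarrow> ('p \<Rightarrow> 'l form2) \<Rightarrow> ('p \<Rightarrow> 'l form1 \<times> 'l form2) \<Rightarrow>
   'p \<Rightarrow> 'l form1 \<times> 'l form2" where
  "dPhi A B s p = vector_derivative
     (\<lambda>t. Phi (translate A (\<lambda>q. t *\<^sub>R fst (s q))) (\<lambda>q. B q + t *\<^sub>R snd (s q)) p) (at 0)"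

definition K ::
  "('p \<Rightarrow> 'k \<Rightarrow>\<^sub>L 'l) \<Rightarrow> ('p \<Rightarrow> 'l form2) \<Rightarrow> ('p \<Rightarrow> 'l) \<Rightarrow> 'p \<Rightarrow> 'l form1 \<times> 'l form2" where
  "K A B \<xi> p = (d_conn A \<xi> p, Form2 (\<lambda>X Y. bracket (B p X Y) (\<xi> p)))"

end

end

theory Submission
  imports Defs
begin

text \<open>Fix a point, a covector \<open>\<zeta>\<close> and an oriented orthonormal frame with \<open>e\<^sub>5 = v\<close>, and split
  \<open>\<zeta> = \<zeta>\<^sub>h + c \<eta>\<close>. The symbol of \<open>K\<close> is \<open>\<xi> \<mapsto> (\<zeta> \<otimes> \<xi>, 0)\<close>. The terms of \<open>\<delta>\<Phi>\<close> that come from the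
  variation of the horizontal lift, from the Christoffel symbols and from \<open>\<sigma>\<close> are algebraic, so that the
  symbol of \<open>\<delta>\<Phi>\<close> is \<open>(\<alpha>, b) \<mapsto> (c \<alpha> - \<alpha>(v) \<zeta> + \<iota>\<^sub>\<zeta> b, (\<zeta> \<and> \<alpha>)\<^sup>+ - c b)\<close>. For self-dual \<open>b\<close> one has
  \<open>(\<zeta>\<^sub>h \<and> \<iota>\<^sub>\<zeta> b)\<^sup>+ = |\<zeta>\<^sub>h|\<^sup>2 b / 2\<close>; wedging the first component with \<open>\<zeta>\<^sub>h\<close> and using the second therefore
  determines \<open>(c\<^sup>2 + |\<zeta>\<^sub>h|\<^sup>2/2) b\<close>, and then \<open>\<alpha>\<close> up to multiples of \<open>\<zeta>\<close>.

  As the symbol is defined through sections, every element of a fibre has to be extended to a smooth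
  equivariant section: this is done with bump functions, the adjoint action in a local
  trivialization, and, for self-dual forms, smooth adapted frames obtained by Gram-Schmidt.\<close>

section \<open>Calculus of smooth functions\<close>

text \<open>Surjectivity has the same source as the kernel computation. For self-dual b put C b =
  \<iota>_\<zeta> b, in the components used below. Then (\<zeta>_h \<and> a)^+ is half of C^T a,
  while C^T C = |\<zeta>_h|^2 and C^T \<zeta>_h = 0. On pairs (a, b) with a horizontal the symbol is
  the block matrix T with rows (c, C) and (C^T/2, -c), and T^2 is the scalar c^2 + |\<zeta>_h|^2/2
  except for a rank-one defect along \<zeta>_h on 1-forms. The term -\<alpha>(v) \<zeta> repairs
  exactly this defect.

  Two obstacles shape the rest. The identification of tangent spaces with R^5 jumps from point to
  point, so smoothness and orientation have to be read in a fixed chart near the point considered.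
  The operators contain chosen frames and definite descriptions, so existence, uniqueness and, for
  traces and the Hodge star, independence of the frame come before any computation. Once they are
  settled, the curves differentiated in \<delta>\<Phi> have polynomial values in t, and linearizing
  is algebra.\<close>

lemma finite_dim_coordinates:
  "\<exists>C d. finite C \<and> (\<forall>x::'a::finite_dim_inner. x = (\<Sum>c\<in>C. (x \<bullet> d c) *\<^sub>R c))"
proof -
  obtain B :: "'a set" where B: "finite B" "\<And>x. \<exists>c. x = (\<Sum>b\<in>B. c b *\<^sub>R b)"
    using finite_dim by blast
  obtain C where C: "finite C" "span C = span B" "pairwise orthogonal C"
    using basis_orthogonal[OF B(1)] by blast
  \<comment> \<open>Coefficients with respect to an orthogonal spanning set. The zero vector may
    belong to \<open>C\<close>: its coefficient is then 0 by division by zero, and its term vanishes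
    in any case.\<close>
  have "x = (\<Sum>c\<in>C. (x \<bullet> (c /\<^sub>R (c \<bullet> c))) *\<^sub>R c)" for x
  proof -
    have "x \<in> span B"
      using B(2)[of x] by (metis (no_types, lifting) span_base span_scale span_sum)
    then obtain u where u: "x = (\<Sum>c\<in>C. u c *\<^sub>R c)"
      using C(1,2) span_finite[OF C(1)] by (metis (no_types, lifting) rangeE)
    have "x \<bullet> c = u c * (c \<bullet> c)" if "c \<in> C" for c
    proof -
      have "x \<bullet> c = (\<Sum>b\<in>C. u b * (b \<bullet> c))"
        unfolding u by (simp add: inner_sum_left)
      also have "\<dots> = (\<Sum>b\<in>C. if b = c then u c * (c \<bullet> c) else 0)"
        using C(3) that by (intro sum.cong) (auto simp: pairwise_def orthogonal_def)
      finally show ?thesis using C(1) that by simp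
    qed
    then have *: "(x \<bullet> (c /\<^sub>R (c \<bullet> c))) *\<^sub>R c = u c *\<^sub>R c" if "c \<in> C" for c
      using that by (cases "c = 0") (auto simp: field_simps)
    then have "(\<Sum>c\<in>C. (x \<bullet> (c /\<^sub>R (c \<bullet> c))) *\<^sub>R c) = (\<Sum>c\<in>C. u c *\<^sub>R c)"
      by (intro sum.cong refl) (rule *)
    then show ?thesis using u by simp
  qed
  then show ?thesis
    using C(1) by (intro exI[of _ C] exI[of _ "\<lambda>c. c /\<^sub>R (c \<bullet> c)"] conjI allI)
qed

text \<open>Product charts take values in the product of the model spaces, and composition with a
  map out of a product manifold requires that space to be in the class.\<close>

instance prod :: (finite_dim_inner, finite_dim_inner) finite_dim_inner
proof
  obtain C d where C: "finite C" "\<And>x::'a. x = (\<Sum>c\<in>C. (x \<bullet> d c) *\<^sub>R c)"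
    using finite_dim_coordinates by blast
  obtain C' d' where C': "finite C'" "\<And>x::'b. x = (\<Sum>c\<in>C'. (x \<bullet> d' c) *\<^sub>R c)"
    using finite_dim_coordinates by blast
  \<comment> \<open>Removing 0 from the second family makes the two images disjoint, and
    \<open>snd b = 0\<close> then tells to which of them b belongs.\<close>
  let ?B = "(\<lambda>c. (c, 0)) ` C \<union> (\<lambda>c. (0, c)) ` (C' - {0})"
  have "\<exists>c. x = (\<Sum>b\<in>?B. c b *\<^sub>R b)" for x :: "'a \<times> 'b"
  proof
    let ?c = "\<lambda>b. if snd b = 0 then fst x \<bullet> d (fst b) else snd x \<bullet> d' (snd b)"
    have "(\<Sum>b\<in>?B. ?c b *\<^sub>R b) = (\<Sum>b\<in>(\<lambda>c. (c, 0)) ` C. ?c b *\<^sub>R b) + (\<Sum>b\<in>(\<lambda>c. (0, c)) ` (C' - {0}). ?c b *\<^sub>R b)"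
      using C(1) C'(1) by (intro sum.union_disjoint) auto
    also have "\<dots> = (\<Sum>c\<in>C. (fst x \<bullet> d c) *\<^sub>R (c, 0)) + (\<Sum>c\<in>C'-{0}. (snd x \<bullet> d' c) *\<^sub>R (0, c))"
      by (subst sum.reindex, simp add: inj_on_def, subst sum.reindex, simp add: inj_on_def) (simp add: o_def)
    also have "(\<Sum>c\<in>C'-{0}. (snd x \<bullet> d' c) *\<^sub>R ((0::'a), c)) = (\<Sum>c\<in>C'. (snd x \<bullet> d' c) *\<^sub>R (0, c))"
      using C'(1) by (intro sum.mono_neutral_left) (auto simp: zero_prod_def)
    also have "(\<Sum>c\<in>C. (fst x \<bullet> d c) *\<^sub>R (c, 0::'b)) + (\<Sum>c\<in>C'. (snd x \<bullet> d' c) *\<^sub>R (0, c)) = x"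
    proof (rule prod_eqI)
      show "fst ((\<Sum>c\<in>C. (fst x \<bullet> d c) *\<^sub>R (c, 0::'b)) + (\<Sum>c\<in>C'. (snd x \<bullet> d' c) *\<^sub>R (0, c))) = fst x"
        by (simp add: fst_sum C(2)[symmetric])
      show "snd ((\<Sum>c\<in>C. (fst x \<bullet> d c) *\<^sub>R (c, 0::'b)) + (\<Sum>c\<in>C'. (snd x \<bullet> d' c) *\<^sub>R (0, c))) = snd x"
        by (simp add: snd_sum C'(2)[symmetric])
    qed
    finally show "x = (\<Sum>b\<in>?B. ?c b *\<^sub>R b)" by simp
  qed
  then show "\<exists>B. finite B \<and> (\<forall>x::'a \<times> 'b. \<exists>c. x = (\<Sum>b\<in>B. c b *\<^sub>R b))"
    using C(1) C'(1) by (intro exI[of _ ?B]) simp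
qed

lemma linear_imp_bounded_linear:
  fixes f :: "'a::finite_dim_inner \<Rightarrow> 'b::real_normed_vector"
  assumes "linear f" shows "bounded_linear f"
proof -
  obtain C d where C: "finite C" "\<And>x::'a. x = (\<Sum>c\<in>C. (x \<bullet> d c) *\<^sub>R c)"
    using finite_dim_coordinates by blast
  have "f = (\<lambda>x. \<Sum>c\<in>C. (x \<bullet> d c) *\<^sub>R f c)"
  proof
    fix x
    have "f x = f (\<Sum>c\<in>C. (x \<bullet> d c) *\<^sub>R c)" using C(2) by metis
    then show "f x = (\<Sum>c\<in>C. (x \<bullet> d c) *\<^sub>R f c)"
      using assms by (simp add: linear_sum linear_scale)
  qed
  moreover have "bounded_linear (\<lambda>x. \<Sum>c\<in>C. (x \<bullet> d c) *\<^sub>R f c)"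
    by (intro bounded_linear_sum bounded_linear_scaleR_const bounded_linear_inner_left)
  ultimately show ?thesis by simp
qed

section \<open>Differentiability of finite order and its closure properties\<close>

lemma ck_on_imp_continuous: "ck_on k S f \<Longrightarrow> continuous_on S f"
  by (cases k) (auto intro: differentiable_imp_continuous_on)

lemma ck_on_SucD: "ck_on (Suc k) S f \<Longrightarrow> ck_on k S f"
proof (induction k arbitrary: f)
  case 0
  then show ?case by (auto intro: differentiable_imp_continuous_on)
next
  case (Suc k)
  then show ?case by (metis ck_on.simps(2))
qed

lemma ck_on_subset: "ck_on k S f \<Longrightarrow> T \<subseteq> S \<Longrightarrow> ck_on k T f"
  by (induction k arbitrary: f) (auto intro: continuous_on_subset differentiable_on_subset)

lemma ck_on_differentiable_at:
  "ck_on (Suc k) S f \<Longrightarrow> open S \<Longrightarrow> x \<in> S \<Longrightarrow> f differentiable (at x)"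
  by (auto simp: differentiable_on_eq_differentiable_at)

text \<open>The derivative in \<open>ck_on\<close> is taken at x in the whole space and not within
  S, hence it is the same for every neighbourhood of x.\<close>

lemma ck_on_local:
  assumes "\<And>x. x \<in> S \<Longrightarrow> \<exists>V. open V \<and> x \<in> V \<and> ck_on k V f"
  shows "ck_on k S f"
  using assms
proof (induction k arbitrary: f)
  case 0
  then show ?case
    by (metis ck_on.simps(1) continuous_at_imp_continuous_on continuous_on_eq_continuous_at)
next
  case (Suc k)
  have "f differentiable (at x)" if "x \<in> S" for x
    using Suc.prems[OF that] ck_on_differentiable_at by blast
  then have "f differentiable_on S"
    by (simp add: differentiable_at_imp_differentiable_on)
  moreover have "ck_on k S (\<lambda>x. frechet_derivative f (at x) u)" for u
  proof (rule Suc.IH)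
    fix x assume "x \<in> S"
    then show "\<exists>V. open V \<and> x \<in> V \<and> ck_on k V (\<lambda>x. frechet_derivative f (at x) u)"
      using Suc.prems[of x] by auto
  qed
  ultimately show ?case by simp
qed

lemma ck_on_cong:
  assumes "ck_on k S f" "open S" "\<And>x. x \<in> S \<Longrightarrow> f x = g x"
  shows "ck_on k S g"
  using assms
proof (induction k arbitrary: f g)
  case 0
  then show ?case using continuous_on_cong by force
next
  case (Suc k)
  have d: "f differentiable (at x)" if "x \<in> S" for x
    using Suc.prems ck_on_differentiable_at that by blast
  have eq: "frechet_derivative f (at x) = frechet_derivative g (at x)" if "x \<in> S" for x
    using frechet_derivative_transform_within_open[OF d[OF that] Suc.prems(2) that] Suc.prems(3) by blast
  have "g differentiable (at x)" if "x \<in> S" for x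
    using d[OF that] Suc.prems(2,3) that
    by (meson differentiable_def has_derivative_transform_within_open)
  then have "g differentiable_on S"
    by (simp add: differentiable_at_imp_differentiable_on)
  moreover have "ck_on k S (\<lambda>x. frechet_derivative g (at x) u)" for u
    using Suc.IH[of "\<lambda>x. frechet_derivative f (at x) u" "\<lambda>x. frechet_derivative g (at x) u"] Suc.prems eq by simp
  ultimately show ?case by simp
qed

text \<open>Lets a proof name its derivative instead of handling \<open>frechet_derivative\<close>;
  the closure properties below are inductions on k through this rule.\<close>

lemma ck_on_SucI:
  assumes "open S" "\<And>x. x \<in> S \<Longrightarrow> (f has_derivative D x) (at x)" "\<And>u. ck_on k S (\<lambda>x. D x u)"
  shows "ck_on (Suc k) S f"
proof -
  have "ck_on k S (\<lambda>x. frechet_derivative f (at x) u)" for u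
  proof (rule ck_on_cong[OF assms(3)[of u] assms(1)])
    show "D x u = frechet_derivative f (at x) u" if "x \<in> S" for x
      using frechet_derivative_at[OF assms(2)[OF that]] by simp
  qed
  moreover have "f differentiable_on S"
    by (rule differentiable_at_imp_differentiable_on) (rule differentiableI[OF assms(2)])
  ultimately show ?thesis by simp
qed

lemma ck_on_has_derivative:
  "ck_on (Suc k) S f \<Longrightarrow> open S \<Longrightarrow> x \<in> S \<Longrightarrow> (f has_derivative frechet_derivative f (at x)) (at x)"
  using ck_on_differentiable_at frechet_derivative_works by blast

lemma ck_on_const: "open S \<Longrightarrow> ck_on k S (\<lambda>x. c)"
proof (induction k arbitrary: c)
  case (Suc k)
  show ?case by (rule ck_on_SucI[where D = "\<lambda>x u. 0"]) (use Suc in auto)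
qed auto

lemma ck_on_bounded_linear:
  assumes L: "bounded_linear L" and S: "open S" and f: "ck_on k S f"
  shows "ck_on k S (\<lambda>x. L (f x))"
  using f
proof (induction k arbitrary: f)
  case 0
  then show ?case using L by (simp add: bounded_linear.continuous_on)
next
  case (Suc k)
  show ?case
  proof (rule ck_on_SucI[OF S])
    show "((\<lambda>x. L (f x)) has_derivative (\<lambda>u. L (frechet_derivative f (at x) u))) (at x)" if "x \<in> S" for x
      using ck_on_has_derivative[OF Suc.prems S that] L by (rule bounded_linear.has_derivative[rotated])
    show "ck_on k S (\<lambda>x. L (frechet_derivative f (at x) u))" for u
      using Suc by simp
  qed
qed

lemma ck_on_add:
  assumes "open S" "ck_on k S f" "ck_on k S g"
  shows "ck_on k S (\<lambda>x. f x + g x)"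
  using assms(2,3)
proof (induction k arbitrary: f g)
  case 0
  then show ?case by (simp add: continuous_on_add)
next
  case (Suc k)
  show ?case
  proof (rule ck_on_SucI[OF assms(1)])
    show "((\<lambda>x. f x + g x) has_derivative (\<lambda>u. frechet_derivative f (at x) u + frechet_derivative g (at x) u)) (at x)" if "x \<in> S" for x
      using ck_on_has_derivative Suc.prems assms(1) that by (intro has_derivative_add) auto
    show "ck_on k S (\<lambda>x. frechet_derivative f (at x) u + frechet_derivative g (at x) u)" for u
      using Suc by simp
  qed
qed

lemma ck_on_sum:
  assumes "open S" "\<And>i. i \<in> I \<Longrightarrow> ck_on k S (f i)"
  shows "ck_on k S (\<lambda>x. \<Sum>i\<in>I. f i x)"
  using assms(2) by (induction I rule: infinite_finite_induct) (auto intro: ck_on_add ck_on_const assms(1))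

lemma ck_on_bounded_bilinear:
  assumes b: "bounded_bilinear b" and S: "open S" and "ck_on k S f" "ck_on k S g"
  shows "ck_on k S (\<lambda>x. b (f x) (g x))"
  using assms(3,4)
proof (induction k arbitrary: f g)
  case 0
  then show ?case using b by (simp add: bounded_bilinear.continuous_on)
next
  case (Suc k)
  show ?case
  proof (rule ck_on_SucI[OF S])
    show "((\<lambda>x. b (f x) (g x)) has_derivative (\<lambda>u. b (f x) (frechet_derivative g (at x) u) + b (frechet_derivative f (at x) u) (g x))) (at x)"
      if "x \<in> S" for x
      using bounded_bilinear.FDERIV[OF b ck_on_has_derivative[OF Suc.prems(1) S that] ck_on_has_derivative[OF Suc.prems(2) S that]] .
    show "ck_on k S (\<lambda>x. b (f x) (frechet_derivative g (at x) u) + b (frechet_derivative f (at x) u) (g x))" for u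
      using Suc.prems by (intro ck_on_add[OF S Suc.IH Suc.IH] ck_on_SucD[OF Suc.prems(1)] ck_on_SucD[OF Suc.prems(2)]) simp_all
  qed
qed

text \<open>In the chain rule the direction f'(x) u at which g' is evaluated moves with x, whereas
  \<open>ck_on\<close> controls g' in constant directions only. Expanding f'(x) u in finitely many
  coordinates gives a sum of products to which the induction hypothesis applies.\<close>

lemma ck_on_compose:
  fixes f :: "'a::real_normed_vector \<Rightarrow> 'b::finite_dim_inner" and g :: "'b \<Rightarrow> 'c::real_normed_vector"
  assumes "ck_on k S f" "ck_on k T g" "f ` S \<subseteq> T" "open S" "open T"
  shows "ck_on k S (\<lambda>x. g (f x))"
  using assms(1,2)
proof (induction k arbitrary: g)
  case 0
  then show ?case using assms(3) by (auto intro: continuous_on_compose2)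
next
  case (Suc k)
  obtain C d where C: "finite C" "\<And>x::'b. x = (\<Sum>c\<in>C. (x \<bullet> d c) *\<^sub>R c)"
    using finite_dim_coordinates by blast
  let ?D = "\<lambda>x u. \<Sum>c\<in>C. (frechet_derivative f (at x) u \<bullet> d c) *\<^sub>R frechet_derivative g (at (f x)) c"
  show ?case
  proof (rule ck_on_SucI[OF assms(4)])
    show "((\<lambda>x. g (f x)) has_derivative ?D x) (at x)" if x: "x \<in> S" for x
    proof -
      have g': "(g has_derivative frechet_derivative g (at (f x))) (at (f x))"
        using ck_on_has_derivative[OF Suc.prems(2) assms(5)] x assms(3) by blast
      have "?D x u = frechet_derivative g (at (f x)) (frechet_derivative f (at x) u)" for u
      proof -
        have "frechet_derivative g (at (f x)) (frechet_derivative f (at x) u)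
          = frechet_derivative g (at (f x)) (\<Sum>c\<in>C. (frechet_derivative f (at x) u \<bullet> d c) *\<^sub>R c)"
          using C(2) by metis
        then show ?thesis
          using has_derivative_linear[OF g'] by (simp add: linear_sum linear_scale)
      qed
      then show ?thesis
        using has_derivative_compose[OF ck_on_has_derivative[OF Suc.prems(1) assms(4) x] g'] by simp
    qed
    show "ck_on k S (\<lambda>x. ?D x u)" for u
    proof (intro ck_on_sum assms ck_on_bounded_bilinear[OF bounded_bilinear_scaleR])
      fix c assume "c \<in> C"
      show "ck_on k S (\<lambda>x. frechet_derivative f (at x) u \<bullet> d c)"
        using Suc.prems(1) by (intro ck_on_bounded_linear[OF bounded_linear_inner_left] assms) simp
      show "ck_on k S (\<lambda>x. frechet_derivative g (at (f x)) c)"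
        using Suc.prems by (intro Suc.IH ck_on_SucD[OF Suc.prems(1)]) simp
    qed
  qed
qed

section \<open>Smooth functions on open sets\<close>

lemma smooth_on_subset: "smooth_on S f \<Longrightarrow> T \<subseteq> S \<Longrightarrow> smooth_on T f"
  by (auto simp: smooth_on_def intro: ck_on_subset)

lemma smooth_on_local:
  "(\<And>x. x \<in> S \<Longrightarrow> \<exists>V. open V \<and> x \<in> V \<and> smooth_on V f) \<Longrightarrow> smooth_on S f"
  unfolding smooth_on_def by (meson ck_on_local)

lemma smooth_on_cong:
  "smooth_on S f \<Longrightarrow> open S \<Longrightarrow> (\<And>x. x \<in> S \<Longrightarrow> f x = g x) \<Longrightarrow> smooth_on S g"
  by (auto simp: smooth_on_def intro: ck_on_cong)

lemma smooth_on_imp_continuous: "smooth_on S f \<Longrightarrow> continuous_on S f"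
  by (auto simp: smooth_on_def intro: ck_on_imp_continuous)

lemma smooth_on_has_derivative:
  "smooth_on S f \<Longrightarrow> open S \<Longrightarrow> x \<in> S \<Longrightarrow> (f has_derivative frechet_derivative f (at x)) (at x)"
  unfolding smooth_on_def using ck_on_has_derivative by blast

lemma smooth_on_derivative: "smooth_on S f \<Longrightarrow> smooth_on S (\<lambda>x. frechet_derivative f (at x) u)"
  unfolding smooth_on_def by (metis ck_on.simps(2))

lemma smooth_on_const: "open S \<Longrightarrow> smooth_on S (\<lambda>x. c)"
  by (simp add: smooth_on_def ck_on_const)

lemma smooth_on_bounded_linear:
  "bounded_linear L \<Longrightarrow> open S \<Longrightarrow> smooth_on S f \<Longrightarrow> smooth_on S (\<lambda>x. L (f x))"
  by (simp add: smooth_on_def ck_on_bounded_linear)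

lemma smooth_on_id: "open S \<Longrightarrow> smooth_on S (\<lambda>x. x)"
  unfolding smooth_on_def
proof
  fix k :: nat assume S: "open S"
  show "ck_on k S (\<lambda>x. x)"
    by (cases k) (auto intro!: ck_on_SucI[OF S, where D = "\<lambda>x u. u"] ck_on_const S simp del: ck_on.simps(2))
qed

lemma smooth_on_linear: "bounded_linear L \<Longrightarrow> open S \<Longrightarrow> smooth_on S L"
  using smooth_on_bounded_linear[OF _ _ smooth_on_id] .

lemma smooth_on_add: "open S \<Longrightarrow> smooth_on S f \<Longrightarrow> smooth_on S g \<Longrightarrow> smooth_on S (\<lambda>x. f x + g x)"
  by (simp add: smooth_on_def ck_on_add)

lemma smooth_on_sum:
  "open S \<Longrightarrow> (\<And>i. i \<in> I \<Longrightarrow> smooth_on S (f i)) \<Longrightarrow> smooth_on S (\<lambda>x. \<Sum>i\<in>I. f i x)"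
  by (simp add: smooth_on_def ck_on_sum)

lemma smooth_on_bounded_bilinear:
  "bounded_bilinear b \<Longrightarrow> open S \<Longrightarrow> smooth_on S f \<Longrightarrow> smooth_on S g \<Longrightarrow> smooth_on S (\<lambda>x. b (f x) (g x))"
  by (simp add: smooth_on_def ck_on_bounded_bilinear)

lemmas smooth_on_inner = smooth_on_bounded_bilinear[OF bounded_bilinear_inner]

lemma smooth_on_diff:
  assumes "open S" "smooth_on S f" "smooth_on S g"
  shows "smooth_on S (\<lambda>x. f x - g x)"
  using smooth_on_add[OF assms(1,2) smooth_on_bounded_linear[OF bounded_linear_minus[OF bounded_linear_ident] assms(1,3)]] by simp

lemma smooth_on_compose:
  fixes f :: "'a::real_normed_vector \<Rightarrow> 'b::finite_dim_inner" and g :: "'b \<Rightarrow> 'c::real_normed_vector"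
  shows "smooth_on S f \<Longrightarrow> smooth_on T g \<Longrightarrow> f ` S \<subseteq> T \<Longrightarrow> open S \<Longrightarrow> open T \<Longrightarrow>
    smooth_on S (\<lambda>x. g (f x))"
  unfolding smooth_on_def by (auto intro: ck_on_compose[where T = T])

lemma smooth_on_Pair:
  assumes "open S" "smooth_on S f" "smooth_on S g"
  shows "smooth_on S (\<lambda>x. (f x, g x))"
proof -
  have 1: "bounded_linear (\<lambda>x. (x, 0))" "bounded_linear (\<lambda>x. (0, x))"
    by (auto intro: bounded_linear_Pair bounded_linear_ident bounded_linear_zero)
  show ?thesis
    using smooth_on_add[OF assms(1) smooth_on_bounded_linear[OF 1(1) assms(1,2)] smooth_on_bounded_linear[OF 1(2) assms(1,3)]]
    by simp
qed

section \<open>Reciprocals, square roots and bump functions\<close>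

lemma smooth_on_inverse: "smooth_on {x::real. x \<noteq> 0} inverse"
  unfolding smooth_on_def
proof
  have S: "open {x::real. x \<noteq> 0}" by (simp add: open_Collect_neq)
  show "ck_on k {x::real. x \<noteq> 0} inverse" for k
  proof (induction k)
    case 0
    then show ?case by (auto intro: continuous_intros)
  next
    case (Suc k)
    show ?case
    proof (rule ck_on_SucI[OF S])
      show "(inverse has_derivative (\<lambda>u. (- u) *\<^sub>R (inverse x * inverse x))) (at x)" if "x \<in> {x. x \<noteq> 0}" for x :: real
        using that by (auto intro!: derivative_eq_intros simp: power2_eq_square)
      show "ck_on k {x::real. x \<noteq> 0} (\<lambda>x. (- u) *\<^sub>R (inverse x * inverse x))" for u
        by (intro ck_on_bounded_linear[OF bounded_linear_scaleR_right S] ck_on_bounded_bilinear[OF bounded_bilinear_mult S] Suc)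
    qed
  qed
qed

text \<open>The derivative is a multiple of the reciprocal of sqrt itself, so the induction closes
  through \<open>smooth_on_inverse\<close>. Gram-Schmidt with variable vectors divides by such
  roots.\<close>

lemma smooth_on_sqrt: "smooth_on {0<..} sqrt"
  unfolding smooth_on_def
proof
  have S: "open {0::real<..}" by simp
  show "ck_on k {0<..} sqrt" for k
  proof (induction k)
    case 0
    then show ?case by (auto intro: continuous_intros)
  next
    case (Suc k)
    show ?case
    proof (rule ck_on_SucI[OF S])
      show "(sqrt has_derivative (\<lambda>u. (u / 2) *\<^sub>R inverse (sqrt x))) (at x)" if "x \<in> {0<..}" for x :: real
        using that by (auto intro!: derivative_eq_intros simp: field_simps)
      have "ck_on k {0::real<..} (\<lambda>x. inverse (sqrt x))"
        using smooth_on_inverse by (intro ck_on_compose[OF Suc, of "{x. x \<noteq> 0}"]) (auto simp: smooth_on_def open_Collect_neq)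
      then show "ck_on k {0::real<..} (\<lambda>x. (u / 2) *\<^sub>R inverse (sqrt x))" for u
        by (intro ck_on_bounded_linear[OF bounded_linear_scaleR_right S])
    qed
  qed
qed

text \<open>The polynomial factor makes this class of functions closed under differentiation.\<close>

definition flat :: "real poly \<Rightarrow> real \<Rightarrow> real" where
  "flat p t = (if t > 0 then poly p (inverse t) * exp (- inverse t) else 0)"

text \<open>With s = 1/t the limit from the right becomes that of a polynomial in s divided by exp
  s, as s tends to infinity.\<close>

lemma flat_tendsto_0: "(flat p \<longlongrightarrow> 0) (at 0)"
proof -
  have "((\<lambda>s. \<Sum>i\<le>degree p. coeff p i * (s ^ i / exp s)) \<longlongrightarrow> (\<Sum>i\<le>degree p. coeff p i * 0)) at_top"
    by (intro tendsto_sum tendsto_mult_left tendsto_power_div_exp_0)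
  moreover have "(\<Sum>i\<le>degree p. coeff p i * (s ^ i / exp s)) = poly p s * exp (- s)" for s :: real
    unfolding poly_altdef sum_distrib_right by (intro sum.cong) (simp_all add: exp_minus divide_inverse)
  ultimately have "((\<lambda>s. poly p s * exp (- s)) \<longlongrightarrow> 0) at_top" by simp
  then have "((\<lambda>t. poly p (inverse t) * exp (- inverse t)) \<longlongrightarrow> 0) (at_right 0)"
    using filterlim_inverse_at_top_right by (rule filterlim_compose)
  then have "(flat p \<longlongrightarrow> 0) (at_right 0)"
    by (rule Lim_transform_eventually) (auto simp: eventually_at_filter flat_def)
  moreover have "(flat p \<longlongrightarrow> 0) (at_left 0)"
    by (rule tendsto_eventually) (auto simp: eventually_at_filter flat_def)
  ultimately show ?thesis by (simp add: filterlim_split_at)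
qed

lemma flat_has_derivative:
  "(flat p has_derivative (\<lambda>u. u * flat ([:0, 0, 1:] * (p - pderiv p)) t)) (at t)"
proof -
  \<comment> \<open>With s = 1/t one has ds/dt = -s^2 and d/ds (p e^(-s)) = (p' - p) e^(-s); the
    product is s^2 (p - p') e^(-s).\<close>
  let ?q = "[:0, 0, 1:] * (p - pderiv p)"
  consider "t > 0" | "t = 0" | "t < 0" by linarith
  then have "(flat p has_field_derivative flat ?q t) (at t)"
  proof cases
    case 1
    have "((\<lambda>t. poly p (inverse t) * exp (- inverse t)) has_field_derivative flat ?q t) (at t)"
      using 1 by (auto intro!: derivative_eq_intros simp: flat_def field_simps power2_eq_square)
    then show ?thesis
      by (rule has_field_derivative_transform_within_open[of _ _ _ "{0<..}"]) (use 1 in \<open>auto simp: flat_def\<close>)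
  next
    case 2
    have "(flat ([:0, 1:] * p) \<longlongrightarrow> 0) (at 0)" by (rule flat_tendsto_0)
    \<comment> \<open>Dividing by h multiplies the polynomial in 1/h by its variable, so the
      difference quotient at 0 is again a flat function and tends to 0.\<close>
    moreover have "flat ([:0, 1:] * p) = (\<lambda>h. (flat p (0 + h) - flat p 0) / h)"
      by (auto simp: flat_def field_simps)
    ultimately have "((\<lambda>h. (flat p (0 + h) - flat p 0) / h) \<longlongrightarrow> 0) (at 0)" by simp
    then have "(flat p has_field_derivative 0) (at 0)" by (simp add: DERIV_def)
    then show ?thesis using 2 by (simp add: flat_def)
  next
    case 3
    have "((\<lambda>t. 0) has_field_derivative flat ?q t) (at t)"
      using 3 by (auto simp: flat_def)
    then show ?thesis
      by (rule has_field_derivative_transform_within_open[of _ _ _ "{..<0}"]) (use 3 in \<open>auto simp: flat_def\<close>)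
  qed
  then show ?thesis
    by (simp add: has_field_derivative_def mult.commute[of _ "flat _ _"])
qed

lemma smooth_on_flat: "smooth_on UNIV (flat p)"
  unfolding smooth_on_def
proof
  show "ck_on k UNIV (flat p)" for k
  proof (induction k arbitrary: p)
    case 0
    have "isCont (flat p) t" for t
      using flat_has_derivative has_derivative_continuous by blast
    then show ?case by (simp add: continuous_at_imp_continuous_on)
  next
    case (Suc k)
    show ?case
    proof (rule ck_on_SucI)
      show "(flat p has_derivative (\<lambda>u. u *\<^sub>R flat ([:0, 0, 1:] * (p - pderiv p)) t)) (at t)" for t
        using flat_has_derivative by simp
      show "ck_on k UNIV (\<lambda>x. u *\<^sub>R flat ([:0, 0, 1:] * (p - pderiv p)) x)" for u
        by (intro ck_on_bounded_linear[OF bounded_linear_scaleR_right] Suc open_UNIV)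
    qed simp
  qed
qed

text \<open>The flat function is applied to r^2 - |y - y0|^2, which is smooth, instead of r - |y -
  y0|, which is not differentiable at y0.\<close>

lemma exists_bump:
  fixes y0 :: "'a::real_inner"
  assumes "r > 0"
  shows "\<exists>\<beta>::'a \<Rightarrow> real. smooth_on UNIV \<beta> \<and> \<beta> y0 = 1 \<and> (\<forall>y. \<beta> y \<noteq> 0 \<longrightarrow> dist y0 y < r)"
proof -
  let ?n = "\<lambda>y. r\<^sup>2 - (y - y0) \<bullet> (y - y0)"
  let ?\<beta> = "\<lambda>y. (1 / flat 1 (r\<^sup>2)) *\<^sub>R flat 1 (?n y)"
  have n: "smooth_on UNIV ?n"
    by (intro smooth_on_diff smooth_on_inner smooth_on_const smooth_on_id open_UNIV)
  have "smooth_on UNIV (\<lambda>y. flat 1 (?n y))"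
    by (rule smooth_on_compose[OF n smooth_on_flat]) auto
  then have "smooth_on UNIV ?\<beta>"
    by (rule smooth_on_bounded_linear[OF bounded_linear_scaleR_right open_UNIV])
  moreover have "?\<beta> y0 = 1"
    using assms by (simp add: flat_def)
  moreover have "dist y0 y < r" if "?\<beta> y \<noteq> 0" for y
  proof -
    from that have "?n y > 0" by (auto simp: flat_def split: if_splits)
    then have "(norm (y - y0))\<^sup>2 < r\<^sup>2" by (simp add: power2_norm_eq_inner)
    then show ?thesis using assms
      by (metis dist_commute dist_norm less_eq_real_def power2_less_imp_less)
  qed
  ultimately show ?thesis by blast
qed


section \<open>Calculus on manifolds\<close>

definition topological_atlas ::
  "('m::topological_space, 'e::real_normed_vector) chart set \<Rightarrow> bool" where
  "topological_atlas M \<longleftrightarrow> (\<Union>c\<in>M. fst c) = UNIV \<and>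
     (\<forall>c\<in>M. open (fst c) \<and> open (snd c ` fst c) \<and>
        homeomorphism (fst c) (snd c ` fst c) (snd c) (cinv c))"

lemma smooth_atlas_topological: "smooth_atlas M \<Longrightarrow> topological_atlas M"
  by (simp add: smooth_atlas_def topological_atlas_def)

text \<open>A normed space as a manifold with its identity chart: vector-valued functions become
  maps between manifolds and share their composition rule.\<close>

abbreviation vec_atlas :: "('b, 'b) chart set" where
  "vec_atlas \<equiv> {(UNIV, \<lambda>x. x)}"

lemma topological_atlas_vec: "topological_atlas (vec_atlas :: ('b::real_normed_vector, 'b) chart set)"
proof -
  have "inv_into UNIV (\<lambda>x::'b. x) = (\<lambda>x. x)"
    using inv_id by (simp add: id_def)
  then show ?thesis
    by (simp add: topological_atlas_def homeomorphism_def)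
qed

context
  fixes M :: "('m::topological_space, 'e::real_normed_vector) chart set" and c
  assumes M: "topological_atlas M" and c: "c \<in> M"
begin

lemma chart_open: "open (fst c)"
  using M c by (auto simp: topological_atlas_def)

lemma cinv_chart: "x \<in> fst c \<Longrightarrow> cinv c (snd c x) = x"
  using M c by (auto simp: topological_atlas_def homeomorphism_def)

lemma chart_cinv: "y \<in> snd c ` fst c \<Longrightarrow> snd c (cinv c y) = y"
  using M c by (auto simp: topological_atlas_def homeomorphism_def)

lemma continuous_chart: "continuous_on (fst c) (snd c)"
  using M c by (auto simp: topological_atlas_def homeomorphism_def)

lemma continuous_cinv: "continuous_on (snd c ` fst c) (cinv c)"
  using M c by (auto simp: topological_atlas_def homeomorphism_def)

lemma chart_image_open:
  assumes "open S"
  shows "open (snd c ` (fst c \<inter> S))"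
proof -
  have "snd c ` (fst c \<inter> S) = snd c ` fst c \<inter> cinv c -` S"
    using cinv_chart chart_cinv by force
  moreover have "open (snd c ` fst c)"
    using M c by (auto simp: topological_atlas_def)
  ultimately show ?thesis
    using continuous_open_preimage[OF continuous_cinv _ assms] by simp
qed

end

lemma chart_cover: "topological_atlas M \<Longrightarrow> \<exists>c\<in>M. x \<in> fst c"
  by (auto simp: topological_atlas_def)

lemma chart_at:
  assumes "topological_atlas M"
  shows chart_at_mem: "chart_at M x \<in> M" and chart_at_dom: "x \<in> fst (chart_at M x)"
proof -
  have "\<exists>c. c \<in> M \<and> x \<in> fst c" using chart_cover[OF assms] by blast
  from someI_ex[OF this] show "chart_at M x \<in> M" "x \<in> fst (chart_at M x)"
    by (auto simp: chart_at_def)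
qed

section \<open>Smooth maps, smooth functions and composition\<close>

lemma smooth_map_on_subset:
  assumes "smooth_map_on M N S f" "T \<subseteq> S"
  shows "smooth_map_on M N T f"
  unfolding smooth_map_on_def
proof (intro conjI ballI)
  show "continuous_on T f"
    using assms continuous_on_subset unfolding smooth_map_on_def by blast
  fix c d assume "c \<in> M" "d \<in> N"
  then have "smooth_on (snd c ` (fst c \<inter> S \<inter> f -` fst d)) (snd d \<circ> f \<circ> cinv c)"
    using assms(1) unfolding smooth_map_on_def by blast
  then show "smooth_on (snd c ` (fst c \<inter> T \<inter> f -` fst d)) (snd d \<circ> f \<circ> cinv c)"
    by (rule smooth_on_subset) (intro image_mono Int_mono order_refl assms(2))
qed

lemma smooth_fun_on_subset:
  assumes "smooth_fun_on M S f" "T \<subseteq> S"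
  shows "smooth_fun_on M T f"
  unfolding smooth_fun_on_def
proof
  fix c assume "c \<in> M"
  then have "smooth_on (snd c ` (fst c \<inter> S)) (f \<circ> cinv c)"
    using assms(1) unfolding smooth_fun_on_def by blast
  then show "smooth_on (snd c ` (fst c \<inter> T)) (f \<circ> cinv c)"
    by (rule smooth_on_subset) (intro image_mono Int_mono order_refl assms(2))
qed

text \<open>Continuity, a separate clause of \<open>smooth_map_on\<close>, comes for free here: over
  each chart f is the composite of its smooth coordinate expression with the continuous chart
  map.\<close>

lemma smooth_map_on_vec:
  assumes M: "topological_atlas M" and S: "open S"
  shows "smooth_map_on M vec_atlas S f \<longleftrightarrow> smooth_fun_on M S f"
proof -
  have "continuous_on S f" if f: "smooth_fun_on M S f"
  proof -
    have c: "continuous_on (fst c \<inter> S) f" if c: "c \<in> M" for c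
    proof -
      have "continuous_on (snd c ` (fst c \<inter> S)) (f \<circ> cinv c)"
        using f c unfolding smooth_fun_on_def by (blast intro: smooth_on_imp_continuous)
      then have "continuous_on (fst c \<inter> S) ((f \<circ> cinv c) \<circ> snd c)"
        by (rule continuous_on_compose[OF continuous_on_subset[OF continuous_chart[OF M c]], rotated]) auto
      then show ?thesis
        by (rule continuous_on_eq) (auto simp: cinv_chart[OF M c])
    qed
    have "continuous_on (\<Union>c\<in>M. fst c \<inter> S) f"
      using S by (intro continuous_on_open_UN c open_Int chart_open[OF M])
    moreover have "(\<Union>c\<in>M. fst c \<inter> S) = S" using M by (auto simp: topological_atlas_def)
    ultimately show ?thesis by simp
  qed
  then show ?thesis
    by (auto simp: smooth_map_on_def smooth_fun_on_def o_def)
qed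

text \<open>Near each point a chart d of the middle manifold is inserted. Continuity of f makes the
  set where f stays in the domain of d open, and there the composite is a composite of coordinate
  expressions.\<close>

lemma smooth_map_on_compose:
  fixes M :: "('m::topological_space, 'e::real_normed_vector) chart set"
    and N :: "('n::topological_space, 'f::finite_dim_inner) chart set"
    and K :: "('k::topological_space, 'h::real_normed_vector) chart set"
  assumes M: "topological_atlas M" and N: "topological_atlas N" and K: "topological_atlas K"
    and f: "smooth_map_on M N S f" and h: "smooth_map_on N K T h"
    and S: "open S" and T: "open T" and sub: "f ` S \<subseteq> T"
  shows "smooth_map_on M K S (\<lambda>x. h (f x))"
  unfolding smooth_map_on_def
proof (intro conjI ballI)
  have cf: "continuous_on S f" and ch: "continuous_on T h"
    using f h by (auto simp: smooth_map_on_def)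
  show "continuous_on S (\<lambda>x. h (f x))"
    using ch cf sub by (rule continuous_on_compose2)
  fix c e assume c: "c \<in> M" and e: "e \<in> K"
  have U: "open (T \<inter> h -` fst e)"
    using continuous_open_preimage[OF ch T chart_open[OF K e]] .
  show "smooth_on (snd c ` (fst c \<inter> S \<inter> (\<lambda>x. h (f x)) -` fst e)) (snd e \<circ> (\<lambda>x. h (f x)) \<circ> cinv c)"
  proof (rule smooth_on_local)
    fix y assume "y \<in> snd c ` (fst c \<inter> S \<inter> (\<lambda>x. h (f x)) -` fst e)"
    then obtain x where x: "y = snd c x" "x \<in> fst c" "x \<in> S" "h (f x) \<in> fst e" by auto
    obtain d where d: "d \<in> N" "f x \<in> fst d" using chart_cover[OF N] by blast
    define V where "V = snd c ` (fst c \<inter> (S \<inter> f -` (fst d \<inter> (T \<inter> h -` fst e))))"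
    have V: "open V"
      unfolding V_def
      by (intro chart_image_open[OF M c] continuous_open_preimage[OF cf S] open_Int U chart_open[OF N d(1)])
    have 1: "smooth_on V (snd d \<circ> f \<circ> cinv c)"
      using f c d(1) by (auto simp: smooth_map_on_def V_def intro: smooth_on_subset)
    have 2: "smooth_on (snd d ` (fst d \<inter> (T \<inter> h -` fst e))) (snd e \<circ> h \<circ> cinv d)"
      using h e d(1) by (auto simp: smooth_map_on_def Int_assoc)
    have "smooth_on V (\<lambda>y. (snd e \<circ> h \<circ> cinv d) ((snd d \<circ> f \<circ> cinv c) y))"
      using cinv_chart[OF M c]
      by (intro smooth_on_compose[OF 1 2] V chart_image_open[OF N d(1)] U) (auto simp: V_def)
    then have "smooth_on V (snd e \<circ> (\<lambda>x. h (f x)) \<circ> cinv c)"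
      by (rule smooth_on_cong[OF _ V]) (auto simp: V_def cinv_chart[OF M c] cinv_chart[OF N d(1)])
    moreover have "y \<in> V" using x d(2) sub by (auto simp: V_def)
    ultimately show "\<exists>V. open V \<and> y \<in> V \<and> smooth_on V (snd e \<circ> (\<lambda>x. h (f x)) \<circ> cinv c)"
      using V by blast
  qed
qed

lemma smooth_fun_on_compose:
  fixes M :: "('m::topological_space, 'e::real_normed_vector) chart set"
    and N :: "('n::topological_space, 'f::finite_dim_inner) chart set"
  assumes M: "topological_atlas M" and N: "topological_atlas N"
    and f: "smooth_map_on M N S f" and h: "smooth_fun_on N T h"
    and S: "open S" and T: "open T" and sub: "f ` S \<subseteq> T"
  shows "smooth_fun_on M S (\<lambda>x. h (f x))"
  using smooth_map_on_compose[OF M N topological_atlas_vec f _ S T sub, of h] smooth_map_on_vec[OF M S]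
    smooth_map_on_vec[OF N T] h by blast

lemma smooth_fun_on_local:
  assumes M: "topological_atlas M"
    and "\<And>x. x \<in> S \<Longrightarrow> \<exists>U. open U \<and> x \<in> U \<and> smooth_fun_on M U f"
  shows "smooth_fun_on M S f"
  unfolding smooth_fun_on_def
proof (intro ballI smooth_on_local)
  fix c y assume c: "c \<in> M" and "y \<in> snd c ` (fst c \<inter> S)"
  then obtain x where x: "y = snd c x" "x \<in> fst c" "x \<in> S" by auto
  obtain U where U: "open U" "x \<in> U" "smooth_fun_on M U f" using assms(2)[OF x(3)] by blast
  have "smooth_on (snd c ` (fst c \<inter> U)) (f \<circ> cinv c)" using U(3) c by (auto simp: smooth_fun_on_def)
  then show "\<exists>V. open V \<and> y \<in> V \<and> smooth_on V (f \<circ> cinv c)"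
    using chart_image_open[OF M c U(1)] x U(2) by blast
qed

lemma smooth_fun_on_cong:
  assumes M: "topological_atlas M" and S: "open S"
    and f: "smooth_fun_on M S f" and eq: "\<And>x. x \<in> S \<Longrightarrow> f x = g x"
  shows "smooth_fun_on M S g"
  unfolding smooth_fun_on_def
proof
  fix c assume c: "c \<in> M"
  have "smooth_on (snd c ` (fst c \<inter> S)) (f \<circ> cinv c)" using f c by (auto simp: smooth_fun_on_def)
  then show "smooth_on (snd c ` (fst c \<inter> S)) (g \<circ> cinv c)"
    by (rule smooth_on_cong[OF _ chart_image_open[OF M c S]]) (auto simp: cinv_chart[OF M c] eq)
qed

lemma smooth_fun_on_const: "topological_atlas M \<Longrightarrow> open S \<Longrightarrow> smooth_fun_on M S (\<lambda>x. a)"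
  by (auto simp: smooth_fun_on_def o_def intro: smooth_on_const chart_image_open)

lemma smooth_fun_on_bounded_bilinear:
  assumes M: "topological_atlas M" and S: "open S" and b: "bounded_bilinear b"
    and "smooth_fun_on M S f" "smooth_fun_on M S h"
  shows "smooth_fun_on M S (\<lambda>x. b (f x) (h x))"
  using assms(4,5) smooth_on_bounded_bilinear[OF b chart_image_open[OF M _ S]]
  unfolding smooth_fun_on_def o_def by blast

lemma smooth_fun_on_sum:
  assumes M: "topological_atlas M" and S: "open S" and "\<And>i. i \<in> I \<Longrightarrow> smooth_fun_on M S (f i)"
  shows "smooth_fun_on M S (\<lambda>x. \<Sum>i\<in>I. f i x)"
  unfolding smooth_fun_on_def o_def
proof
  fix c assume c: "c \<in> M"
  show "smooth_on (snd c ` (fst c \<inter> S)) (\<lambda>x. \<Sum>i\<in>I. f i (cinv c x))"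
    using assms(3) c unfolding smooth_fun_on_def o_def
    by (intro smooth_on_sum chart_image_open[OF M c S]) blast
qed

lemma smooth_fun_on_diff:
  assumes M: "topological_atlas M" and S: "open S" and "smooth_fun_on M S f" "smooth_fun_on M S h"
  shows "smooth_fun_on M S (\<lambda>x. f x - h x)"
  using assms(3,4) smooth_on_diff[OF chart_image_open[OF M _ S]]
  unfolding smooth_fun_on_def o_def by blast

lemma smooth_fun_on_smooth:
  fixes f :: "'m::topological_space \<Rightarrow> 'b::finite_dim_inner"
  assumes M: "topological_atlas M" and S: "open S" and f: "smooth_fun_on M S f"
    and h: "smooth_on T h" and T: "open T" and sub: "f ` S \<subseteq> T"
  shows "smooth_fun_on M S (\<lambda>x. h (f x))"
  unfolding smooth_fun_on_def
proof
  fix c assume c: "c \<in> M"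
  have "smooth_on (snd c ` (fst c \<inter> S)) (f \<circ> cinv c)" using f c by (auto simp: smooth_fun_on_def)
  from smooth_on_compose[OF this h _ chart_image_open[OF M c S] T]
  show "smooth_on (snd c ` (fst c \<inter> S)) ((\<lambda>x. h (f x)) \<circ> cinv c)"
    using sub by (auto simp: o_def image_subset_iff cinv_chart[OF M c])
qed

section \<open>Product manifolds\<close>

lemma prod_atlas_cinv:
  assumes M: "topological_atlas M" and N: "topological_atlas N" and c: "c \<in> M" and d: "d \<in> N"
    and y: "y \<in> snd c ` fst c" "z \<in> snd d ` fst d"
  shows "inv_into (fst c \<times> fst d) (map_prod (snd c) (snd d)) (y, z) = (cinv c y, cinv d z)"
proof -
  have inj: "inj_on (map_prod (snd c) (snd d)) (fst c \<times> fst d)"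
    using cinv_chart[OF M c] cinv_chart[OF N d] by (intro inj_onI) (auto, metis+)
  have "(cinv c y, cinv d z) \<in> fst c \<times> fst d"
    using y by (auto simp: cinv_chart[OF M c] cinv_chart[OF N d])
  moreover have "map_prod (snd c) (snd d) (cinv c y, cinv d z) = (y, z)"
    using y by (simp add: chart_cinv[OF M c] chart_cinv[OF N d])
  ultimately show ?thesis
    using inv_into_f_f[OF inj] by metis
qed

lemma topological_atlas_prod:
  assumes M: "topological_atlas M" and N: "topological_atlas N"
  shows "topological_atlas (prod_atlas M N)"
  unfolding topological_atlas_def
proof (intro conjI ballI)
  show "(\<Union>c\<in>prod_atlas M N. fst c) = UNIV"
  proof (intro equalityI subsetI)
    fix x :: "'a \<times> 'c"
    obtain c d where "c \<in> M" "fst x \<in> fst c" "d \<in> N" "snd x \<in> fst d"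
      using chart_cover[OF M, of "fst x"] chart_cover[OF N, of "snd x"] by blast
    then have "(fst c \<times> fst d, map_prod (snd c) (snd d)) \<in> prod_atlas M N" "x \<in> fst c \<times> fst d"
      unfolding prod_atlas_def by (blast, simp add: mem_Times_iff)
    then show "x \<in> (\<Union>c\<in>prod_atlas M N. fst c)" by force
  qed simp
  fix k assume "k \<in> prod_atlas M N"
  then obtain c d where k: "k = (fst c \<times> fst d, map_prod (snd c) (snd d))" and c: "c \<in> M" and d: "d \<in> N"
    by (auto simp: prod_atlas_def)
  have im: "snd k ` fst k = (snd c ` fst c) \<times> (snd d ` fst d)"
    by (auto simp: k map_prod_def)
  show "open (fst k)" using chart_open[OF M c] chart_open[OF N d] by (simp add: k open_Times)
  have "open (snd c ` fst c)" "open (snd d ` fst d)"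
    using M N c d by (auto simp: topological_atlas_def)
  then show "open (snd k ` fst k)" unfolding im by (rule open_Times)
  show "homeomorphism (fst k) (snd k ` fst k) (snd k) (cinv k)"
    unfolding homeomorphism_def
  proof (intro conjI ballI)
    show "cinv k (snd k x) = x" if "x \<in> fst k" for x
      using that prod_atlas_cinv[OF M N c d] cinv_chart[OF M c] cinv_chart[OF N d] by (auto simp: k)
    then show "cinv k ` snd k ` fst k = fst k" by (force simp: image_image)
    show "snd k (cinv k y) = y" if "y \<in> snd k ` fst k" for y
      using that by (rule f_inv_into_f)
    show "continuous_on (fst k) (snd k)"
      unfolding k fst_conv snd_conv map_prod_def case_prod_beta
      by (intro continuous_on_Pair continuous_on_compose2[OF continuous_chart[OF M c]]
            continuous_on_compose2[OF continuous_chart[OF N d]] continuous_intros) auto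
    have "continuous_on (snd k ` fst k) (\<lambda>y. (cinv c (fst y), cinv d (snd y)))"
      unfolding im
      by (intro continuous_on_Pair continuous_on_compose2[OF continuous_cinv[OF M c]]
            continuous_on_compose2[OF continuous_cinv[OF N d]] continuous_intros) auto
    then show "continuous_on (snd k ` fst k) (cinv k)"
      by (rule continuous_on_eq) (auto simp: k prod_atlas_cinv[OF M N c d])
  qed simp
qed

lemma smooth_map_on_Pair:
  assumes M: "topological_atlas M" and N: "topological_atlas N" and K: "topological_atlas K"
    and f: "smooth_map_on M N S f" and h: "smooth_map_on M K S h" and S: "open S"
  shows "smooth_map_on M (prod_atlas N K) S (\<lambda>x. (f x, h x))"
  unfolding smooth_map_on_def
proof (intro conjI ballI)
  have cf: "continuous_on S f" and ch: "continuous_on S h"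
    using f h by (auto simp: smooth_map_on_def)
  then show "continuous_on S (\<lambda>x. (f x, h x))" by (rule continuous_on_Pair)
  fix c k assume c: "c \<in> M" and "k \<in> prod_atlas N K"
  then obtain d e where k: "k = (fst d \<times> fst e, map_prod (snd d) (snd e))" and d: "d \<in> N" and e: "e \<in> K"
    by (auto simp: prod_atlas_def)
  let ?V = "snd c ` (fst c \<inter> ((S \<inter> f -` fst d) \<inter> (S \<inter> h -` fst e)))"
  have V: "open ?V"
    by (intro chart_image_open[OF M c] open_Int continuous_open_preimage[OF cf S] continuous_open_preimage[OF ch S]
          chart_open[OF N d] chart_open[OF K e])
  have "smooth_on ?V (snd d \<circ> f \<circ> cinv c)" "smooth_on ?V (snd e \<circ> h \<circ> cinv c)"
    using f h c d e by (auto simp: smooth_map_on_def intro!: smooth_on_subset[where T = ?V])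
  from smooth_on_Pair[OF V this]
  have "smooth_on ?V (snd k \<circ> (\<lambda>x. (f x, h x)) \<circ> cinv c)"
    by (simp add: k o_def)
  moreover have "?V = snd c ` (fst c \<inter> S \<inter> (\<lambda>x. (f x, h x)) -` fst k)"
    by (auto simp: k)
  ultimately show "smooth_on (snd c ` (fst c \<inter> S \<inter> (\<lambda>x. (f x, h x)) -` fst k)) (snd k \<circ> (\<lambda>x. (f x, h x)) \<circ> cinv c)"
    by simp
qed

lemma smooth_map_on_id:
  assumes "smooth_atlas M"
  shows "smooth_map_on M M S (\<lambda>x. x)"
  unfolding smooth_map_on_def
proof (intro conjI ballI)
  fix c d assume "c \<in> M" "d \<in> M"
  then have "smooth_on (snd c ` (fst c \<inter> fst d)) (snd d \<circ> cinv c)"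
    using assms by (auto simp: smooth_atlas_def)
  then show "smooth_on (snd c ` (fst c \<inter> S \<inter> (\<lambda>x. x) -` fst d)) (snd d \<circ> (\<lambda>x. x) \<circ> cinv c)"
    by (rule smooth_on_subset[THEN back_subst[of "smooth_on _"]]) (auto simp: o_def)
qed simp

lemma smooth_map_on_const:
  assumes M: "topological_atlas M" and S: "open S"
  shows "smooth_map_on M N S (\<lambda>x. a)"
  unfolding smooth_map_on_def
proof (intro conjI ballI)
  fix c d assume c: "c \<in> M"
  show "smooth_on (snd c ` (fst c \<inter> S \<inter> (\<lambda>x. a) -` fst d)) (snd d \<circ> (\<lambda>x. a) \<circ> cinv c)"
  proof (cases "a \<in> fst d")
    case True
    then show ?thesis using smooth_on_const[OF chart_image_open[OF M c S]] by (simp add: o_def)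
  next
    case False
    have "(\<lambda>x::'a. a) -` fst d = {}" using False by auto
    then show ?thesis using smooth_on_const[of "{}"] by (simp add: o_def)
  qed
qed simp

text \<open>In product charts the projection becomes a transition map of M after the linear
  projection, which is why smooth transitions enter here.\<close>

lemma smooth_map_on_fst:
  assumes M: "smooth_atlas M" and N: "smooth_atlas N"
  shows "smooth_map_on (prod_atlas M N) M UNIV fst"
  unfolding smooth_map_on_def
proof (intro conjI ballI)
  note tM = smooth_atlas_topological[OF M] and tN = smooth_atlas_topological[OF N]
  show "continuous_on UNIV (fst :: 'a \<times> 'c \<Rightarrow> 'a)" by (intro continuous_intros)
  fix k e assume "k \<in> prod_atlas M N" and e: "e \<in> M"
  then obtain c d where k: "k = (fst c \<times> fst d, map_prod (snd c) (snd d))" and c: "c \<in> M" and d: "d \<in> N"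
    by (auto simp: prod_atlas_def)
  let ?V = "(snd c ` (fst c \<inter> fst e)) \<times> (snd d ` (fst d \<inter> UNIV))"
  have V: "open ?V"
    by (intro open_Times chart_image_open[OF tM c] chart_image_open[OF tN d] chart_open[OF tM e] open_UNIV)
  have s: "smooth_on (snd c ` (fst c \<inter> fst e)) (snd e \<circ> cinv c)"
    using M c e by (auto simp: smooth_atlas_def)
  have eq: "fst (cinv k y) = cinv c (fst y)" if "y \<in> ?V" for y
    using that prod_atlas_cinv[OF tM tN c d, of "fst y" "snd y"] by (auto simp: k)
  have "smooth_on ?V (\<lambda>y. (snd e \<circ> cinv c) (fst y))"
    by (intro smooth_on_compose[OF _ s] smooth_on_linear[OF bounded_linear_fst] V
          chart_image_open[OF tM c] chart_open[OF tM e]) auto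
  then have "smooth_on ?V (snd e \<circ> fst \<circ> cinv k)"
    by (rule smooth_on_cong[OF _ V]) (simp add: eq)
  moreover have "?V = snd k ` (fst k \<inter> UNIV \<inter> fst -` fst e)"
    by (auto simp: k map_prod_def image_iff)
  ultimately show "smooth_on (snd k ` (fst k \<inter> UNIV \<inter> fst -` fst e)) (snd e \<circ> fst \<circ> cinv k)"
    by simp
qed

lemma smooth_map_on_snd:
  assumes M: "smooth_atlas M" and N: "smooth_atlas N"
  shows "smooth_map_on (prod_atlas M N) N UNIV snd"
  unfolding smooth_map_on_def
proof (intro conjI ballI)
  note tM = smooth_atlas_topological[OF M] and tN = smooth_atlas_topological[OF N]
  show "continuous_on UNIV (snd :: 'a \<times> 'c \<Rightarrow> 'c)" by (intro continuous_intros)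
  fix k e assume "k \<in> prod_atlas M N" and e: "e \<in> N"
  then obtain c d where k: "k = (fst c \<times> fst d, map_prod (snd c) (snd d))" and c: "c \<in> M" and d: "d \<in> N"
    by (auto simp: prod_atlas_def)
  let ?V = "(snd c ` (fst c \<inter> UNIV)) \<times> (snd d ` (fst d \<inter> fst e))"
  have V: "open ?V"
    by (intro open_Times chart_image_open[OF tM c] chart_image_open[OF tN d] chart_open[OF tN e] open_UNIV)
  have s: "smooth_on (snd d ` (fst d \<inter> fst e)) (snd e \<circ> cinv d)"
    using N d e by (auto simp: smooth_atlas_def)
  have eq: "snd (cinv k y) = cinv d (snd y)" if "y \<in> ?V" for y
    using that prod_atlas_cinv[OF tM tN c d, of "fst y" "snd y"] by (auto simp: k)
  have "smooth_on ?V (\<lambda>y. (snd e \<circ> cinv d) (snd y))"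
    by (intro smooth_on_compose[OF _ s] smooth_on_linear[OF bounded_linear_snd] V
          chart_image_open[OF tN d] chart_open[OF tN e]) auto
  then have "smooth_on ?V (snd e \<circ> snd \<circ> cinv k)"
    by (rule smooth_on_cong[OF _ V]) (simp add: eq)
  moreover have "?V = snd k ` (fst k \<inter> UNIV \<inter> snd -` fst e)"
    by (auto simp: k map_prod_def image_iff)
  ultimately show "smooth_on (snd k ` (fst k \<inter> UNIV \<inter> snd -` fst e)) (snd e \<circ> snd \<circ> cinv k)"
    by simp
qed

section \<open>Derivatives at a point and change of chart\<close>

text \<open>The relational counterpart of \<open>deriv_fun\<close>, whose value means nothing for a
  function that is not differentiable. The rules of calculus are stated for the relation and
  transferred by \<open>has_mderiv_deriv_fun\<close>.\<close>

definition has_mderiv ::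
  "('m, 'e::real_normed_vector) chart set \<Rightarrow> ('m \<Rightarrow> 'b::real_normed_vector) \<Rightarrow> 'm \<Rightarrow> ('e \<Rightarrow> 'b) \<Rightarrow> bool" where
  "has_mderiv M f x D \<longleftrightarrow>
     ((f \<circ> cinv (chart_at M x)) has_derivative D) (at (snd (chart_at M x) x))"

lemma has_mderiv_deriv_fun: "has_mderiv M f x D \<Longrightarrow> deriv_fun M f x = D"
  unfolding has_mderiv_def deriv_fun_def using frechet_derivative_at by metis

lemma has_mderiv_linear: "has_mderiv M f x D \<Longrightarrow> linear D"
  unfolding has_mderiv_def by (rule has_derivative_linear)

lemma smooth_fun_on_chart_derivative:
  assumes M: "topological_atlas M" and f: "smooth_fun_on M S f" and S: "open S" and x: "x \<in> S"
    and c: "c \<in> M" "x \<in> fst c"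
  shows "((f \<circ> cinv c) has_derivative frechet_derivative (f \<circ> cinv c) (at (snd c x))) (at (snd c x))"
proof (rule smooth_on_has_derivative)
  show "smooth_on (snd c ` (fst c \<inter> S)) (f \<circ> cinv c)"
    using f c(1) unfolding smooth_fun_on_def by blast
  show "open (snd c ` (fst c \<inter> S))" by (rule chart_image_open[OF M c(1) S])
qed (use x c in blast)

lemma smooth_fun_on_has_mderiv:
  assumes "topological_atlas M" "smooth_fun_on M S f" "open S" "x \<in> S"
  shows "has_mderiv M f x (deriv_fun M f x)"
  unfolding has_mderiv_def deriv_fun_def
  using smooth_fun_on_chart_derivative[OF assms chart_at[OF assms(1)]] .

lemma has_mderiv_cong:
  assumes M: "topological_atlas M" and f: "has_mderiv M f x D" and U: "open U" "x \<in> U"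
    and eq: "\<And>y. y \<in> U \<Longrightarrow> f y = h y"
  shows "has_mderiv M h x D"
  unfolding has_mderiv_def
proof (rule has_derivative_transform_within_open)
  note c = chart_at[OF M, of x]
  show "((f \<circ> cinv (chart_at M x)) has_derivative D) (at (snd (chart_at M x) x))"
    using f unfolding has_mderiv_def .
  show "open (snd (chart_at M x) ` (fst (chart_at M x) \<inter> U))" by (rule chart_image_open[OF M c(1) U(1)])
  show "snd (chart_at M x) x \<in> snd (chart_at M x) ` (fst (chart_at M x) \<inter> U)" using c(2) U(2) by blast
  show "\<And>y. y \<in> snd (chart_at M x) ` (fst (chart_at M x) \<inter> U) \<Longrightarrow>
     (f \<circ> cinv (chart_at M x)) y = (h \<circ> cinv (chart_at M x)) y"
    using cinv_chart[OF M c(1)] eq by auto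
qed

lemma has_mderiv_const: "has_mderiv M (\<lambda>x. a) x (\<lambda>u. 0)"
  by (simp add: has_mderiv_def o_def)

lemma has_mderiv_diff:
  "has_mderiv M f x D \<Longrightarrow> has_mderiv M h x E \<Longrightarrow> has_mderiv M (\<lambda>x. f x - h x) x (\<lambda>u. D u - E u)"
  by (auto simp: has_mderiv_def o_def intro: has_derivative_diff)

lemma has_mderiv_add:
  "has_mderiv M f x D \<Longrightarrow> has_mderiv M h x E \<Longrightarrow> has_mderiv M (\<lambda>x. f x + h x) x (\<lambda>u. D u + E u)"
  by (auto simp: has_mderiv_def o_def intro: has_derivative_add)

lemma has_mderiv_bilinear:
  assumes M: "topological_atlas M" and b: "bounded_bilinear b"
    and "has_mderiv M f x D" "has_mderiv M h x E"
  shows "has_mderiv M (\<lambda>x. b (f x) (h x)) x (\<lambda>u. b (f x) (E u) + b (D u) (h x))"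
  using bounded_bilinear.FDERIV[OF b assms(3,4)[unfolded has_mderiv_def]]
  by (simp add: has_mderiv_def o_def cinv_chart[OF M chart_at[OF M]])

lemma has_mderiv_bounded_linear:
  assumes "bounded_linear b" "has_mderiv M f x D"
  shows "has_mderiv M (\<lambda>x. b (f x)) x (\<lambda>u. b (D u))"
  using bounded_linear.has_derivative[OF assms(1) assms(2)[unfolded has_mderiv_def]]
  by (simp add: has_mderiv_def o_def)

lemma smooth_fun_on_chart:
  assumes "smooth_atlas M" "d \<in> M"
  shows "smooth_fun_on M (fst d) (snd d)"
  using assms unfolding smooth_atlas_def smooth_fun_on_def by blast

lemma smooth_map_on_chart:
  assumes "smooth_map_on M N S f" "d \<in> N"
  shows "smooth_fun_on M (S \<inter> f -` fst d) (\<lambda>x. snd d (f x))"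
  using assms unfolding smooth_map_on_def smooth_fun_on_def by (simp add: o_def Int_assoc)

lemma coord_field_has_derivative:
  assumes M: "smooth_atlas M" and c: "c \<in> M" "x \<in> fst c"
  shows "((snd (chart_at M x) \<circ> cinv c) has_derivative (\<lambda>u. coord_field M c u x)) (at (snd c x))"
proof -
  note tM = smooth_atlas_topological[OF M]
  note c0 = chart_at[OF tM, of x]
  show ?thesis
    unfolding coord_field_def
    by (rule smooth_fun_on_chart_derivative[OF tM smooth_fun_on_chart[OF M c0(1)] chart_open[OF tM c0(1)] c0(2) c])
qed

lemma linear_coord_field:
  assumes "smooth_atlas M" "c \<in> M" "x \<in> fst c"
  shows "linear (\<lambda>u. coord_field M c u x)"
  using has_derivative_linear[OF coord_field_has_derivative[OF assms]] .

text \<open>Chain rule for the passage from the preferred chart to c: \<open>coord_field\<close> is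
  the derivative of this transition map. \<open>has_mderiv_via_chart\<close> is the passage
  back.\<close>

lemma has_mderiv_chart:
  assumes M: "smooth_atlas M" and f: "has_mderiv M f x D" and c: "c \<in> M" "x \<in> fst c"
  shows "((f \<circ> cinv c) has_derivative (\<lambda>u. D (coord_field M c u x))) (at (snd c x))"
proof -
  note tM = smooth_atlas_topological[OF M]
  note c0 = chart_at[OF tM, of x]
  let ?V = "snd c ` (fst c \<inter> fst (chart_at M x))"
  have "((f \<circ> cinv (chart_at M x)) has_derivative D) (at ((snd (chart_at M x) \<circ> cinv c) (snd c x)))"
    using f cinv_chart[OF tM c(1) c(2)] unfolding has_mderiv_def by simp
  from has_derivative_compose[OF coord_field_has_derivative[OF M c] this] show ?thesis
  proof (rule has_derivative_transform_within_open)
    show "open ?V" by (rule chart_image_open[OF tM c(1) chart_open[OF tM c0(1)]])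
    show "snd c x \<in> ?V" using c(2) c0(2) by blast
    show "\<And>y. y \<in> ?V \<Longrightarrow> (f \<circ> cinv (chart_at M x)) ((snd (chart_at M x) \<circ> cinv c) y) = (f \<circ> cinv c) y"
      using cinv_chart[OF tM c(1)] cinv_chart[OF tM c0(1)] by auto
  qed
qed

lemma has_mderiv_via_chart:
  assumes M: "smooth_atlas M" and c: "c \<in> M" "x \<in> fst c"
    and f: "((f \<circ> cinv c) has_derivative D) (at (snd c x))"
  shows "has_mderiv M f x (\<lambda>w. D (deriv_fun M (snd c) x w))"
proof -
  note tM = smooth_atlas_topological[OF M]
  note c0 = chart_at[OF tM, of x]
  let ?c = "chart_at M x" let ?V = "snd ?c ` (fst ?c \<inter> fst c)"
  have "has_mderiv M (snd c) x (deriv_fun M (snd c) x)"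
    by (rule smooth_fun_on_has_mderiv[OF tM smooth_fun_on_chart[OF M c(1)] chart_open[OF tM c(1)] c(2)])
  then have 1: "((snd c \<circ> cinv ?c) has_derivative deriv_fun M (snd c) x) (at (snd ?c x))"
    unfolding has_mderiv_def .
  have 2: "((f \<circ> cinv c) has_derivative D) (at ((snd c \<circ> cinv ?c) (snd ?c x)))"
    using f cinv_chart[OF tM c0(1) c0(2)] by simp
  from has_derivative_compose[OF 1 2] show ?thesis
    unfolding has_mderiv_def
  proof (rule has_derivative_transform_within_open)
    show "open ?V" by (rule chart_image_open[OF tM c0(1) chart_open[OF tM c(1)]])
    show "snd ?c x \<in> ?V" using c(2) c0(2) by blast
    show "\<And>y. y \<in> ?V \<Longrightarrow> (f \<circ> cinv c) ((snd c \<circ> cinv ?c) y) = (f \<circ> cinv ?c) y"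
      using cinv_chart[OF tM c(1)] cinv_chart[OF tM c0(1)] by auto
  qed
qed

lemma chart_self_derivative:
  assumes M: "topological_atlas M" and c: "c \<in> M" "x \<in> fst c"
  shows "((snd c \<circ> cinv c) has_derivative (\<lambda>u. u)) (at (snd c x))"
proof (rule has_derivative_transform_within_open[OF has_derivative_ident])
  show "open (snd c ` (fst c \<inter> UNIV))" by (rule chart_image_open[OF M c(1) open_UNIV])
qed (use c cinv_chart[OF M c(1)] in auto)

lemma coord_field_chart_at: "smooth_atlas M \<Longrightarrow> coord_field M (chart_at M x) u x = u"
  using chart_self_derivative[OF smooth_atlas_topological chart_at[OF smooth_atlas_topological], THEN frechet_derivative_at]
  unfolding coord_field_def by metis

text \<open>Both maps are derivatives of transition maps between c and the preferred chart. By this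
  lemma and \<open>coord_field_deriv_fun\<close> they are mutually inverse, so a tangent vector may
  be described by its components in any chart.\<close>

lemma deriv_fun_coord_field:
  assumes M: "smooth_atlas M" and c: "c \<in> M" "x \<in> fst c"
  shows "deriv_fun M (snd c) x (coord_field M c u x) = u"
proof -
  note tM = smooth_atlas_topological[OF M]
  have "has_mderiv M (snd c) x (deriv_fun M (snd c) x)"
    by (rule smooth_fun_on_has_mderiv[OF tM smooth_fun_on_chart[OF M c(1)] chart_open[OF tM c(1)] c(2)])
  from has_mderiv_chart[OF M this c] chart_self_derivative[OF tM c]
  have "(\<lambda>u. deriv_fun M (snd c) x (coord_field M c u x)) = (\<lambda>u. u)"
    by (rule has_derivative_unique)
  then show ?thesis by meson
qed

lemma coord_field_deriv_fun:
  assumes M: "smooth_atlas M" and c: "c \<in> M" "x \<in> fst c"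
  shows "coord_field M c (deriv_fun M (snd c) x w) x = w"
proof -
  note tM = smooth_atlas_topological[OF M]
  note c0 = chart_at[OF tM, of x]
  have "has_mderiv M (snd (chart_at M x)) x (\<lambda>w. coord_field M c (deriv_fun M (snd c) x w) x)"
    by (rule has_mderiv_via_chart[OF M c coord_field_has_derivative[OF M c]])
  moreover have "has_mderiv M (snd (chart_at M x)) x (\<lambda>w. w)"
    unfolding has_mderiv_def by (rule chart_self_derivative[OF tM c0])
  ultimately show ?thesis using has_mderiv_deriv_fun by metis
qed

lemma coord_field_change:
  assumes M: "smooth_atlas M" and c: "c \<in> M" "x \<in> fst c" and d: "d \<in> M" "x \<in> fst d"
  shows "coord_field M c u x = coord_field M d (frechet_derivative (snd d \<circ> cinv c) (at (snd c x)) u) x"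
proof -
  note tM = smooth_atlas_topological[OF M]
  have "has_mderiv M (snd d) x (deriv_fun M (snd d) x)"
    by (rule smooth_fun_on_has_mderiv[OF tM smooth_fun_on_chart[OF M d(1)] chart_open[OF tM d(1)] d(2)])
  from frechet_derivative_at[OF has_mderiv_chart[OF M this c]]
  have "frechet_derivative (snd d \<circ> cinv c) (at (snd c x)) u = deriv_fun M (snd d) x (coord_field M c u x)"
    by (rule fun_cong[OF sym])
  then show ?thesis using coord_field_deriv_fun[OF M d] by presburger
qed

lemma smooth_fun_on_transition_derivative:
  assumes M: "smooth_atlas M" and c: "c \<in> M" and d: "d \<in> M"
  shows "smooth_fun_on M (fst c \<inter> fst d) (\<lambda>x. frechet_derivative (snd d \<circ> cinv c) (at (snd c x)) u)"
proof -
  note tM = smooth_atlas_topological[OF M]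
  have "smooth_on (snd c ` (fst c \<inter> fst d)) (\<lambda>y. frechet_derivative (snd d \<circ> cinv c) (at y) u)"
    using M c d unfolding smooth_atlas_def by (blast intro: smooth_on_derivative)
  moreover have "smooth_fun_on M (fst c \<inter> fst d) (snd c)"
    by (rule smooth_fun_on_subset[OF smooth_fun_on_chart[OF M c]]) simp
  ultimately show ?thesis
    using smooth_fun_on_smooth[OF tM open_Int[OF chart_open[OF tM c] chart_open[OF tM d]] _ _
        chart_image_open[OF tM c chart_open[OF tM d]] order_refl] by blast
qed

section \<open>Tangent maps and the chain rule\<close>

lemma tangent_map_has_mderiv:
  assumes M: "topological_atlas M" and N: "topological_atlas N"
    and f: "smooth_map_on M N S f" and S: "open S" "x \<in> S"
  shows "has_mderiv M (\<lambda>y. snd (chart_at N (f x)) (f y)) x (tangent_map M N f x)"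
proof -
  note d = chart_at[OF N, of "f x"]
  have "open (S \<inter> f -` fst (chart_at N (f x)))"
    using f S(1) unfolding smooth_map_on_def
    by (intro continuous_open_preimage chart_open[OF N d(1)]) auto
  from smooth_fun_on_has_mderiv[OF M smooth_map_on_chart[OF f d(1)] this]
  show ?thesis using S(2) d(2) by (simp add: tangent_map_def o_def)
qed

lemma linear_tangent_map:
  assumes "topological_atlas M" "topological_atlas N" "smooth_map_on M N S f" "open S" "x \<in> S"
  shows "linear (tangent_map M N f x)"
  by (rule has_mderiv_linear[OF tangent_map_has_mderiv[OF assms]])

lemma has_mderiv_compose:
  assumes M: "topological_atlas M" and N: "topological_atlas N"
    and f: "smooth_map_on M N S f" and S: "open S" "x \<in> S" and h: "has_mderiv N h (f x) D"
  shows "has_mderiv M (\<lambda>y. h (f y)) x (\<lambda>u. D (tangent_map M N f x u))"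
proof -
  note c = chart_at[OF M, of x] and d = chart_at[OF N, of "f x"]
  let ?c = "chart_at M x" and ?d = "chart_at N (f x)"
  let ?U = "S \<inter> f -` fst ?d" let ?V = "snd ?c ` (fst ?c \<inter> ?U)"
  have U: "open ?U"
    using f S(1) unfolding smooth_map_on_def
    by (intro continuous_open_preimage chart_open[OF N d(1)]) auto
  have 1: "(((\<lambda>y. snd ?d (f y)) \<circ> cinv ?c) has_derivative tangent_map M N f x) (at (snd ?c x))"
    using tangent_map_has_mderiv[OF M N f S] unfolding has_mderiv_def .
  have 2: "((h \<circ> cinv ?d) has_derivative D) (at (((\<lambda>y. snd ?d (f y)) \<circ> cinv ?c) (snd ?c x)))"
    using h cinv_chart[OF M c(1) c(2)] unfolding has_mderiv_def by simp
  from has_derivative_compose[OF 1 2] show ?thesis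
    unfolding has_mderiv_def
  proof (rule has_derivative_transform_within_open)
    show "open ?V" by (rule chart_image_open[OF M c(1) U])
    show "snd ?c x \<in> ?V" using c(2) d(2) S(2) by blast
    show "\<And>y. y \<in> ?V \<Longrightarrow> (h \<circ> cinv ?d) (((\<lambda>y. snd ?d (f y)) \<circ> cinv ?c) y) = ((\<lambda>y. h (f y)) \<circ> cinv ?c) y"
      using cinv_chart[OF M c(1)] cinv_chart[OF N d(1)] by auto
  qed
qed

lemma tangent_map_compose:
  assumes "topological_atlas M" "topological_atlas N" "topological_atlas K"
    and f: "smooth_map_on M N S f" "open S" "x \<in> S" and h: "smooth_map_on N K T h" "open T" "f x \<in> T"
  shows "tangent_map M K (\<lambda>y. h (f y)) x u = tangent_map N K h (f x) (tangent_map M N f x u)"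
  using has_mderiv_deriv_fun[OF has_mderiv_compose[OF assms(1,2) f tangent_map_has_mderiv[OF assms(2,3) h]]]
  by (simp add: tangent_map_def o_def)

lemma tangent_map_cong:
  assumes M: "topological_atlas M" and N: "topological_atlas N"
    and f: "smooth_map_on M N S f" and S: "open S" "x \<in> S" and eq: "\<And>y. y \<in> S \<Longrightarrow> f y = h y"
  shows "tangent_map M N h x = tangent_map M N f x"
proof -
  have "has_mderiv M (\<lambda>y. snd (chart_at N (f x)) (h y)) x (tangent_map M N f x)"
    by (rule has_mderiv_cong[OF M tangent_map_has_mderiv[OF M N f S] S]) (simp add: eq)
  from has_mderiv_deriv_fun[OF this] show ?thesis
    using eq[OF S(2)] by (simp add: tangent_map_def o_def)
qed

lemma tangent_map_const: "tangent_map M N (\<lambda>y. a) x u = 0"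
  using has_mderiv_deriv_fun[OF has_mderiv_const[of M "snd (chart_at N a) a" x]]
  by (simp add: tangent_map_def o_def)

lemma tangent_map_id:
  assumes "smooth_atlas M" shows "tangent_map M M (\<lambda>y. y) x u = u"
proof -
  note tM = smooth_atlas_topological[OF assms]
  have "has_mderiv M (snd (chart_at M x)) x (\<lambda>w. w)"
    unfolding has_mderiv_def by (rule chart_self_derivative[OF tM chart_at[OF tM]])
  then show ?thesis using has_mderiv_deriv_fun by (fastforce simp: tangent_map_def o_def)
qed

text \<open>The support \<open>K\<close> is compact, hence closed in the Hausdorff space \<open>M\<close>; this allows extension by zero.\<close>

lemma manifold_bump:
  fixes M :: "('m::{t2_space,second_countable_topology}, 'e::euclidean_space) chart set"
  assumes M: "smooth_atlas M" and U: "open U" "x \<in> U"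
  shows "\<exists>\<beta> K. smooth_fun_on M UNIV \<beta> \<and> \<beta> x = (1::real) \<and> closed K \<and> K \<subseteq> U \<and> (\<forall>y. y \<notin> K \<longrightarrow> \<beta> y = 0)"
proof -
  note tM = smooth_atlas_topological[OF M]
  obtain c where c: "c \<in> M" "x \<in> fst c" using chart_cover[OF tM] by blast
  have "open (snd c ` (fst c \<inter> U))" by (rule chart_image_open[OF tM c(1) U(1)])
  then obtain r where r: "r > 0" "cball (snd c x) r \<subseteq> snd c ` (fst c \<inter> U)"
    using open_contains_cball c(2) U(2) by blast
  obtain b :: "'e \<Rightarrow> real" where b: "smooth_on UNIV b" "b (snd c x) = 1" "\<And>y. b y \<noteq> 0 \<Longrightarrow> dist (snd c x) y < r"
    using exists_bump[OF r(1), of "snd c x"] by blast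
  define K where "K = cinv c ` cball (snd c x) r"
  define \<beta> where "\<beta> y = (if y \<in> fst c then b (snd c y) else 0)" for y
  have "continuous_on (cball (snd c x) r) (cinv c)"
    using continuous_on_subset[OF continuous_cinv[OF tM c(1)]] r(2) by blast
  then have "compact K" unfolding K_def by (intro compact_continuous_image) auto
  then have cK: "closed K" by (rule compact_imp_closed)
  have KU: "K \<subseteq> fst c \<inter> U"
  proof
    fix k assume "k \<in> K"
    then obtain y where "y \<in> cball (snd c x) r" "k = cinv c y" unfolding K_def by blast
    then obtain z where "z \<in> fst c \<inter> U" "k = cinv c (snd c z)" using r(2) by blast
    then show "k \<in> fst c \<inter> U" by (simp add: cinv_chart[OF tM c(1)])
  qed
  have zero: "\<beta> y = 0" if "y \<notin> K" for y
  proof (rule ccontr)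
    assume "\<beta> y \<noteq> 0"
    then have "y \<in> fst c" "dist (snd c x) (snd c y) < r"
      using b(3) by (auto simp: \<beta>_def split: if_splits)
    then have "cinv c (snd c y) \<in> K" unfolding K_def by auto
    then show False using that \<open>y \<in> fst c\<close> by (simp add: cinv_chart[OF tM c(1)])
  qed
  have "smooth_fun_on M UNIV \<beta>"
  proof (rule smooth_fun_on_local[OF tM])
    fix y
    show "\<exists>V. open V \<and> y \<in> V \<and> smooth_fun_on M V \<beta>"
    proof (cases "y \<in> fst c")
      case True
      have "smooth_fun_on M (fst c) (\<lambda>y. b (snd c y))"
        by (rule smooth_fun_on_smooth[OF tM chart_open[OF tM c(1)] smooth_fun_on_chart[OF M c(1)] b(1)]) auto
      then have "smooth_fun_on M (fst c) \<beta>"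
        by (rule smooth_fun_on_cong[OF tM chart_open[OF tM c(1)]]) (simp add: \<beta>_def)
      then show ?thesis using True chart_open[OF tM c(1)] by blast
    next
      case False
      have o: "open (- K)" using cK by (simp add: open_Compl)
      have "smooth_fun_on M (- K) \<beta>"
        by (rule smooth_fun_on_cong[OF tM o smooth_fun_on_const[OF tM o, of 0]]) (simp add: zero)
      then show ?thesis using False KU o by blast
    qed
  qed
  moreover have "\<beta> x = 1" using b(2) c(2) by (simp add: \<beta>_def)
  ultimately show ?thesis using cK KU zero by blast
qed

text \<open>The linear coordinate function is cut off by a bump. As it vanishes at x, the derivative
  of the bump drops out of the product rule there.\<close>

lemma exists_smooth_differential:
  fixes M :: "('m::{t2_space,second_countable_topology}, 'e::euclidean_space) chart set"
  assumes M: "smooth_atlas M"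
  shows "\<exists>f. smooth_fun_on M UNIV f \<and> deriv_fun M f x = (blinfun_apply \<zeta> :: 'e \<Rightarrow> real)"
proof -
  note tM = smooth_atlas_topological[OF M]
  note c = chart_at[OF tM, of x]
  let ?c = "chart_at M x"
  note oc = chart_open[OF tM c(1)]
  obtain \<beta> K where \<beta>: "smooth_fun_on M UNIV \<beta>" "\<beta> x = (1::real)" "closed K" "K \<subseteq> fst ?c" "\<And>y. y \<notin> K \<Longrightarrow> \<beta> y = 0"
    using manifold_bump[OF M oc c(2)] by blast
  define f where "f y = \<beta> y * blinfun_apply \<zeta> (snd ?c y - snd ?c x)" for y
  have l: "smooth_on UNIV (\<lambda>y. blinfun_apply \<zeta> (y - snd ?c x))"
    by (intro smooth_on_bounded_linear[OF blinfun.bounded_linear_right] smooth_on_diff smooth_on_id smooth_on_const) auto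
  have s1: "smooth_fun_on M (fst ?c) (\<lambda>y. blinfun_apply \<zeta> (snd ?c y - snd ?c x))"
    by (rule smooth_fun_on_smooth[OF tM oc smooth_fun_on_chart[OF M c(1)] l]) auto
  have s2: "smooth_fun_on M (fst ?c) f"
    unfolding f_def by (intro smooth_fun_on_bounded_bilinear[OF tM oc bounded_bilinear_mult] s1
        smooth_fun_on_subset[OF \<beta>(1)]) auto
  have "smooth_fun_on M UNIV f"
  proof (rule smooth_fun_on_local[OF tM])
    fix y
    have o: "open (- K)" using \<beta>(3) by (simp add: open_Compl)
    have "smooth_fun_on M (- K) f"
      by (rule smooth_fun_on_cong[OF tM o smooth_fun_on_const[OF tM o, of 0]]) (simp add: f_def \<beta>(5))
    then show "\<exists>V. open V \<and> y \<in> V \<and> smooth_fun_on M V f"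
      using s2 oc o \<beta>(4) by (cases "y \<in> K") auto
  qed
  moreover have "deriv_fun M f x = blinfun_apply \<zeta>"
  proof (rule has_mderiv_deriv_fun)
    have "has_mderiv M (snd ?c) x (\<lambda>u. u)"
      unfolding has_mderiv_def by (rule chart_self_derivative[OF tM c])
    then have "has_mderiv M (\<lambda>y. blinfun_apply \<zeta> (snd ?c y - snd ?c x)) x (\<lambda>u. blinfun_apply \<zeta> (u - 0))"
      by (intro has_mderiv_bounded_linear[OF blinfun.bounded_linear_right] has_mderiv_diff has_mderiv_const)
    from has_mderiv_bilinear[OF tM bounded_bilinear_mult smooth_fun_on_has_mderiv[OF tM \<beta>(1)] this]
    show "has_mderiv M f x (blinfun_apply \<zeta>)" unfolding f_def by (simp add: \<beta>(2))
  qed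
  ultimately show ?thesis by blast
qed

section \<open>Two-forms on an oriented Euclidean five-space\<close>

lemma exhaust_5: "x = 1 \<or> x = 2 \<or> x = 3 \<or> x = 4 \<or> x = 5" for x :: 5
proof (induct x)
  case (of_int z)
  then have "z = 0 \<or> z = 1 \<or> z = 2 \<or> z = 3 \<or> z = 4" by fastforce
  then show ?case by auto
qed

lemma forall_5: "(\<forall>i::5. P i) \<longleftrightarrow> P 1 \<and> P 2 \<and> P 3 \<and> P 4 \<and> P 5"
  by (metis exhaust_5)

lemma UNIV_5: "UNIV = {1, 2, 3, 4, 5::5}"
  using exhaust_5 by auto

lemma sum_5: "sum f (UNIV::5 set) = f 1 + f 2 + f 3 + f 4 + f 5"
  unfolding UNIV_5 by (simp add: ac_simps)

lemma bilinear_sum_left: "bilinear f \<Longrightarrow> f (sum u S) y = (\<Sum>i\<in>S. f (u i) y)"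
  using linear_sum[of "\<lambda>x. f x y"] by (simp add: bilinear_def)

lemma bilinear_sum_right: "bilinear f \<Longrightarrow> f y (sum u S) = (\<Sum>i\<in>S. f y (u i))"
  using linear_sum[of "f y"] by (simp add: bilinear_def)

lemma vec_axis_expansion: "x = (\<Sum>i\<in>UNIV. x $ i *\<^sub>R axis i (1::real))"
  by (simp add: vec_eq_iff axis_def if_distrib[of "\<lambda>t. _ * t"] cong: if_cong)

subsection \<open>Constructing forms from functions\<close>

lemma Blinfun_apply: "linear f \<Longrightarrow> blinfun_apply (Blinfun f) X = f X"
  for f :: "'a::finite_dim_inner \<Rightarrow> 'b::real_normed_vector"
  by (simp add: bounded_linear_Blinfun_apply linear_imp_bounded_linear)

text \<open>\<open>Blinfun\<close> is meaningful on bounded linear maps only; in finite dimension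
  linearity in each slot suffices. Every use of a form defined by \<open>Form2\<close> goes through
  this check of bilinearity.\<close>

lemma Form2_apply:
  assumes "bilinear f"
  shows "blinfun_apply (blinfun_apply (Form2 f) X) Y = f X Y"
proof -
  have l: "linear (f X)" for X using assms by (simp add: bilinear_def)
  have "linear (\<lambda>X. Blinfun (f X))"
    by (rule linearI; rule blinfun_eqI)
      (simp_all add: Blinfun_apply[OF l] blinfun.bilinear_simps bilinear_ladd[OF assms] bilinear_lmul[OF assms])
  then show ?thesis
    unfolding Form2_def by (simp add: Blinfun_apply l)
qed

lemma form2_eqI: "(\<And>X Y. \<omega> X Y = \<omega>' X Y) \<Longrightarrow> \<omega> = \<omega>'"
  for \<omega> \<omega>' :: "'b::real_normed_vector form2"
  by (intro blinfun_eqI)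

lemma alternating_skew:
  assumes "alternating \<omega>" shows "\<omega> X Y = - \<omega> Y X"
proof -
  have "\<omega> (X + Y) (X + Y) = 0" "\<omega> X X = 0" "\<omega> Y Y = 0"
    using assms unfolding alternating_def by blast+
  then show ?thesis by (simp add: blinfun.bilinear_simps add_eq_0_iff)
qed

text \<open>The form a \<otimes> y. Forms are reassembled from their values on a frame as sums of
  such tensors with the dual covectors.\<close>

definition tensor1 :: "('a::real_normed_vector \<Rightarrow>\<^sub>L real) \<Rightarrow> 'b::real_normed_vector \<Rightarrow> ('a \<Rightarrow>\<^sub>L 'b)" where
  "tensor1 a y = blinfun_scaleR_left y o\<^sub>L a"

lemma tensor1_apply [simp]: "tensor1 a y X = a X *\<^sub>R y"
  by (simp add: tensor1_def)

lemma bounded_linear_tensor1: "bounded_linear (tensor1 a)"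
  unfolding tensor1_def
  by (rule bounded_linear_compose[OF bounded_bilinear.bounded_linear_left[OF bounded_bilinear_blinfun_compose]
        bounded_linear_blinfun_scaleR_left])

subsection \<open>Orthonormal frames\<close>

definition inner_product :: "(real^5 \<Rightarrow> real^5 \<Rightarrow> real) \<Rightarrow> bool" where
  "inner_product h \<longleftrightarrow> bilinear h \<and> (\<forall>u w. h u w = h w u) \<and> (\<forall>u. u \<noteq> 0 \<longrightarrow> h u u > 0)"

text \<open>Only the rows in J are constrained: such partial frames are the intermediate states of
  Gram-Schmidt.\<close>

definition orthonormal_on :: "(real^5 \<Rightarrow> real^5 \<Rightarrow> real) \<Rightarrow> 5 set \<Rightarrow> real^5^5 \<Rightarrow> bool" where
  "orthonormal_on h J e \<longleftrightarrow> (\<forall>i\<in>J. \<forall>j\<in>J. h (e $ i) (e $ j) = (if i = j then 1 else 0))"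

lemma oriented_frame_orthonormal: "oriented_frame h e \<longleftrightarrow> orthonormal_on h UNIV e \<and> det e > 0"
  by (simp add: oriented_frame_def orthonormal_on_def)

context
  fixes h :: "real^5 \<Rightarrow> real^5 \<Rightarrow> real"
  assumes h: "inner_product h"
begin

lemma ip_bilinear: "bilinear h" and ip_sym: "h u w = h w u" and ip_pos: "u \<noteq> 0 \<Longrightarrow> h u u > 0"
  using h by (auto simp: inner_product_def)

lemma ip_linear: "linear (h u)"
  using ip_bilinear by (simp add: bilinear_def)

lemmas ip_simps = bilinear_ladd[OF ip_bilinear] bilinear_radd[OF ip_bilinear]
  bilinear_lmul[OF ip_bilinear] bilinear_rmul[OF ip_bilinear]
  bilinear_lsub[OF ip_bilinear] bilinear_rsub[OF ip_bilinear]
  bilinear_lzero[OF ip_bilinear] bilinear_rzero[OF ip_bilinear]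
  bilinear_lneg[OF ip_bilinear] bilinear_rneg[OF ip_bilinear]
  bilinear_sum_left[OF ip_bilinear] bilinear_sum_right[OF ip_bilinear]

text \<open>Orthonormality as E H E^T = 1, where H is the Gram matrix of h in the standard basis.
  The expansion in a frame, the non-vanishing of det e and its uniqueness all follow from this
  identity.\<close>

lemma frame_matrix:
  assumes "orthonormal_on h UNIV e"
  shows "(e ** (\<chi> a b. h (axis a 1) (axis b 1))) ** transpose e = mat 1"
proof -
  have "h (e $ i) (e $ j) = ((e ** (\<chi> a b. h (axis a 1) (axis b 1))) ** transpose e) $ i $ j" for i j
  proof -
    have "h (e $ i) (e $ j) = h (\<Sum>a\<in>UNIV. e $ i $ a *\<^sub>R axis a 1) (\<Sum>b\<in>UNIV. e $ j $ b *\<^sub>R axis b 1)"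
      by (simp only: vec_axis_expansion[symmetric])
    also have "\<dots> = (\<Sum>b\<in>UNIV. \<Sum>a\<in>UNIV. e $ i $ a * h (axis a 1) (axis b 1) * e $ j $ b)"
      by (simp add: ip_simps sum_distrib_left sum_distrib_right mult_ac)
    finally show ?thesis
      by (simp add: matrix_matrix_mult_def transpose_def sum_distrib_right)
  qed
  then show ?thesis
    using assms by (simp add: vec_eq_iff mat_def orthonormal_on_def)
qed

lemma frame_expansion:
  assumes "orthonormal_on h UNIV e"
  shows "X = (\<Sum>i\<in>UNIV. h (e $ i) X *\<^sub>R e $ i)"
proof -
  let ?M = "e ** (\<chi> a b. h (axis a 1) (axis b 1))"
  have "(?M *v X) $ i = h (e $ i) X" for i
  proof -
    have "h (e $ i) X = h (\<Sum>a\<in>UNIV. e $ i $ a *\<^sub>R axis a 1) (\<Sum>b\<in>UNIV. X $ b *\<^sub>R axis b 1)"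
      by (simp only: vec_axis_expansion[symmetric])
    also have "\<dots> = (\<Sum>b\<in>UNIV. \<Sum>a\<in>UNIV. e $ i $ a * h (axis a 1) (axis b 1) * X $ b)"
      by (simp add: ip_simps sum_distrib_left sum_distrib_right mult_ac)
    finally show ?thesis
      by (simp add: matrix_vector_mult_def matrix_matrix_mult_def sum_distrib_right)
  qed
  then have M: "?M *v X = (\<chi> i. h (e $ i) X)" by (simp add: vec_eq_iff)
  \<comment> \<open>For square matrices the right inverse of \<open>?M\<close> is also a left
    inverse.\<close>
  have "transpose e *v (?M *v X) = X"
    using frame_matrix[OF assms] matrix_left_right_inverse[of ?M "transpose e"]
    by (simp add: matrix_vector_mul_assoc)
  then have "X = transpose e *v (\<chi> i. h (e $ i) X)" unfolding M by (rule sym)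
  also have "\<dots> = (\<Sum>i\<in>UNIV. h (e $ i) X *\<^sub>R e $ i)"
    by (simp add: vec_eq_iff matrix_vector_mult_def transpose_def mult.commute)
  finally show ?thesis .
qed

lemma frame_det_nonzero:
  assumes "orthonormal_on h UNIV e" shows "det e \<noteq> 0"
  using arg_cong[OF frame_matrix[OF assms], of det] by (auto simp: det_mul)

text \<open>Expanding e' in e and then recombining in e' moves the sum from one frame to the other.
  The definitions of \<open>hodge3\<close> and \<open>delta_plus\<close> choose a frame, and this
  lemma permits computing in an adapted one.\<close>

lemma frame_trace:
  assumes e: "orthonormal_on h UNIV e" and e': "orthonormal_on h UNIV e'" and F: "bilinear F"
  shows "(\<Sum>i\<in>UNIV. F (e $ i) (e $ i)) = (\<Sum>i\<in>UNIV. F (e' $ i) (e' $ i))"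
proof -
  have "(\<Sum>i\<in>UNIV. F (e' $ i) (e' $ i)) = (\<Sum>i\<in>UNIV. F (\<Sum>j\<in>UNIV. h (e $ j) (e' $ i) *\<^sub>R e $ j) (e' $ i))"
    by (simp only: frame_expansion[OF e, symmetric])
  also have "\<dots> = (\<Sum>i\<in>UNIV. \<Sum>j\<in>UNIV. F (e $ j) (h (e' $ i) (e $ j) *\<^sub>R e' $ i))"
    by (simp add: bilinear_sum_left[OF F] bilinear_lmul[OF F] bilinear_rmul[OF F] ip_sym)
  also have "\<dots> = (\<Sum>j\<in>UNIV. F (e $ j) (\<Sum>i\<in>UNIV. h (e' $ i) (e $ j) *\<^sub>R e' $ i))"
    unfolding bilinear_sum_right[OF F] by (rule sum.swap)
  also have "\<dots> = (\<Sum>j\<in>UNIV. F (e $ j) (e $ j))"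
    by (simp only: frame_expansion[OF e', symmetric])
  finally show ?thesis by simp
qed

text \<open>\<open>frame_matrix\<close> fixes the square of the determinant, and the orientation
  fixes its sign. Consequently \<open>vol\<close> is the same for all oriented orthonormal
  frames.\<close>

lemma frame_det_unique:
  assumes "oriented_frame h e" "oriented_frame h e'"
  shows "det e = det e'"
proof -
  let ?G = "\<chi> a b. h (axis a 1) (axis b 1)"
  have *: "det e * det ?G * det e = 1" "det e' * det ?G * det e' = 1"
    using arg_cong[OF frame_matrix, of _ det] assms by (simp_all add: det_mul oriented_frame_orthonormal)
  have "((det e)\<^sup>2 - (det e')\<^sup>2) * det ?G = det e * det ?G * det e - det e' * det ?G * det e'"
    by (simp add: algebra_simps power2_eq_square)
  then have "((det e)\<^sup>2 - (det e')\<^sup>2) * det ?G = 0" unfolding * by simp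
  moreover have "det ?G \<noteq> 0" using * by auto
  ultimately have "(det e)\<^sup>2 = (det e')\<^sup>2" by simp
  then show ?thesis
    using assms by (simp add: oriented_frame_def power2_eq_iff_nonneg)
qed

text \<open>The step serves a single inner product as well as a family over a neighbourhood.
  Positivity is a hypothesis because it comes from linear independence in the first case and from
  continuity in the second.\<close>

lemma gram_schmidt_step:
  fixes e :: "real^5^5"
  assumes e: "orthonormal_on h J e" and i: "i \<notin> J"
    and u: "u = w - (\<Sum>j\<in>J. h (e $ j) w *\<^sub>R e $ j)" and pos: "h u u > 0"
  shows "orthonormal_on h (insert i J) (\<chi> j. if j = i then (1 / sqrt (h u u)) *\<^sub>R u else e $ j)"
    (is "orthonormal_on h _ ?e")
  unfolding orthonormal_on_def
proof (intro ballI)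
  have orth: "h (e $ k) u = 0" if "k \<in> J" for k
  proof -
    have "h (e $ k) u = h (e $ k) w - (\<Sum>j\<in>J. h (e $ j) w * h (e $ k) (e $ j))"
      unfolding u by (simp add: ip_simps)
    also have "(\<Sum>j\<in>J. h (e $ j) w * h (e $ k) (e $ j)) = (\<Sum>j\<in>J. if j = k then h (e $ k) w else 0)"
      using e that by (intro sum.cong) (auto simp: orthonormal_on_def)
    finally show ?thesis using that by simp
  qed
  have ei: "?e $ i = (1 / sqrt (h u u)) *\<^sub>R u" by simp
  have ej: "?e $ j = e $ j" if "j \<in> J" for j using that i by auto
  fix a b assume ab: "a \<in> insert i J" "b \<in> insert i J"
  have ii: "h (?e $ i) (?e $ i) = 1"
    using pos unfolding ei by (simp add: ip_simps)
  have ij: "h (?e $ i) (?e $ j) = 0" "h (?e $ j) (?e $ i) = 0" if "j \<in> J" for j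
    using orth[OF that] ip_sym[of u "e $ j"] unfolding ei ej[OF that] by (simp_all add: ip_simps)
  show "h (?e $ a) (?e $ b) = (if a = b then 1 else 0)"
  proof (cases "a = i")
    case True
    then show ?thesis using ab(2) ii ij(1)[of b] i by (cases "b = i") auto
  next
    case False
    then have a: "a \<in> J" using ab(1) by simp
    show ?thesis
    proof (cases "b = i")
      case True
      then show ?thesis using ij(2)[OF a] False by simp
    next
      case b: False
      then have "b \<in> J" using ab(2) by simp
      then show ?thesis using e a unfolding ej[OF a] ej[OF \<open>b \<in> J\<close>] orthonormal_on_def by blast
    qed
  qed
qed

lemma exists_orthonormal:
  assumes "h n n = 1" "finite J"
  shows "\<exists>e. orthonormal_on h (insert 5 J) e \<and> e $ 5 = n"
  using assms(2)
proof (induction J rule: finite_induct)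
  case empty
  show ?case
    by (rule exI[of _ "\<chi> i. n"]) (simp add: orthonormal_on_def assms(1))
next
  case (insert i J)
  then obtain e where e: "orthonormal_on h (insert 5 J) e" "e $ 5 = n" by blast
  show ?case
  proof (cases "i \<in> insert 5 J")
    case True
    then show ?thesis using e by (intro exI[of _ e]) (simp add: insert_absorb insert_commute)
  next
    case False
    let ?J = "insert 5 J"
    \<comment> \<open>Fewer than five rows cannot span, so there is a vector w whose component
      orthogonal to them is nonzero.\<close>
    have "card ?J < CARD(5)"
      using False by (intro psubset_card_mono) auto
    have "dim ((\<lambda>j. e $ j) ` ?J) \<le> card ((\<lambda>j. e $ j) ` ?J)" by (rule dim_le_card') simp
    also have "\<dots> \<le> card ?J" by (rule card_image_le) simp
    also have "\<dots> < CARD(5)" by fact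
    finally have "dim ((\<lambda>j. e $ j) ` ?J) < dim (UNIV :: (real^5) set)" by (simp add: dim_UNIV)
    then have "span ((\<lambda>j. e $ j) ` ?J) \<noteq> UNIV" by (metis dim_span less_irrefl)
    then obtain w where w: "w \<notin> span ((\<lambda>j. e $ j) ` ?J)" by blast
    define u where "u = w - (\<Sum>j\<in>?J. h (e $ j) w *\<^sub>R e $ j)"
    have "u \<noteq> 0"
    proof
      assume "u = 0"
      then have "w = (\<Sum>j\<in>?J. h (e $ j) w *\<^sub>R e $ j)" by (simp add: u_def)
      moreover have "(\<Sum>j\<in>?J. h (e $ j) w *\<^sub>R e $ j) \<in> span ((\<lambda>j. e $ j) ` ?J)"
        by (intro span_sum span_scale span_base imageI)
      ultimately show False using w by simp
    qed
    then have pos: "h u u > 0" by (rule ip_pos)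
    define e' where "e' = (\<chi> j. if j = i then (1 / sqrt (h u u)) *\<^sub>R u else e $ j)"
    have "orthonormal_on h (insert 5 (insert i J)) e'"
      using gram_schmidt_step[OF e(1) False u_def pos] unfolding e'_def by (simp only: insert_commute)
    moreover have "e' $ 5 = n" using False e(2) by (auto simp: e'_def)
    ultimately show ?thesis by blast
  qed
qed

lemma exists_adapted_frame:
  assumes "h n n = 1"
  shows "\<exists>e. oriented_frame h e \<and> e $ 5 = n"
proof -
  obtain e where "orthonormal_on h (insert 5 UNIV) e" and e5: "e $ 5 = n"
    using exists_orthonormal[OF assms, of UNIV] by auto
  then have e: "orthonormal_on h UNIV e" by simp
  show ?thesis
  proof (cases "det e > 0")
    case True
    then show ?thesis using e e5 oriented_frame_orthonormal by blast
  next
    case False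
    then have neg: "det e < 0" using frame_det_nonzero[OF e] by simp
    \<comment> \<open>A wrong orientation is corrected in the first row, because the fifth must
      remain n.\<close>
    define e' where "e' = (\<chi> i. if i = 1 then (-1) *s e $ i else e $ i)"
    have "det e' = -1 * det (\<chi> i. if i = 1 then e $ i else e $ i)"
      unfolding e'_def by (rule det_row_mul)
    then have "det e' > 0" using neg by simp
    moreover have "orthonormal_on h UNIV e'"
      using e by (auto simp: orthonormal_on_def e'_def ip_simps)
    moreover have "e' $ 5 = n" using e5 by (simp add: e'_def)
    ultimately show ?thesis using oriented_frame_orthonormal by blast
  qed
qed

end

subsection \<open>The volume form\<close>

lemma det_transposed_rows:
  fixes R :: "5 \<Rightarrow> real^5"
  assumes "a \<noteq> b" "\<And>r. R' r = R (Transposition.transpose a b r)"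
  shows "det (\<chi> r. R' r) = - det (\<chi> r. R r)"
  using det_permute_rows[of "Transposition.transpose a b" "\<chi> r. R r"] assms
  by (simp add: permutes_swap_id sign_swap_id)

lemma vol_swap:
  "vol e X2 X1 X3 X4 X5 = - vol e X1 X2 X3 X4 X5"
  "vol e X1 X3 X2 X4 X5 = - vol e X1 X2 X3 X4 X5"
  "vol e X1 X2 X4 X3 X5 = - vol e X1 X2 X3 X4 X5"
  "vol e X1 X2 X3 X5 X4 = - vol e X1 X2 X3 X4 X5"
proof -
  let ?R = "\<lambda>r::5. if r = 1 then X1 else if r = 2 then X2 else if r = 3 then X3 else if r = 4 then X4 else X5"
  have *: "\<forall>r. R' r = ?R (Transposition.transpose a b r) \<Longrightarrow> a \<noteq> b \<Longrightarrow> det (\<chi> r. R' r) / det e = - (det (\<chi> r. ?R r) / det e)" for R' a b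
    using det_transposed_rows[of a b R' ?R] by simp
  show "vol e X2 X1 X3 X4 X5 = - vol e X1 X2 X3 X4 X5"
    unfolding vol_def by (rule *[of _ 1 2]) (simp_all add: forall_5 Transposition.transpose_def)
  show "vol e X1 X3 X2 X4 X5 = - vol e X1 X2 X3 X4 X5"
    unfolding vol_def by (rule *[of _ 2 3]) (simp_all add: forall_5 Transposition.transpose_def)
  show "vol e X1 X2 X4 X3 X5 = - vol e X1 X2 X3 X4 X5"
    unfolding vol_def by (rule *[of _ 3 4]) (simp_all add: forall_5 Transposition.transpose_def)
  show "vol e X1 X2 X3 X5 X4 = - vol e X1 X2 X3 X4 X5"
    unfolding vol_def by (rule *[of _ 4 5]) (simp_all add: forall_5 Transposition.transpose_def)
qed

lemma vol_cycle: "vol e X2 X3 X1 X4 X5 = vol e X1 X2 X3 X4 X5"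
  using vol_swap(1)[of e X1 X2 X3] vol_swap(2)[of e X2 X1 X3] by simp

text \<open>The permutation is a product of two disjoint transpositions, hence even; the chain
  realises it by adjacent swaps. It halves the number of volume values needed for
  \<open>star_eta_frame\<close>.\<close>

lemma vol_exchange_pairs: "vol e X4 X5 X3 X1 X2 = vol e X1 X2 X3 X4 X5"
  using vol_swap(3)[of e X4 X5 X3 X1 X2] vol_swap(2)[of e X4 X5 X1 X3 X2] vol_swap(1)[of e X4 X1 X5 X3 X2]
    vol_swap(4)[of e X1 X4 X5 X3 X2] vol_swap(3)[of e X1 X4 X5 X2 X3] vol_swap(2)[of e X1 X4 X2 X5 X3]
    vol_swap(4)[of e X1 X2 X4 X5 X3] vol_swap(3)[of e X1 X2 X4 X3 X5]
    vol_swap(4)[of e X1 X2 X3 X4 X5] vol_swap(4)[of e X4 X5 X3 X1 X2]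
    vol_swap(4)[of e X1 X4 X2 X3 X5] vol_swap(2)[of e X1 X2 X4 X3 X5] vol_swap(2)[of e X1 X2 X4 X5 X3]
    vol_swap(3)[of e X1 X2 X4 X5 X3]
  by linarith

lemma vol_repeated [simp]:
  "vol e X X A B C = 0" "vol e X A X B C = 0" "vol e X A B X C = 0" "vol e X A B C X = 0"
  "vol e A X X B C = 0" "vol e A X B X C = 0" "vol e A X B C X = 0"
  "vol e A B X X C = 0" "vol e A B X C X = 0" "vol e A B C X X = 0"
proof -
  show 12: "vol e X X A B C = 0" for X A B C using vol_swap(1)[of e X X A B C] by simp
  show 23: "vol e A X X B C = 0" for X A B C using vol_swap(2)[of e A X X B C] by simp
  show 34: "vol e A B X X C = 0" for X A B C using vol_swap(3)[of e A B X X C] by simp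
  show "vol e A B C X X = 0" for X A B C using vol_swap(4)[of e A B C X X] by simp
  show 13: "vol e X A X B C = 0" for X A B C using vol_swap(2)[of e X X A B C] 12 by simp
  show 24: "vol e A X B X C = 0" for X A B C using vol_swap(3)[of e A X X B C] 23 by simp
  show "vol e A B X C X = 0" for X A B C using vol_swap(4)[of e A B X X C] 34 by simp
  show 14: "vol e X A B X C = 0" for X A B C using vol_swap(3)[of e X A X B C] 13 by simp
  show "vol e A X B C X = 0" for X A B C using vol_swap(4)[of e A X B X C] 24 by simp
  show "vol e X A B C X = 0" for X A B C using vol_swap(4)[of e X A B X C] 14 by simp
qed

lemma linear_vol1: "linear (\<lambda>X. vol e X X2 X3 X4 X5)"
proof (rule linearI)
  let ?c = "\<lambda>r::5. if r = 2 then X2 else if r = 3 then X3 else if r = 4 then X4 else X5"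
  show "vol e (X + Y) X2 X3 X4 X5 = vol e X X2 X3 X4 X5 + vol e Y X2 X3 X4 X5" for X Y
    unfolding vol_def using det_row_add[of 1 "\<lambda>r. X" "\<lambda>r. Y" ?c] by (simp add: add_divide_distrib)
  show "vol e (c *\<^sub>R X) X2 X3 X4 X5 = c *\<^sub>R vol e X X2 X3 X4 X5" for c X
  proof -
    have "c *s X = c *\<^sub>R X" by (simp add: vec_eq_iff)
    from det_row_mul[of 1 c "\<lambda>r. X" ?c, unfolded this] show ?thesis
      by (simp add: vol_def)
  qed
qed

lemma linear_vol2: "linear (\<lambda>X. vol e X1 X X3 X4 X5)"
  using linear_compose_neg[OF linear_vol1[of e X1 X3 X4 X5]] by (simp add: vol_swap(1)[of e _ X1])

lemma linear_vol3: "linear (\<lambda>X. vol e X1 X2 X X4 X5)"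
  using linear_compose_neg[OF linear_vol2[of e X1 X2 X4 X5]] by (simp add: vol_swap(2)[of e X1 _ X2])

lemma linear_vol4: "linear (\<lambda>X. vol e X1 X2 X3 X X5)"
  using linear_compose_neg[OF linear_vol3[of e X1 X2 X3 X5]] by (simp add: vol_swap(3)[of e X1 X2 _ X3])

lemma linear_vol5: "linear (\<lambda>X. vol e X1 X2 X3 X4 X)"
  using linear_compose_neg[OF linear_vol4[of e X1 X2 X3 X4]] by (simp add: vol_swap(4)[of e X1 X2 X3 _ X4])

lemma vol_frame:
  assumes "det e \<noteq> 0"
  shows "vol e (e $ 1) (e $ 2) (e $ 3) (e $ 4) (e $ 5) = 1"
proof -
  have "(\<chi> r. if r = 1 then e $ 1 else if r = 2 then e $ 2 else if r = 3 then e $ 3 else if r = 4 then e $ 4 else e $ 5) = e"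
    by (simp add: vec_eq_iff[of _ e] forall_5)
  then show ?thesis using assms by (simp add: vol_def)
qed

text \<open>All three permutations are even. They encode the pairings 12|34, 13|42 and 14|23 of
  complementary index pairs, and explain the order 42 in the self-dual basis.\<close>

lemma vol_frame_even:
  assumes "det e \<noteq> 0"
  shows "vol e (e $ 3) (e $ 4) (e $ 5) (e $ 1) (e $ 2) = 1"
    and "vol e (e $ 4) (e $ 2) (e $ 5) (e $ 1) (e $ 3) = 1"
    and "vol e (e $ 2) (e $ 3) (e $ 5) (e $ 1) (e $ 4) = 1"
proof -
  note s = vol_swap[of e]
  \<comment> \<open>Four adjacent swaps: the first vector moves left past three others, the fifth
    moves right past one.\<close>
  have *: "vol e (e $ a) (e $ b) (e $ 5) (e $ 1) (e $ c) = vol e (e $ 1) (e $ a) (e $ b) (e $ c) (e $ 5)" for a b c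
    using s(3)[of "e $ a" "e $ b" "e $ 1" "e $ 5" "e $ c"] s(2)[of "e $ a" "e $ 1" "e $ b" "e $ 5" "e $ c"]
      s(1)[of "e $ 1" "e $ a" "e $ b" "e $ 5" "e $ c"] s(4)[of "e $ 1" "e $ a" "e $ b" "e $ c" "e $ 5"] by linarith
  note f = vol_frame[OF assms]
  show "vol e (e $ 2) (e $ 3) (e $ 5) (e $ 1) (e $ 4) = 1" using *[of 2 3 4] f by simp
  show "vol e (e $ 3) (e $ 4) (e $ 5) (e $ 1) (e $ 2) = 1"
    using *[of 3 4 2] f s(3)[of "e $ 1" "e $ 3" "e $ 2" "e $ 4" "e $ 5"] s(2)[of "e $ 1" "e $ 2" "e $ 3" "e $ 4" "e $ 5"]
    by linarith
  show "vol e (e $ 4) (e $ 2) (e $ 5) (e $ 1) (e $ 3) = 1"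
    using *[of 4 2 3] f s(2)[of "e $ 1" "e $ 2" "e $ 4" "e $ 3" "e $ 5"] s(3)[of "e $ 1" "e $ 2" "e $ 3" "e $ 4" "e $ 5"]
    by linarith
qed

subsection \<open>The operator \<open>\<omega> \<mapsto> *(\<omega> \<and> \<eta>)\<close> in an adapted frame\<close>

lemma bilinear_scaleR_product:
  assumes "linear f" "linear g"
  shows "bilinear (\<lambda>a b. (f a :: real) *\<^sub>R g b)"
  using assms by (simp add: bilinear_def linear_iff algebra_simps)

text \<open>With two of the three indices fixed, the sum is the trace of a bilinear map in the
  remaining slot. Hence \<open>frame_trace\<close> can replace the chosen frame by e one slot at a
  time; the volume form itself agrees for both frames.\<close>

lemma hodge3_frame:
  assumes h: "inner_product h" and e: "oriented_frame h e"
    and \<theta>: "\<And>Y Z. linear (\<lambda>X. \<theta> X Y Z)" "\<And>X Z. linear (\<lambda>Y. \<theta> X Y Z)" "\<And>X Y. linear (\<lambda>Z. \<theta> X Y Z)"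
  shows "hodge3 h \<theta> X Y = (1/6) *\<^sub>R (\<Sum>i\<in>UNIV. \<Sum>j\<in>UNIV. \<Sum>k\<in>UNIV.
    vol e (e $ i) (e $ j) (e $ k) X Y *\<^sub>R \<theta> (e $ i) (e $ j) (e $ k))"
proof -
  define e' where "e' = (SOME e. oriented_frame h e)"
  have e': "oriented_frame h e'" unfolding e'_def using someI[of "oriented_frame h" e] e by simp
  note o = e[unfolded oriented_frame_orthonormal, THEN conjunct1] e'[unfolded oriented_frame_orthonormal, THEN conjunct1]
  have vol: "vol e' = vol e"
    by (intro ext) (simp add: vol_def frame_det_unique[OF h e e'])
  let ?F = "\<lambda>X Y. (1/6) *\<^sub>R (\<Sum>i\<in>UNIV. \<Sum>j\<in>UNIV. \<Sum>k\<in>UNIV.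
    vol e (e' $ i) (e' $ j) (e' $ k) X Y *\<^sub>R \<theta> (e' $ i) (e' $ j) (e' $ k))"
  have "bilinear ?F"
    using linear_vol4[of e] linear_vol5[of e]
    by (simp add: bilinear_def linear_iff scaleR_add_left sum.distrib add_divide_distrib scaleR_add_right scaleR_sum_right mult_ac)
  then have 0: "hodge3 h \<theta> X Y = ?F X Y"
    unfolding hodge3_def Let_def e'_def[symmetric] vol by (simp add: Form2_apply)
  have tr: "(\<Sum>i\<in>UNIV. F (e' $ i) (e' $ i)) = (\<Sum>i\<in>UNIV. F (e $ i) (e $ i))" if "bilinear F" for F :: "real^5 \<Rightarrow> real^5 \<Rightarrow> 'a"
    by (rule frame_trace[OF h o(2,1) that])
  let ?t = "\<lambda>a b c. vol e a b c X Y *\<^sub>R \<theta> a b c"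
  have 1: "(\<Sum>k\<in>UNIV. ?t a b (e' $ k)) = (\<Sum>k\<in>UNIV. ?t a b (e $ k))" for a b
    by (rule tr[OF bilinear_scaleR_product[OF linear_vol3 \<theta>(3)]])
  have 2: "(\<Sum>j\<in>UNIV. ?t a (e' $ j) c) = (\<Sum>j\<in>UNIV. ?t a (e $ j) c)" for a c
    by (rule tr[OF bilinear_scaleR_product[OF linear_vol2 \<theta>(2)]])
  have 3: "(\<Sum>i\<in>UNIV. ?t (e' $ i) b c) = (\<Sum>i\<in>UNIV. ?t (e $ i) b c)" for b c
    by (rule tr[OF bilinear_scaleR_product[OF linear_vol1 \<theta>(1)]])
  have "(\<Sum>i\<in>UNIV. \<Sum>j\<in>UNIV. \<Sum>k\<in>UNIV. ?t (e' $ i) (e' $ j) (e' $ k))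
      = (\<Sum>i\<in>UNIV. \<Sum>j\<in>UNIV. \<Sum>k\<in>UNIV. ?t (e' $ i) (e' $ j) (e $ k))"
    by (simp only: 1)
  also have "\<dots> = (\<Sum>i\<in>UNIV. \<Sum>k\<in>UNIV. \<Sum>j\<in>UNIV. ?t (e' $ i) (e' $ j) (e $ k))"
    by (intro sum.cong refl sum.swap)
  also have "\<dots> = (\<Sum>i\<in>UNIV. \<Sum>k\<in>UNIV. \<Sum>j\<in>UNIV. ?t (e' $ i) (e $ j) (e $ k))"
    by (simp only: 2)
  also have "\<dots> = (\<Sum>k\<in>UNIV. \<Sum>i\<in>UNIV. \<Sum>j\<in>UNIV. ?t (e' $ i) (e $ j) (e $ k))"
    by (rule sum.swap)
  also have "\<dots> = (\<Sum>k\<in>UNIV. \<Sum>j\<in>UNIV. \<Sum>i\<in>UNIV. ?t (e' $ i) (e $ j) (e $ k))"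
    by (intro sum.cong refl sum.swap)
  also have "\<dots> = (\<Sum>k\<in>UNIV. \<Sum>j\<in>UNIV. \<Sum>i\<in>UNIV. ?t (e $ i) (e $ j) (e $ k))"
    by (simp only: 3)
  also have "\<dots> = (\<Sum>k\<in>UNIV. \<Sum>i\<in>UNIV. \<Sum>j\<in>UNIV. ?t (e $ i) (e $ j) (e $ k))"
    by (intro sum.cong refl sum.swap)
  also have "\<dots> = (\<Sum>i\<in>UNIV. \<Sum>k\<in>UNIV. \<Sum>j\<in>UNIV. ?t (e $ i) (e $ j) (e $ k))"
    by (rule sum.swap)
  also have "\<dots> = (\<Sum>i\<in>UNIV. \<Sum>j\<in>UNIV. \<Sum>k\<in>UNIV. ?t (e $ i) (e $ j) (e $ k))"
    by (intro sum.cong refl sum.swap)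
  finally show ?thesis unfolding 0 by simp
qed

locale adapted_frame =
  fixes h :: "real^5 \<Rightarrow> real^5 \<Rightarrow> real" and n :: "real^5" and e :: "real^5^5"
  assumes ip: "inner_product h" and frame: "oriented_frame h e" and e5: "e $ 5 = n"
begin

lemma orthonormal: "orthonormal_on h UNIV e"
  using frame by (simp add: oriented_frame_orthonormal)

lemma h_frame: "h (e $ i) (e $ j) = (if i = j then 1 else 0)"
  using orthonormal by (simp add: orthonormal_on_def)

lemma expansion: "X = (\<Sum>i\<in>UNIV. h (e $ i) X *\<^sub>R e $ i)"
  by (rule frame_expansion[OF ip orthonormal])

lemma form2_expansion:
  fixes \<omega> :: "'b::real_normed_vector form2"
  shows "\<omega> X Y = (\<Sum>i\<in>UNIV. \<Sum>j\<in>UNIV. (h (e $ i) X * h (e $ j) Y) *\<^sub>R \<omega> (e $ i) (e $ j))"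
proof -
  have "\<omega> X Y = \<omega> (\<Sum>i\<in>UNIV. h (e $ i) X *\<^sub>R e $ i) (\<Sum>j\<in>UNIV. h (e $ j) Y *\<^sub>R e $ j)"
    by (simp only: expansion[symmetric])
  also have "\<dots> = (\<Sum>j\<in>UNIV. \<Sum>i\<in>UNIV. (h (e $ i) X * h (e $ j) Y) *\<^sub>R \<omega> (e $ i) (e $ j))"
    by (simp add: blinfun.bilinear_simps blinfun.sum_left blinfun.sum_right scaleR_sum_right mult.commute)
  finally show ?thesis by (subst sum.swap)
qed

lemma form1_eqI_frame:
  fixes \<alpha> \<alpha>' :: "'b::real_normed_vector form1"
  assumes "\<And>i. \<alpha> (e $ i) = \<alpha>' (e $ i)" shows "\<alpha> = \<alpha>'"
proof (rule blinfun_eqI)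
  fix X
  have "\<alpha> X = \<alpha> (\<Sum>i\<in>UNIV. h (e $ i) X *\<^sub>R e $ i)" for \<alpha> :: "'b form1" by (simp only: expansion[symmetric])
  then have "\<alpha> X = (\<Sum>i\<in>UNIV. h (e $ i) X *\<^sub>R \<alpha> (e $ i))" for \<alpha> :: "'b form1"
    by (simp add: blinfun.bilinear_simps blinfun.sum_right)
  then show "\<alpha> X = \<alpha>' X" using assms by simp
qed

lemma form2_eqI_frame:
  fixes \<omega> \<omega>' :: "'b::real_normed_vector form2"
  assumes "\<And>i j. \<omega> (e $ i) (e $ j) = \<omega>' (e $ i) (e $ j)" shows "\<omega> = \<omega>'"
proof (rule form2_eqI)
  show "\<omega> X Y = \<omega>' X Y" for X Y
    by (simp only: form2_expansion[of \<omega> X Y] form2_expansion[of \<omega>' X Y] assms)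
qed

text \<open>Ten independent components determine an alternating form. The pair (4,2) is listed
  instead of (2,4) so that no signs arise against e^13 + e^42.\<close>

lemma alternating_eqI:
  fixes \<omega> \<omega>' :: "'b::real_normed_vector form2"
  assumes a: "alternating \<omega>" "alternating \<omega>'"
    and "\<And>i. \<omega> (e $ i) (e $ 5) = \<omega>' (e $ i) (e $ 5)"
    and "\<omega> (e $ 1) (e $ 2) = \<omega>' (e $ 1) (e $ 2)" "\<omega> (e $ 1) (e $ 3) = \<omega>' (e $ 1) (e $ 3)"
    and "\<omega> (e $ 1) (e $ 4) = \<omega>' (e $ 1) (e $ 4)" "\<omega> (e $ 2) (e $ 3) = \<omega>' (e $ 2) (e $ 3)"
    and "\<omega> (e $ 4) (e $ 2) = \<omega>' (e $ 4) (e $ 2)" "\<omega> (e $ 3) (e $ 4) = \<omega>' (e $ 3) (e $ 4)"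
  shows "\<omega> = \<omega>'"
proof (rule form2_eqI_frame)
  have 0: "\<omega> (e $ i) (e $ i) = \<omega>' (e $ i) (e $ i)" for i
    using a unfolding alternating_def by simp
  have s: "\<omega> (e $ i) (e $ j) = \<omega>' (e $ i) (e $ j) \<Longrightarrow> \<omega> (e $ j) (e $ i) = \<omega>' (e $ j) (e $ i)" for i j
    using alternating_skew[OF a(1), of "e $ j" "e $ i"] alternating_skew[OF a(2), of "e $ j" "e $ i"] by simp
  have "\<forall>i j. \<omega> (e $ i) (e $ j) = \<omega>' (e $ i) (e $ j)"
    unfolding forall_5 by (intro conjI; (rule 0 | rule assms | rule s, rule assms))
  then show "\<omega> (e $ i) (e $ j) = \<omega>' (e $ i) (e $ j)" for i j by blast
qed

definition star_eta :: "'b::real_normed_vector form2 \<Rightarrow> 'b form2" where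
  "star_eta \<omega> = hodge3 h (wedge21 \<omega> (h n))"

text \<open>The volume form is invariant under cyclic shifts of its first three arguments, so the
  three terms of \<omega> \<and> \<eta> contribute equally and 1/6 becomes 1/2; the factor
  \<eta>(e_k) leaves only k = 5.\<close>

lemma star_eta_vol:
  fixes \<omega> :: "'b::real_normed_vector form2"
  shows "star_eta \<omega> X Y = (1/2) *\<^sub>R (\<Sum>i\<in>UNIV. \<Sum>j\<in>UNIV.
     vol e (e $ i) (e $ j) n X Y *\<^sub>R \<omega> (e $ i) (e $ j))"
proof -
  let ?w = "\<lambda>i j. \<omega> (e $ i) (e $ j)" and ?v = "\<lambda>i j k. vol e (e $ i) (e $ j) (e $ k) X Y"
  have l: "linear (h n)" by (rule ip_linear[OF ip])
  have "star_eta \<omega> X Y = (1/6) *\<^sub>R (\<Sum>i\<in>UNIV. \<Sum>j\<in>UNIV. \<Sum>k\<in>UNIV. ?v i j k *\<^sub>R wedge21 \<omega> (h n) (e $ i) (e $ j) (e $ k))"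
    unfolding star_eta_def
    by (rule hodge3_frame[OF ip frame])
      (auto intro!: linearI simp: wedge21_def blinfun.bilinear_simps linear_add[OF l] linear_scale[OF l] algebra_simps)
  also have "(\<Sum>i\<in>UNIV. \<Sum>j\<in>UNIV. \<Sum>k\<in>UNIV. ?v i j k *\<^sub>R wedge21 \<omega> (h n) (e $ i) (e $ j) (e $ k))
     = (\<Sum>i\<in>UNIV. \<Sum>j\<in>UNIV. \<Sum>k\<in>UNIV. (?v i j k * h n (e $ k)) *\<^sub>R ?w i j)
     + (\<Sum>i\<in>UNIV. \<Sum>j\<in>UNIV. \<Sum>k\<in>UNIV. (?v j k i * h n (e $ i)) *\<^sub>R ?w j k)
     + (\<Sum>i\<in>UNIV. \<Sum>j\<in>UNIV. \<Sum>k\<in>UNIV. (?v k i j * h n (e $ j)) *\<^sub>R ?w k i)"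
  proof -
    have "?v i j k *\<^sub>R wedge21 \<omega> (h n) (e $ i) (e $ j) (e $ k) = (?v i j k * h n (e $ k)) *\<^sub>R ?w i j
        + (?v j k i * h n (e $ i)) *\<^sub>R ?w j k + (?v k i j * h n (e $ j)) *\<^sub>R ?w k i" for i j k
    proof -
      have "?v j k i = ?v i j k" "?v k i j = ?v i j k"
        using vol_cycle[of e "e $ j" "e $ k" "e $ i" X Y] vol_cycle[of e "e $ k" "e $ i" "e $ j" X Y] by simp_all
      then show ?thesis by (simp add: wedge21_def scaleR_add_right)
    qed
    then show ?thesis by (simp only: sum.distrib)
  qed
  also have "(\<Sum>i\<in>UNIV. \<Sum>j\<in>UNIV. \<Sum>k\<in>UNIV. (?v j k i * h n (e $ i)) *\<^sub>R ?w j k)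
      = (\<Sum>j\<in>UNIV. \<Sum>k\<in>UNIV. \<Sum>i\<in>UNIV. (?v j k i * h n (e $ i)) *\<^sub>R ?w j k)"
    by (subst sum.swap) (intro sum.cong refl sum.swap)
  also have "(\<Sum>i\<in>UNIV. \<Sum>j\<in>UNIV. \<Sum>k\<in>UNIV. (?v k i j * h n (e $ j)) *\<^sub>R ?w k i)
      = (\<Sum>k\<in>UNIV. \<Sum>i\<in>UNIV. \<Sum>j\<in>UNIV. (?v k i j * h n (e $ j)) *\<^sub>R ?w k i)"
    by (rule trans[OF sum.cong[OF refl sum.swap] sum.swap])
  finally have "star_eta \<omega> X Y = (1/2) *\<^sub>R (\<Sum>i\<in>UNIV. \<Sum>j\<in>UNIV. \<Sum>k\<in>UNIV. (?v i j k * h n (e $ k)) *\<^sub>R ?w i j)"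
  proof -
    have "T + T + T = (1 + 1 + 1) *\<^sub>R T" for T :: 'b by (simp only: scaleR_add_left scaleR_one)
    then have "(1/6) *\<^sub>R (T + T + T) = (1/2) *\<^sub>R T" for T :: 'b by simp
    then show "star_eta \<omega> X Y = (1/6) *\<^sub>R (T + T + T) \<Longrightarrow> star_eta \<omega> X Y = (1/2) *\<^sub>R T" for T by simp
  qed
  moreover have "h n (e $ k) = (if k = 5 then 1 else 0)" for k
    using h_frame[of 5 k] by (auto simp: e5)
  ultimately show ?thesis by (simp add: if_distrib if_distribR e5 cong: if_cong)
qed

lemma alternating_star_eta: "alternating (star_eta \<omega>)"
  unfolding alternating_def star_eta_vol by simp

text \<open>For k, l among 1, ..., 4 a repeated index kills every term of
  \<open>star_eta_vol\<close> except those of the complementary pair. Its two orders contribute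
  equally and cancel the factor 1/2.\<close>

lemma star_eta_frame:
  fixes \<omega> :: "'b::real_normed_vector form2"
  assumes "alternating \<omega>"
  shows "star_eta \<omega> (e $ i) (e $ 5) = 0"
    and "star_eta \<omega> (e $ 1) (e $ 2) = \<omega> (e $ 3) (e $ 4)" and "star_eta \<omega> (e $ 3) (e $ 4) = \<omega> (e $ 1) (e $ 2)"
    and "star_eta \<omega> (e $ 1) (e $ 3) = \<omega> (e $ 4) (e $ 2)" and "star_eta \<omega> (e $ 4) (e $ 2) = \<omega> (e $ 1) (e $ 3)"
    and "star_eta \<omega> (e $ 1) (e $ 4) = \<omega> (e $ 2) (e $ 3)" and "star_eta \<omega> (e $ 2) (e $ 3) = \<omega> (e $ 1) (e $ 4)"
proof -
  have d: "det e \<noteq> 0" by (rule frame_det_nonzero[OF ip orthonormal])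
  let ?v = "\<lambda>i j k l. vol e (e $ i) (e $ j) (e $ 5) (e $ k) (e $ l)"
  have *: "star_eta \<omega> (e $ k) (e $ l) = \<omega> (e $ i) (e $ j)"
    if "?v i j k l = 1" "{i, j, k, l} = {1, 2, 3, 4}" "i \<noteq> j" for i j k l
  proof -
    have v: "?v j i k l = -1" using vol_swap(1)[of e "e $ i" "e $ j"] that(1) by simp
    have "star_eta \<omega> (e $ k) (e $ l) = (1/2) *\<^sub>R (\<Sum>p\<in>UNIV \<times> UNIV. ?v (fst p) (snd p) k l *\<^sub>R \<omega> (e $ fst p) (e $ snd p))"
      by (simp only: star_eta_vol e5 sum.cartesian_product case_prod_unfold)
    also have "(\<Sum>p\<in>UNIV \<times> UNIV. ?v (fst p) (snd p) k l *\<^sub>R \<omega> (e $ fst p) (e $ snd p))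
       = (\<Sum>p\<in>{(i, j), (j, i)}. ?v (fst p) (snd p) k l *\<^sub>R \<omega> (e $ fst p) (e $ snd p))"
    proof (rule sum.mono_neutral_right)
      show "\<forall>p\<in>UNIV \<times> UNIV - {(i, j), (j, i)}. ?v (fst p) (snd p) k l *\<^sub>R \<omega> (e $ fst p) (e $ snd p) = 0"
      proof
        fix p assume "p \<in> UNIV \<times> UNIV - {(i, j), (j, i)}"
        moreover obtain a b where p: "p = (a, b)" by (cases p)
        ultimately have ne: "(a, b) \<noteq> (i, j)" "(a, b) \<noteq> (j, i)" by auto
        have "UNIV = {i, j, k, l, 5}" unfolding UNIV_5 using that(2) by auto
        then have "a \<in> {i, j, k, l, 5}" "b \<in> {i, j, k, l, 5}" by auto
        then have "?v a b k l = 0" using ne by auto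
        then show "?v (fst p) (snd p) k l *\<^sub>R \<omega> (e $ fst p) (e $ snd p) = 0" by (simp add: p)
      qed
    qed auto
    also have "\<dots> = \<omega> (e $ i) (e $ j) - \<omega> (e $ j) (e $ i)"
      using that(1,3) v by simp
    also have "\<dots> = 2 *\<^sub>R \<omega> (e $ i) (e $ j)"
      using alternating_skew[OF assms, of "e $ j" "e $ i"] by (simp add: scaleR_2)
    finally show ?thesis by simp
  qed
  note v = vol_frame_even[OF d]
  have x: "?v i j k l = 1 \<Longrightarrow> ?v k l i j = 1" for i j k l
    using vol_exchange_pairs by simp
  show "star_eta \<omega> (e $ i) (e $ 5) = 0" unfolding star_eta_vol by (simp add: e5)
  show "star_eta \<omega> (e $ 1) (e $ 2) = \<omega> (e $ 3) (e $ 4)" by (rule *[OF v(1)]) auto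
  show "star_eta \<omega> (e $ 3) (e $ 4) = \<omega> (e $ 1) (e $ 2)" by (rule *[OF x[OF v(1)]]) auto
  show "star_eta \<omega> (e $ 1) (e $ 3) = \<omega> (e $ 4) (e $ 2)" by (rule *[OF v(2)]) auto
  show "star_eta \<omega> (e $ 4) (e $ 2) = \<omega> (e $ 1) (e $ 3)" by (rule *[OF x[OF v(2)]]) auto
  show "star_eta \<omega> (e $ 1) (e $ 4) = \<omega> (e $ 2) (e $ 3)" by (rule *[OF v(3)]) auto
  show "star_eta \<omega> (e $ 2) (e $ 3) = \<omega> (e $ 1) (e $ 4)" by (rule *[OF x[OF v(3)]]) auto
qed

lemma alternating_combination:
  "alternating \<omega> \<Longrightarrow> alternating \<omega>' \<Longrightarrow> alternating (a *\<^sub>R \<omega> + b *\<^sub>R \<omega>')"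
  "alternating \<omega> \<Longrightarrow> alternating \<omega>' \<Longrightarrow> alternating (\<omega> + \<omega>')"
  "alternating \<omega> \<Longrightarrow> alternating \<omega>' \<Longrightarrow> alternating (\<omega> - \<omega>')"
  "alternating \<omega> \<Longrightarrow> alternating (a *\<^sub>R \<omega>)"
  for \<omega> \<omega>' :: "'b::real_normed_vector form2"
  by (simp_all add: alternating_def blinfun.bilinear_simps)

text \<open>The operator exchanges complementary components, so the eigenvalue equation becomes a
  list of component equations; keeping \<mu> general serves the eigenvalues 1, -1 and 0 at
  once.\<close>

lemma star_eigenforms_iff:
  fixes \<omega> :: "'b::real_normed_vector form2"
  shows "\<omega> \<in> star_eigenforms h n \<mu> \<longleftrightarrow> alternating \<omega> \<and> (\<forall>i. \<mu> *\<^sub>R \<omega> (e $ i) (e $ 5) = 0) \<and>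
     \<omega> (e $ 3) (e $ 4) = \<mu> *\<^sub>R \<omega> (e $ 1) (e $ 2) \<and> \<omega> (e $ 1) (e $ 2) = \<mu> *\<^sub>R \<omega> (e $ 3) (e $ 4) \<and>
     \<omega> (e $ 4) (e $ 2) = \<mu> *\<^sub>R \<omega> (e $ 1) (e $ 3) \<and> \<omega> (e $ 1) (e $ 3) = \<mu> *\<^sub>R \<omega> (e $ 4) (e $ 2) \<and>
     \<omega> (e $ 2) (e $ 3) = \<mu> *\<^sub>R \<omega> (e $ 1) (e $ 4) \<and> \<omega> (e $ 1) (e $ 4) = \<mu> *\<^sub>R \<omega> (e $ 2) (e $ 3)"
    (is "_ \<longleftrightarrow> _ \<and> ?C")
proof (cases "alternating \<omega>")
  case True
  note s = star_eta_frame[OF True]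
  have "star_eta \<omega> = \<mu> *\<^sub>R \<omega> \<longleftrightarrow> ?C"
  proof
    assume "star_eta \<omega> = \<mu> *\<^sub>R \<omega>"
    then have "star_eta \<omega> X Y = \<mu> *\<^sub>R \<omega> X Y" for X Y by (simp only: blinfun.scaleR_left)
    note * = this[of "e $ _" "e $ _"]
    show ?C
      by (intro conjI allI *[of _ 5, unfolded s, symmetric] *[of 1 2, unfolded s] *[of 3 4, unfolded s]
          *[of 1 3, unfolded s] *[of 4 2, unfolded s] *[of 1 4, unfolded s] *[of 2 3, unfolded s])
  next
    assume C: ?C
    then show "star_eta \<omega> = \<mu> *\<^sub>R \<omega>"
      by (intro alternating_eqI[OF alternating_star_eta alternating_combination(4)[OF True]];
          unfold s blinfun.scaleR_left; use C in \<open>elim conjE allE; metis\<close>)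
  qed
  then show ?thesis using True by (simp add: star_eigenforms_def star_eta_def)
next
  case False
  then show ?thesis by (simp add: star_eigenforms_def)
qed

lemma star_plus_iff:
  fixes \<omega> :: "'b::real_normed_vector form2"
  shows "\<omega> \<in> star_eigenforms h n 1 \<longleftrightarrow> alternating \<omega> \<and> (\<forall>i. \<omega> (e $ i) (e $ 5) = 0) \<and>
     \<omega> (e $ 3) (e $ 4) = \<omega> (e $ 1) (e $ 2) \<and> \<omega> (e $ 4) (e $ 2) = \<omega> (e $ 1) (e $ 3) \<and>
     \<omega> (e $ 2) (e $ 3) = \<omega> (e $ 1) (e $ 4)"
  unfolding star_eigenforms_iff scaleR_one
  by (rule iffI; elim conjE; intro conjI; (assumption | rule sym, assumption))

lemma plus_part_props:
  fixes \<omega> :: "'b::real_normed_vector form2"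
  assumes "alternating \<omega>"
  shows plus_part_mem: "plus_part h n \<omega> \<in> star_eigenforms h n 1"
    and plus_part_frame:
      "plus_part h n \<omega> (e $ 1) (e $ 2) = (1/2) *\<^sub>R (\<omega> (e $ 1) (e $ 2) + \<omega> (e $ 3) (e $ 4))"
      "plus_part h n \<omega> (e $ 1) (e $ 3) = (1/2) *\<^sub>R (\<omega> (e $ 1) (e $ 3) + \<omega> (e $ 4) (e $ 2))"
      "plus_part h n \<omega> (e $ 1) (e $ 4) = (1/2) *\<^sub>R (\<omega> (e $ 1) (e $ 4) + \<omega> (e $ 2) (e $ 3))"
proof -
  let ?P = "\<lambda>\<alpha>. \<alpha> \<in> star_eigenforms h n 1 \<and>
     (\<exists>\<beta>\<in>star_eigenforms h n (-1). \<exists>\<gamma>\<in>star_eigenforms h n 0. \<omega> = \<beta> + \<gamma> + \<alpha>)"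
  define S where "S = star_eta \<omega>"
  define SS where "SS = star_eta S"
  have aS: "alternating S" and aSS: "alternating SS" unfolding S_def SS_def by (rule alternating_star_eta)+
  note s = star_eta_frame[OF assms, folded S_def]
  note ss = star_eta_frame[OF aS, folded SS_def, unfolded s]
  \<comment> \<open>The operator T = \<open>star_eta\<close> satisfies T^3 = T on alternating forms,
    so its spectral projections for 1, -1 and 0 are (T^2 + T)/2, (T^2 - T)/2 and 1 - T^2.\<close>
  let ?\<alpha> = "(1/2) *\<^sub>R SS + (1/2) *\<^sub>R S" and ?\<beta> = "(1/2) *\<^sub>R SS - (1/2) *\<^sub>R S" and ?\<gamma> = "\<omega> - SS"
  have "?\<alpha> \<in> star_eigenforms h n 1"
    unfolding star_plus_iff using alternating_combination(1)[OF aSS aS]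
    by (simp add: s ss blinfun.add_left blinfun.scaleR_left)
  moreover have "?\<beta> \<in> star_eigenforms h n (-1)"
    unfolding star_eigenforms_iff
    using alternating_combination(3)[OF alternating_combination(4)[OF aSS, of "1/2"] alternating_combination(4)[OF aS, of "1/2"]]
    by (simp add: s ss blinfun.diff_left blinfun.scaleR_left)
  moreover have "?\<gamma> \<in> star_eigenforms h n 0"
    unfolding star_eigenforms_iff using alternating_combination(3)[OF assms aSS]
    by (simp add: s ss blinfun.diff_left)
  moreover have "\<omega> = ?\<beta> + ?\<gamma> + ?\<alpha>"
  proof -
    have "(1/2) *\<^sub>R SS + (1/2) *\<^sub>R SS = SS"
      unfolding scaleR_add_left[symmetric] by simp
    then show ?thesis by (simp add: algebra_simps)
  qed
  ultimately have ex: "?P ?\<alpha>" by blast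
  \<comment> \<open>In a sum of complementary components the (-1)-part cancels and the 0-part has no
    such components, which leaves twice the component of \<alpha>. The same values prove uniqueness
    for the definite description.\<close>
  have vals: "\<alpha> (e $ 1) (e $ 2) = (1/2) *\<^sub>R (\<omega> (e $ 1) (e $ 2) + \<omega> (e $ 3) (e $ 4)) \<and>
      \<alpha> (e $ 1) (e $ 3) = (1/2) *\<^sub>R (\<omega> (e $ 1) (e $ 3) + \<omega> (e $ 4) (e $ 2)) \<and>
      \<alpha> (e $ 1) (e $ 4) = (1/2) *\<^sub>R (\<omega> (e $ 1) (e $ 4) + \<omega> (e $ 2) (e $ 3))" if "?P \<alpha>" for \<alpha>
  proof -
    from that obtain \<beta> \<gamma> where *: "\<beta> \<in> star_eigenforms h n (-1)" "\<gamma> \<in> star_eigenforms h n 0" "\<omega> = \<beta> + \<gamma> + \<alpha>" "\<alpha> \<in> star_eigenforms h n 1"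
      by blast
    have "\<beta> (e $ 3) (e $ 4) = - \<beta> (e $ 1) (e $ 2) \<and> \<beta> (e $ 4) (e $ 2) = - \<beta> (e $ 1) (e $ 3) \<and> \<beta> (e $ 2) (e $ 3) = - \<beta> (e $ 1) (e $ 4)"
      using *(1) unfolding star_eigenforms_iff scaleR_minus1_left by blast
    moreover have "\<gamma> (e $ 3) (e $ 4) = 0 \<and> \<gamma> (e $ 4) (e $ 2) = 0 \<and> \<gamma> (e $ 2) (e $ 3) = 0 \<and>
        \<gamma> (e $ 1) (e $ 2) = 0 \<and> \<gamma> (e $ 1) (e $ 3) = 0 \<and> \<gamma> (e $ 1) (e $ 4) = 0"
      using *(2) unfolding star_eigenforms_iff scaleR_zero_left by blast
    moreover have "\<alpha> (e $ 3) (e $ 4) = \<alpha> (e $ 1) (e $ 2) \<and> \<alpha> (e $ 4) (e $ 2) = \<alpha> (e $ 1) (e $ 3) \<and> \<alpha> (e $ 2) (e $ 3) = \<alpha> (e $ 1) (e $ 4)"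
      using *(4) unfolding star_plus_iff by blast
    ultimately show ?thesis
      unfolding *(3) by (simp add: blinfun.add_left scaleR_2[symmetric])
  qed
  have uniq: "\<alpha> = ?\<alpha>" if "?P \<alpha>" for \<alpha>
  proof -
    have a: "\<alpha> \<in> star_eigenforms h n 1" "?\<alpha> \<in> star_eigenforms h n 1" using that ex by blast+
    show ?thesis
      by (rule alternating_eqI) (use a[unfolded star_plus_iff] vals[OF that] vals[OF ex] in metis)+
  qed
  have "plus_part h n \<omega> = ?\<alpha>"
    unfolding plus_part_def
  proof (rule the_equality)
    show "?P ?\<alpha>" by (rule ex)
    show "\<alpha> = ?\<alpha>" if "?P \<alpha>" for \<alpha> by (rule uniq[OF that])
  qed
  then have "?P (plus_part h n \<omega>)" using ex by simp
  then show "plus_part h n \<omega> \<in> star_eigenforms h n 1"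
    "plus_part h n \<omega> (e $ 1) (e $ 2) = (1/2) *\<^sub>R (\<omega> (e $ 1) (e $ 2) + \<omega> (e $ 3) (e $ 4))"
    "plus_part h n \<omega> (e $ 1) (e $ 3) = (1/2) *\<^sub>R (\<omega> (e $ 1) (e $ 3) + \<omega> (e $ 4) (e $ 2))"
    "plus_part h n \<omega> (e $ 1) (e $ 4) = (1/2) *\<^sub>R (\<omega> (e $ 1) (e $ 4) + \<omega> (e $ 2) (e $ 3))"
    using vals by blast+
qed

end

subsection \<open>Exactness of the symbol sequence\<close>

text \<open>Coordinates with respect to an adapted frame: \<open>z\<close> is the covector, \<open>a\<close> the 1-form, and \<open>b\<close> the
  components of the self-dual form along \<open>e\<^sup>1\<^sup>2+e\<^sup>3\<^sup>4, e\<^sup>1\<^sup>3+e\<^sup>4\<^sup>2, e\<^sup>1\<^sup>4+e\<^sup>2\<^sup>3\<close>. The equations combine to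
  \<open>(z\<^sub>5\<^sup>2 + |z\<^sub>h|\<^sup>2/2) b = 0\<close> through \<open>(z\<^sub>h \<and> \<iota>\<^sub>z\<^sub>h b)\<^sup>+ = |z\<^sub>h|\<^sup>2 b/2\<close>.\<close>

lemma symbol_kernel_coordinates:
  fixes a1 a2 a3 a4 a5 b1 b2 b3 z1 z2 z3 z4 z5 :: real
  assumes E1: "z5*a1 - z1*a5 - z2*b1 - z3*b2 - z4*b3 = 0"
    and E2: "z5*a2 - z2*a5 + z1*b1 - z3*b3 + z4*b2 = 0"
    and E3: "z5*a3 - z3*a5 + z1*b2 + z2*b3 - z4*b1 = 0"
    and E4: "z5*a4 - z4*a5 + z1*b3 - z2*b2 + z3*b1 = 0"
    and F1: "z1*a2 - z2*a1 + z3*a4 - z4*a3 = 2*z5*b1"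
    and F2: "z1*a3 - z3*a1 + z4*a2 - z2*a4 = 2*z5*b2"
    and F3: "z1*a4 - z4*a1 + z2*a3 - z3*a2 = 2*z5*b3"
    and nz: "z1*z1 + z2*z2 + z3*z3 + z4*z4 + z5*z5 \<noteq> 0"
  shows "b1 = 0 \<and> b2 = 0 \<and> b3 = 0"
    and "(z1*z1 + z2*z2 + z3*z3 + z4*z4 + z5*z5)*a1 = z1*(z1*a1 + z2*a2 + z3*a3 + z4*a4 + z5*a5) \<and>
      (z1*z1 + z2*z2 + z3*z3 + z4*z4 + z5*z5)*a2 = z2*(z1*a1 + z2*a2 + z3*a3 + z4*a4 + z5*a5) \<and>
      (z1*z1 + z2*z2 + z3*z3 + z4*z4 + z5*z5)*a3 = z3*(z1*a1 + z2*a2 + z3*a3 + z4*a4 + z5*a5) \<and>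
      (z1*z1 + z2*z2 + z3*z3 + z4*z4 + z5*z5)*a4 = z4*(z1*a1 + z2*a2 + z3*a3 + z4*a4 + z5*a5) \<and>
      (z1*z1 + z2*z2 + z3*z3 + z4*z4 + z5*z5)*a5 = z5*(z1*a1 + z2*a2 + z3*a3 + z4*a4 + z5*a5)"
proof -
  let ?M = "z1*z1 + z2*z2 + z3*z3 + z4*z4 + 2*(z5*z5)"
  have "z1*z1 \<ge> 0" "z2*z2 \<ge> 0" "z3*z3 \<ge> 0" "z4*z4 \<ge> 0" "z5*z5 \<ge> 0" by simp_all
  then have M: "?M \<noteq> 0" using nz by linarith
  have "?M * b1 = 0" using E1 E2 E3 E4 F1 by algebra
  moreover have "?M * b2 = 0" using E1 E2 E3 E4 F2 by algebra
  moreover have "?M * b3 = 0" using E1 E2 E3 E4 F3 by algebra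
  ultimately show b: "b1 = 0 \<and> b2 = 0 \<and> b3 = 0" using M by simp
  then have E: "z5*a1 = z1*a5" "z5*a2 = z2*a5" "z5*a3 = z3*a5" "z5*a4 = z4*a5"
    and F: "z1*a2 - z2*a1 + z3*a4 - z4*a3 = 0" "z1*a3 - z3*a1 + z4*a2 - z2*a4 = 0" "z1*a4 - z4*a1 + z2*a3 - z3*a2 = 0"
    using E1 E2 E3 E4 F1 F2 F3 by simp_all
  show "(z1*z1 + z2*z2 + z3*z3 + z4*z4 + z5*z5)*a1 = z1*(z1*a1 + z2*a2 + z3*a3 + z4*a4 + z5*a5) \<and>
      (z1*z1 + z2*z2 + z3*z3 + z4*z4 + z5*z5)*a2 = z2*(z1*a1 + z2*a2 + z3*a3 + z4*a4 + z5*a5) \<and>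
      (z1*z1 + z2*z2 + z3*z3 + z4*z4 + z5*z5)*a3 = z3*(z1*a1 + z2*a2 + z3*a3 + z4*a4 + z5*a5) \<and>
      (z1*z1 + z2*z2 + z3*z3 + z4*z4 + z5*z5)*a4 = z4*(z1*a1 + z2*a2 + z3*a3 + z4*a4 + z5*a5) \<and>
      (z1*z1 + z2*z2 + z3*z3 + z4*z4 + z5*z5)*a5 = z5*(z1*a1 + z2*a2 + z3*a3 + z4*a4 + z5*a5)"
  proof (intro conjI)
    show "(z1*z1 + z2*z2 + z3*z3 + z4*z4 + z5*z5)*a1 = z1*(z1*a1 + z2*a2 + z3*a3 + z4*a4 + z5*a5)"
      using E F by algebra
    show "(z1*z1 + z2*z2 + z3*z3 + z4*z4 + z5*z5)*a2 = z2*(z1*a1 + z2*a2 + z3*a3 + z4*a4 + z5*a5)"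
      using E F by algebra
    show "(z1*z1 + z2*z2 + z3*z3 + z4*z4 + z5*z5)*a3 = z3*(z1*a1 + z2*a2 + z3*a3 + z4*a4 + z5*a5)"
      using E F by algebra
    show "(z1*z1 + z2*z2 + z3*z3 + z4*z4 + z5*z5)*a4 = z4*(z1*a1 + z2*a2 + z3*a3 + z4*a4 + z5*a5)"
      using E F by algebra
    show "(z1*z1 + z2*z2 + z3*z3 + z4*z4 + z5*z5)*a5 = z5*(z1*a1 + z2*a2 + z3*a3 + z4*a4 + z5*a5)"
      using E F by algebra
  qed
qed

text \<open>The explicit right inverse of the symbol: \<open>y = 1/|z|\<^sup>2\<close> and \<open>x = 1/(|z\<^sub>h|\<^sup>2 + 2 z\<^sub>5\<^sup>2)\<close>.\<close>

lemma symbol_onto_coordinates: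
  fixes z1 z2 z3 z4 z5 x y r1 r2 r3 r4 t1 t2 t3 :: real
  assumes y: "(z1*z1 + z2*z2 + z3*z3 + z4*z4 + z5*z5)*y = 1"
    and x: "(z1*z1 + z2*z2 + z3*z3 + z4*z4 + 2*z5*z5)*x = 1"
    and c: "c = z1*r1 + z2*r2 + z3*r3 + z4*r4"
    and a1: "a1 = 2*x*(z5*r1 - z2*t1 - z3*t2 - z4*t3) - x*y*z5*z1*c"
    and a2: "a2 = 2*x*(z5*r2 + z1*t1 - z3*t3 + z4*t2) - x*y*z5*z2*c"
    and a3: "a3 = 2*x*(z5*r3 + z1*t2 + z2*t3 - z4*t1) - x*y*z5*z3*c"
    and a4: "a4 = 2*x*(z5*r4 + z1*t3 - z2*t2 + z3*t1) - x*y*z5*z4*c"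
    and a5: "a5 = - (y*c)"
    and b1: "b1 = x*(z1*r2 - z2*r1 + z3*r4 - z4*r3 - 2*z5*t1)"
    and b2: "b2 = x*(z1*r3 - z3*r1 + z4*r2 - z2*r4 - 2*z5*t2)"
    and b3: "b3 = x*(z1*r4 - z4*r1 + z2*r3 - z3*r2 - 2*z5*t3)"
  shows "z5*a1 - z1*a5 - z2*b1 - z3*b2 - z4*b3 = r1"
    and "z5*a2 - z2*a5 + z1*b1 - z3*b3 + z4*b2 = r2"
    and "z5*a3 - z3*a5 + z1*b2 + z2*b3 - z4*b1 = r3"
    and "z5*a4 - z4*a5 + z1*b3 - z2*b2 + z3*b1 = r4"
    and "z1*a2 - z2*a1 + z3*a4 - z4*a3 - 2*z5*b1 = 2*t1"
    and "z1*a3 - z3*a1 + z4*a2 - z2*a4 - 2*z5*b2 = 2*t2"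
    and "z1*a4 - z4*a1 + z2*a3 - z3*a2 - 2*z5*b3 = 2*t3"
proof -
  show "z5*a1 - z1*a5 - z2*b1 - z3*b2 - z4*b3 = r1"
    unfolding a1 a5 b1 b2 b3 using x y c by algebra
  show "z5*a2 - z2*a5 + z1*b1 - z3*b3 + z4*b2 = r2"
    unfolding a2 a5 b1 b2 b3 using x y c by algebra
  show "z5*a3 - z3*a5 + z1*b2 + z2*b3 - z4*b1 = r3"
    unfolding a3 a5 b1 b2 b3 using x y c by algebra
  show "z5*a4 - z4*a5 + z1*b3 - z2*b2 + z3*b1 = r4"
    unfolding a4 a5 b1 b2 b3 using x y c by algebra
  show "z1*a2 - z2*a1 + z3*a4 - z4*a3 - 2*z5*b1 = 2*t1"
    unfolding a1 a2 a3 a4 b1 using x by algebra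
  show "z1*a3 - z3*a1 + z4*a2 - z2*a4 - 2*z5*b2 = 2*t2"
    unfolding a1 a2 a3 a4 b2 using x by algebra
  show "z1*a4 - z4*a1 + z2*a3 - z3*a2 - 2*z5*b3 = 2*t3"
    unfolding a1 a2 a3 a4 b3 using x by algebra
qed

lemma tensor1_zero [simp]: "tensor1 a 0 = 0"
  by (rule blinfun_eqI) simp

text \<open>This is \<zeta> \<and> \<alpha>, with the covector as the first factor.\<close>

definition wedge_form ::
  "'b form1 \<Rightarrow> ((real^5) \<Rightarrow>\<^sub>L real) \<Rightarrow> 'b::real_normed_vector form2" where
  "wedge_form \<alpha> \<zeta> = Form2 (\<lambda>X Y. \<zeta> X *\<^sub>R \<alpha> Y - \<zeta> Y *\<^sub>R \<alpha> X)"

lemma wedge_form_apply [simp]: "wedge_form \<alpha> \<zeta> X Y = \<zeta> X *\<^sub>R \<alpha> Y - \<zeta> Y *\<^sub>R \<alpha> X"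
  unfolding wedge_form_def
  by (rule Form2_apply) (simp add: bilinear_def linear_iff blinfun.bilinear_simps algebra_simps)

lemma alternating_wedge_form: "alternating (wedge_form \<alpha> \<zeta>)"
  by (simp add: alternating_def)

context adapted_frame
begin

definition coframe :: "5 \<Rightarrow> (real^5) \<Rightarrow>\<^sub>L real" where
  "coframe i = Blinfun (h (e $ i))"

lemma coframe_apply: "coframe i X = h (e $ i) X"
  unfolding coframe_def by (rule Blinfun_apply[OF ip_linear[OF ip]])

lemma coframe_frame [simp]: "coframe i (e $ j) = (if i = j then 1 else 0)"
  by (simp add: coframe_apply h_frame)

text \<open>The form e^i \<and> e^j \<otimes> y, written through \<open>tensor1\<close> so that it
  is visibly bounded linear in y and can be differentiated along a curve.\<close>

definition skew :: "5 \<Rightarrow> 5 \<Rightarrow> 'b \<Rightarrow> 'b::real_normed_vector form2" where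
  "skew i j y = tensor1 (coframe i) (tensor1 (coframe j) y) - tensor1 (coframe j) (tensor1 (coframe i) y)"

lemma skew_apply: "skew i j y X Y = (coframe i X * coframe j Y - coframe j X * coframe i Y) *\<^sub>R y"
  by (simp add: skew_def blinfun.bilinear_simps algebra_simps)

text \<open>Parametrizes self-dual forms by their components at 12, 13 and 14; the basis is not
  normalized by 1/sqrt 2 as it is in \<open>sd_basis\<close>.\<close>

definition plus_form :: "'b \<Rightarrow> 'b \<Rightarrow> 'b \<Rightarrow> 'b::real_normed_vector form2" where
  "plus_form y1 y2 y3 = (skew 1 2 y1 + skew 3 4 y1) + (skew 1 3 y2 + skew 4 2 y2) + (skew 1 4 y3 + skew 2 3 y3)"

lemma plus_form_frame [simp]:
  "plus_form y1 y2 y3 (e $ 1) (e $ 2) = y1" "plus_form y1 y2 y3 (e $ 1) (e $ 3) = y2"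
  "plus_form y1 y2 y3 (e $ 1) (e $ 4) = y3"
  by (simp_all add: plus_form_def skew_apply blinfun.add_left)

lemma plus_form_mem: "plus_form y1 y2 y3 \<in> star_eigenforms h n 1"
  unfolding star_plus_iff
  by (simp add: plus_form_def skew_apply blinfun.add_left alternating_def)

lemma star_plus_eqI:
  fixes \<omega> \<omega>' :: "'b::real_normed_vector form2"
  assumes "\<omega> \<in> star_eigenforms h n 1" "\<omega>' \<in> star_eigenforms h n 1"
    and "\<omega> (e $ 1) (e $ 2) = \<omega>' (e $ 1) (e $ 2)" "\<omega> (e $ 1) (e $ 3) = \<omega>' (e $ 1) (e $ 3)"
      "\<omega> (e $ 1) (e $ 4) = \<omega>' (e $ 1) (e $ 4)"
  shows "\<omega> = \<omega>'"
  using assms(1,2)[unfolded star_plus_iff] assms(3-)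
  by (elim conjE) (rule alternating_eqI; simp)

lemma star_plus_eq_plus_form:
  "\<omega> \<in> star_eigenforms h n 1 \<Longrightarrow> \<omega> = plus_form (\<omega> (e $ 1) (e $ 2)) (\<omega> (e $ 1) (e $ 3)) (\<omega> (e $ 1) (e $ 4))"
  for \<omega> :: "'b::real_normed_vector form2"
  by (rule star_plus_eqI[OF _ plus_form_mem]) simp_all

text \<open>Replaces the definite description by a formula linear in the components of \<omega>,
  which can be differentiated in a parameter.\<close>

lemma plus_part_eq_plus_form:
  fixes \<omega> :: "'b::real_normed_vector form2"
  assumes "alternating \<omega>"
  shows "plus_part h n \<omega> = plus_form ((1/2) *\<^sub>R (\<omega> (e $ 1) (e $ 2) + \<omega> (e $ 3) (e $ 4)))
     ((1/2) *\<^sub>R (\<omega> (e $ 1) (e $ 3) + \<omega> (e $ 4) (e $ 2))) ((1/2) *\<^sub>R (\<omega> (e $ 1) (e $ 4) + \<omega> (e $ 2) (e $ 3)))"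
  by (rule star_plus_eqI[OF plus_part_mem[OF assms] plus_form_mem]) (simp_all add: plus_part_frame[OF assms])

lemma plus_part_combination:
  fixes \<omega> \<omega>' :: "'b::real_normed_vector form2"
  assumes a: "alternating \<omega>" and a': "alternating \<omega>'"
  shows "plus_part h n (\<omega> - c *\<^sub>R \<omega>') = plus_part h n \<omega> - c *\<^sub>R plus_part h n \<omega>'"
proof (rule star_plus_eqI)
  note a'' = alternating_combination(3)[OF a alternating_combination(4)[OF a', of c]]
  show "plus_part h n (\<omega> - c *\<^sub>R \<omega>') \<in> star_eigenforms h n 1" by (rule plus_part_mem[OF a''])
  show "plus_part h n \<omega> - c *\<^sub>R plus_part h n \<omega>' \<in> star_eigenforms h n 1"
    using plus_part_mem[OF a] plus_part_mem[OF a'] unfolding star_plus_iff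
    by (auto simp: alternating_combination blinfun.bilinear_simps)
qed (simp_all add: plus_part_frame a a' alternating_combination blinfun.bilinear_simps algebra_simps)

text \<open>A form is a finite sum of bounded linear images of its values on the frame.
  Differentiability in the operator norm therefore reduces to differentiability of these
  values.\<close>

lemma form1_has_vector_derivativeI:
  fixes \<phi> :: "real \<Rightarrow> 'b::real_normed_vector form1" and \<psi> :: "'b form1"
  assumes "\<And>i. ((\<lambda>t. \<phi> t (e $ i)) has_vector_derivative \<psi> (e $ i)) F"
  shows "(\<phi> has_vector_derivative \<psi>) F"
proof -
  have *: "\<alpha> = (\<Sum>i\<in>UNIV. tensor1 (coframe i) (\<alpha> (e $ i)))" for \<alpha> :: "'b form1"
    by (rule form1_eqI_frame) (simp add: blinfun.sum_left if_distrib if_distribR cong: if_cong)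
  have "((\<lambda>t. \<Sum>i\<in>UNIV. tensor1 (coframe i) (\<phi> t (e $ i))) has_vector_derivative
      (\<Sum>i\<in>UNIV. tensor1 (coframe i) (\<psi> (e $ i)))) F"
    by (intro has_vector_derivative_sum bounded_linear.has_vector_derivative[OF bounded_linear_tensor1] assms)
  then show ?thesis by (simp only: *[symmetric])
qed

lemma form2_has_vector_derivativeI:
  fixes \<phi> :: "real \<Rightarrow> 'b::real_normed_vector form2" and \<psi> :: "'b form2"
  assumes "\<And>X Y. ((\<lambda>t. \<phi> t X Y) has_vector_derivative \<psi> X Y) F"
  shows "(\<phi> has_vector_derivative \<psi>) F"
proof -
  have *: "\<omega> = (\<Sum>i\<in>UNIV. tensor1 (coframe i) (\<omega> (e $ i)))" for \<omega> :: "'b form2"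
    by (rule form2_eqI_frame) (simp add: blinfun.sum_left if_distrib if_distribR cong: if_cong)
  have "((\<lambda>t. \<Sum>i\<in>UNIV. tensor1 (coframe i) (\<phi> t (e $ i))) has_vector_derivative
      (\<Sum>i\<in>UNIV. tensor1 (coframe i) (\<psi> (e $ i)))) F"
    by (intro has_vector_derivative_sum bounded_linear.has_vector_derivative[OF bounded_linear_tensor1]
        form1_has_vector_derivativeI assms)
  then show ?thesis by (simp only: *[symmetric])
qed

lemma plus_part_has_vector_derivative:
  fixes \<phi> :: "real \<Rightarrow> 'b::real_normed_vector form2" and \<psi> :: "'b form2"
  assumes a: "\<And>t. alternating (\<phi> t)" "alternating \<psi>"
    and d: "\<And>X Y. ((\<lambda>t. \<phi> t X Y) has_vector_derivative \<psi> X Y) F"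
  shows "((\<lambda>t. plus_part h n (\<phi> t)) has_vector_derivative plus_part h n \<psi>) F"
  unfolding plus_part_eq_plus_form[OF a(1)] plus_part_eq_plus_form[OF a(2)] plus_form_def skew_def
  by (intro has_vector_derivative_add has_vector_derivative_diff
      bounded_linear.has_vector_derivative[OF bounded_linear_tensor1]
      bounded_linear.has_vector_derivative[OF bounded_linear_scaleR_right] d)

text \<open>The sum in \<open>symbol1\<close> is the contraction of \<open>b\<close> with the metric dual of \<open>\<zeta>\<close>.\<close>

definition symbol1 :: "((real^5) \<Rightarrow>\<^sub>L real) \<Rightarrow> 'b form1 \<Rightarrow> 'b form2 \<Rightarrow> 'b::real_normed_vector form1" where
  "symbol1 \<zeta> \<alpha> b = \<zeta> n *\<^sub>R \<alpha> - tensor1 \<zeta> (\<alpha> n) + (\<Sum>i\<in>UNIV. \<zeta> (e $ i) *\<^sub>R b (e $ i))"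

definition symbol2 :: "((real^5) \<Rightarrow>\<^sub>L real) \<Rightarrow> 'b form1 \<Rightarrow> 'b form2 \<Rightarrow> 'b::real_normed_vector form2" where
  "symbol2 \<zeta> \<alpha> b = plus_part h n (wedge_form \<alpha> \<zeta>) - \<zeta> n *\<^sub>R b"

text \<open>The fifth equation makes the first component of the symbol horizontal: on n the two
  terms in \<alpha> cancel, and b annihilates n.\<close>

lemma symbol1_frame:
  fixes b :: "'b::real_normed_vector form2" and \<zeta> :: "(real^5) \<Rightarrow>\<^sub>L real" and \<alpha> :: "'b form1"
  assumes "b \<in> star_eigenforms h n 1"
  defines "b1 \<equiv> b (e $ 1) (e $ 2)" and "b2 \<equiv> b (e $ 1) (e $ 3)" and "b3 \<equiv> b (e $ 1) (e $ 4)"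
    and "z \<equiv> \<lambda>i. \<zeta> (e $ i)" and "a \<equiv> \<lambda>i. \<alpha> (e $ i)"
  shows "symbol1 \<zeta> \<alpha> b (e $ 1) = z 5 *\<^sub>R a 1 - z 1 *\<^sub>R a 5 - z 2 *\<^sub>R b1 - z 3 *\<^sub>R b2 - z 4 *\<^sub>R b3"
    and "symbol1 \<zeta> \<alpha> b (e $ 2) = z 5 *\<^sub>R a 2 - z 2 *\<^sub>R a 5 + z 1 *\<^sub>R b1 - z 3 *\<^sub>R b3 + z 4 *\<^sub>R b2"
    and "symbol1 \<zeta> \<alpha> b (e $ 3) = z 5 *\<^sub>R a 3 - z 3 *\<^sub>R a 5 + z 1 *\<^sub>R b2 + z 2 *\<^sub>R b3 - z 4 *\<^sub>R b1"
    and "symbol1 \<zeta> \<alpha> b (e $ 4) = z 5 *\<^sub>R a 4 - z 4 *\<^sub>R a 5 + z 1 *\<^sub>R b3 - z 2 *\<^sub>R b2 + z 3 *\<^sub>R b1"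
    and "symbol1 \<zeta> \<alpha> b (e $ 5) = 0"
proof -
  have alt: "alternating b" and v: "b (e $ i) (e $ 5) = 0" "b (e $ 3) (e $ 4) = b1" "b (e $ 4) (e $ 2) = b2" "b (e $ 2) (e $ 3) = b3" for i
    using assms(1) unfolding star_plus_iff b1_def b2_def b3_def by blast+
  have sk: "b X Y = - b Y X" for X Y by (rule alternating_skew[OF alt])
  have d: "b X X = 0" for X using alt by (simp add: alternating_def)
  have u: "b (e $ 2) (e $ 1) = - b1" "b (e $ 3) (e $ 1) = - b2" "b (e $ 4) (e $ 1) = - b3"
    "b (e $ 4) (e $ 3) = - b1" "b (e $ 2) (e $ 4) = - b2" "b (e $ 3) (e $ 2) = - b3" "b (e $ 5) (e $ i) = 0" for i
    using sk[of "e $ 2" "e $ 1"] sk[of "e $ 3" "e $ 1"] sk[of "e $ 4" "e $ 1"] sk[of "e $ 4" "e $ 3"]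
      sk[of "e $ 2" "e $ 4"] sk[of "e $ 3" "e $ 2"] sk[of "e $ 5" "e $ i"] v unfolding b1_def b2_def b3_def by simp_all
  note * = symbol1_def sum_5 z_def a_def blinfun.bilinear_simps e5 tensor1_apply d u[unfolded e5] v[unfolded e5]
    b1_def[symmetric] b2_def[symmetric] b3_def[symmetric]
  show "symbol1 \<zeta> \<alpha> b (e $ 1) = z 5 *\<^sub>R a 1 - z 1 *\<^sub>R a 5 - z 2 *\<^sub>R b1 - z 3 *\<^sub>R b2 - z 4 *\<^sub>R b3"
    unfolding * by simp
  show "symbol1 \<zeta> \<alpha> b (e $ 2) = z 5 *\<^sub>R a 2 - z 2 *\<^sub>R a 5 + z 1 *\<^sub>R b1 - z 3 *\<^sub>R b3 + z 4 *\<^sub>R b2"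
    unfolding * by simp
  show "symbol1 \<zeta> \<alpha> b (e $ 3) = z 5 *\<^sub>R a 3 - z 3 *\<^sub>R a 5 + z 1 *\<^sub>R b2 + z 2 *\<^sub>R b3 - z 4 *\<^sub>R b1"
    unfolding * by simp
  show "symbol1 \<zeta> \<alpha> b (e $ 4) = z 5 *\<^sub>R a 4 - z 4 *\<^sub>R a 5 + z 1 *\<^sub>R b3 - z 2 *\<^sub>R b2 + z 3 *\<^sub>R b1"
    unfolding * by simp
  show "symbol1 \<zeta> \<alpha> b (e $ 5) = 0"
    unfolding * by simp
qed

lemma symbol2_mem:
  assumes "b \<in> star_eigenforms h n 1"
  shows "symbol2 \<zeta> \<alpha> b \<in> star_eigenforms h n 1"
  using assms plus_part_mem[OF alternating_wedge_form[of \<alpha> \<zeta>]] unfolding star_plus_iff symbol2_def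
  by (auto simp: alternating_combination blinfun.bilinear_simps)

lemma symbol2_frame:
  fixes b :: "'b::real_normed_vector form2" and \<zeta> :: "(real^5) \<Rightarrow>\<^sub>L real" and \<alpha> :: "'b form1"
  defines "z \<equiv> \<lambda>i. \<zeta> (e $ i)" and "a \<equiv> \<lambda>i. \<alpha> (e $ i)"
  shows "symbol2 \<zeta> \<alpha> b (e $ 1) (e $ 2) = (1/2) *\<^sub>R (z 1 *\<^sub>R a 2 - z 2 *\<^sub>R a 1 + z 3 *\<^sub>R a 4 - z 4 *\<^sub>R a 3) - z 5 *\<^sub>R b (e $ 1) (e $ 2)"
    and "symbol2 \<zeta> \<alpha> b (e $ 1) (e $ 3) = (1/2) *\<^sub>R (z 1 *\<^sub>R a 3 - z 3 *\<^sub>R a 1 + z 4 *\<^sub>R a 2 - z 2 *\<^sub>R a 4) - z 5 *\<^sub>R b (e $ 1) (e $ 3)"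
    and "symbol2 \<zeta> \<alpha> b (e $ 1) (e $ 4) = (1/2) *\<^sub>R (z 1 *\<^sub>R a 4 - z 4 *\<^sub>R a 1 + z 2 *\<^sub>R a 3 - z 3 *\<^sub>R a 2) - z 5 *\<^sub>R b (e $ 1) (e $ 4)"
  unfolding z_def a_def e5
  by (simp_all add: symbol2_def plus_part_frame alternating_wedge_form blinfun.diff_left blinfun.scaleR_left algebra_simps)

lemma covector_nonzero:
  fixes \<zeta> :: "(real^5) \<Rightarrow>\<^sub>L real"
  assumes "\<zeta> \<noteq> 0"
  shows "\<zeta> (e $ 1) * \<zeta> (e $ 1) + \<zeta> (e $ 2) * \<zeta> (e $ 2) + \<zeta> (e $ 3) * \<zeta> (e $ 3) + \<zeta> (e $ 4) * \<zeta> (e $ 4) + \<zeta> (e $ 5) * \<zeta> (e $ 5) > 0"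
    (is "?S > 0")
proof -
  have s: "x * x \<ge> 0" for x :: real by simp
  have "?S \<noteq> 0"
  proof
    assume "?S = 0"
    then have "\<zeta> (e $ 1) * \<zeta> (e $ 1) = 0" "\<zeta> (e $ 2) * \<zeta> (e $ 2) = 0" "\<zeta> (e $ 3) * \<zeta> (e $ 3) = 0"
      "\<zeta> (e $ 4) * \<zeta> (e $ 4) = 0" "\<zeta> (e $ 5) * \<zeta> (e $ 5) = 0"
      using s[of "\<zeta> (e $ 1)"] s[of "\<zeta> (e $ 2)"] s[of "\<zeta> (e $ 3)"] s[of "\<zeta> (e $ 4)"] s[of "\<zeta> (e $ 5)"] by linarith+
    then have "\<forall>i. \<zeta> (e $ i) = (0 :: (real^5) \<Rightarrow>\<^sub>L real) (e $ i)" unfolding forall_5 by simp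
    then have "\<zeta> = 0" using form1_eqI_frame by blast
    then show False using assms by simp
  qed
  moreover have "?S \<ge> 0" by (intro add_nonneg_nonneg s)
  ultimately show ?thesis by linarith
qed

lemma symbol_kernel:
  fixes b :: "'b::real_inner form2" and \<zeta> :: "(real^5) \<Rightarrow>\<^sub>L real" and \<alpha> :: "'b form1"
  assumes \<zeta>: "\<zeta> \<noteq> 0" and b: "b \<in> star_eigenforms h n 1"
  shows "symbol1 \<zeta> \<alpha> b = 0 \<and> symbol2 \<zeta> \<alpha> b = 0 \<longleftrightarrow> (\<exists>\<xi>. \<alpha> = tensor1 \<zeta> \<xi> \<and> b = 0)"
proof
  assume "\<exists>\<xi>. \<alpha> = tensor1 \<zeta> \<xi> \<and> b = 0"
  then obtain \<xi> where \<alpha>: "\<alpha> = tensor1 \<zeta> \<xi>" and b0: "b = 0" by blast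
  have "symbol1 \<zeta> \<alpha> b = 0"
    by (rule form1_eqI_frame) (simp add: symbol1_def \<alpha> b0 blinfun.bilinear_simps blinfun.sum_left mult.commute)
  moreover have "wedge_form \<alpha> \<zeta> = 0"
    by (rule form2_eqI) (simp add: \<alpha> mult.commute)
  moreover have "plus_part h n (0 :: 'b form2) = 0"
    using plus_part_eq_plus_form[of "0 :: 'b form2"] by (simp add: alternating_def plus_form_def skew_def)
  ultimately show "symbol1 \<zeta> \<alpha> b = 0 \<and> symbol2 \<zeta> \<alpha> b = 0"
    by (simp add: symbol2_def b0)
next
  assume "symbol1 \<zeta> \<alpha> b = 0 \<and> symbol2 \<zeta> \<alpha> b = 0"
  then have s: "symbol1 \<zeta> \<alpha> b = 0" "symbol2 \<zeta> \<alpha> b = 0" by blast+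
  define z a b1 b2 b3 where d: "z = (\<lambda>i. \<zeta> (e $ i))" "a = (\<lambda>i. \<alpha> (e $ i))"
    "b1 = b (e $ 1) (e $ 2)" "b2 = b (e $ 1) (e $ 3)" "b3 = b (e $ 1) (e $ 4)"
  have E: "z 5 *\<^sub>R a 1 - z 1 *\<^sub>R a 5 - z 2 *\<^sub>R b1 - z 3 *\<^sub>R b2 - z 4 *\<^sub>R b3 = 0"
    "z 5 *\<^sub>R a 2 - z 2 *\<^sub>R a 5 + z 1 *\<^sub>R b1 - z 3 *\<^sub>R b3 + z 4 *\<^sub>R b2 = 0"
    "z 5 *\<^sub>R a 3 - z 3 *\<^sub>R a 5 + z 1 *\<^sub>R b2 + z 2 *\<^sub>R b3 - z 4 *\<^sub>R b1 = 0"
    "z 5 *\<^sub>R a 4 - z 4 *\<^sub>R a 5 + z 1 *\<^sub>R b3 - z 2 *\<^sub>R b2 + z 3 *\<^sub>R b1 = 0"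
    using symbol1_frame[OF b, of \<zeta> \<alpha>] unfolding s d by simp_all
  have F: "(1/2) *\<^sub>R (z 1 *\<^sub>R a 2 - z 2 *\<^sub>R a 1 + z 3 *\<^sub>R a 4 - z 4 *\<^sub>R a 3) - z 5 *\<^sub>R b1 = 0"
    "(1/2) *\<^sub>R (z 1 *\<^sub>R a 3 - z 3 *\<^sub>R a 1 + z 4 *\<^sub>R a 2 - z 2 *\<^sub>R a 4) - z 5 *\<^sub>R b2 = 0"
    "(1/2) *\<^sub>R (z 1 *\<^sub>R a 4 - z 4 *\<^sub>R a 1 + z 2 *\<^sub>R a 3 - z 3 *\<^sub>R a 2) - z 5 *\<^sub>R b3 = 0"
    using symbol2_frame[of \<zeta> \<alpha> b] unfolding s d by simp_all
  \<comment> \<open>S is |\<zeta>|^2 and T the contraction of \<zeta> with \<alpha>. If \<alpha> =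
    \<zeta> \<otimes> \<xi> then T = S \<xi>, which dictates the witness T/S below.\<close>
  define S where "S = z 1 * z 1 + z 2 * z 2 + z 3 * z 3 + z 4 * z 4 + z 5 * z 5"
  define T where "T = z 1 *\<^sub>R a 1 + z 2 *\<^sub>R a 2 + z 3 *\<^sub>R a 3 + z 4 *\<^sub>R a 4 + z 5 *\<^sub>R a 5"
  have S: "S > 0" using covector_nonzero[OF \<zeta>] by (simp add: S_def d)
  have nz: "z 1 * z 1 + z 2 * z 2 + z 3 * z 3 + z 4 * z 4 + z 5 * z 5 \<noteq> 0" using S unfolding S_def by simp
  \<comment> \<open>The coordinate lemma speaks of real numbers; pairing with an arbitrary vector w
    reduces the vector-valued equations to it.\<close>
  have Ew: "z 5 * (a 1 \<bullet> w) - z 1 * (a 5 \<bullet> w) - z 2 * (b1 \<bullet> w) - z 3 * (b2 \<bullet> w) - z 4 * (b3 \<bullet> w) = 0"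
    "z 5 * (a 2 \<bullet> w) - z 2 * (a 5 \<bullet> w) + z 1 * (b1 \<bullet> w) - z 3 * (b3 \<bullet> w) + z 4 * (b2 \<bullet> w) = 0"
    "z 5 * (a 3 \<bullet> w) - z 3 * (a 5 \<bullet> w) + z 1 * (b2 \<bullet> w) + z 2 * (b3 \<bullet> w) - z 4 * (b1 \<bullet> w) = 0"
    "z 5 * (a 4 \<bullet> w) - z 4 * (a 5 \<bullet> w) + z 1 * (b3 \<bullet> w) - z 2 * (b2 \<bullet> w) + z 3 * (b1 \<bullet> w) = 0"
    "z 1 * (a 2 \<bullet> w) - z 2 * (a 1 \<bullet> w) + z 3 * (a 4 \<bullet> w) - z 4 * (a 3 \<bullet> w) = 2 * z 5 * (b1 \<bullet> w)"
    "z 1 * (a 3 \<bullet> w) - z 3 * (a 1 \<bullet> w) + z 4 * (a 2 \<bullet> w) - z 2 * (a 4 \<bullet> w) = 2 * z 5 * (b2 \<bullet> w)"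
    "z 1 * (a 4 \<bullet> w) - z 4 * (a 1 \<bullet> w) + z 2 * (a 3 \<bullet> w) - z 3 * (a 2 \<bullet> w) = 2 * z 5 * (b3 \<bullet> w)" for w
    using E[THEN arg_cong, of "\<lambda>x. x \<bullet> w"] F[THEN arg_cong, of "\<lambda>x. x \<bullet> w"]
    by (simp_all add: inner_simps)
  note K = symbol_kernel_coordinates[OF Ew nz]
  \<comment> \<open>Each component is paired with itself, so the vanishing real number is its
    squared norm.\<close>
  have "b1 = 0" "b2 = 0" "b3 = 0"
    using K(1)[of b1] K(1)[of b2] K(1)[of b3] by simp_all
  then have "b = 0"
    using star_plus_eq_plus_form[OF b] by (simp add: d plus_form_def skew_def)
  have Tw: "T \<bullet> w = z 1 * (a 1 \<bullet> w) + z 2 * (a 2 \<bullet> w) + z 3 * (a 3 \<bullet> w) + z 4 * (a 4 \<bullet> w) + z 5 * (a 5 \<bullet> w)" for w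
    by (simp add: T_def inner_simps)
  have "\<forall>i. S *\<^sub>R a i = z i *\<^sub>R T"
    unfolding forall_5
    by (intro conjI; subst vector_eq_rdot[symmetric]) (use K(2) in \<open>simp_all add: S_def[symmetric] Tw[symmetric]\<close>)
  then have aT: "S *\<^sub>R a i = z i *\<^sub>R T" for i by blast
  have "\<alpha> = tensor1 \<zeta> ((1 / S) *\<^sub>R T)"
  proof (rule form1_eqI_frame)
    fix i
    have "\<alpha> (e $ i) = (1 / S) *\<^sub>R (S *\<^sub>R a i)" using S by (simp add: d)
    then show "\<alpha> (e $ i) = tensor1 \<zeta> ((1 / S) *\<^sub>R T) (e $ i)"
      unfolding aT by (simp add: d)
  qed
  then show "\<exists>\<xi>. \<alpha> = tensor1 \<zeta> \<xi> \<and> b = 0" using \<open>b = 0\<close> by blast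
qed

lemma symbol_onto:
  fixes \<rho> :: "'b::real_inner form1" and \<zeta> :: "(real^5) \<Rightarrow>\<^sub>L real"
  assumes \<zeta>: "\<zeta> \<noteq> 0" and \<rho>: "\<rho> n = 0" and \<tau>: "\<tau> \<in> star_eigenforms h n 1"
  shows "\<exists>\<alpha>. \<exists>b\<in>star_eigenforms h n 1. symbol1 \<zeta> \<alpha> b = \<rho> \<and> symbol2 \<zeta> \<alpha> b = \<tau>"
proof -
  define z r t1 t2 t3 where d: "z = (\<lambda>i. \<zeta> (e $ i))" "r = (\<lambda>i. \<rho> (e $ i))"
    "t1 = \<tau> (e $ 1) (e $ 2)" "t2 = \<tau> (e $ 1) (e $ 3)" "t3 = \<tau> (e $ 1) (e $ 4)"
  define S M where SM: "S = z 1 * z 1 + z 2 * z 2 + z 3 * z 3 + z 4 * z 4 + z 5 * z 5"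
    "M = z 1 * z 1 + z 2 * z 2 + z 3 * z 3 + z 4 * z 4 + 2 * z 5 * z 5"
  define x y where xy: "x = 1 / M" "y = 1 / S"
  have "S > 0" using covector_nonzero[OF \<zeta>] by (simp add: SM d)
  moreover have "M \<ge> S" by (simp add: SM)
  ultimately have xy1: "S * y = 1" "M * x = 1" by (simp_all add: xy)
  \<comment> \<open>Without the terms in c, the pair (\<alpha>, b) is 2x T(\<rho>, \<tau>), with T
    the horizontal block of the symbol; it solves the equations up to the error -x c \<zeta>_h in
    the first component. The terms in c remove this error, since -x + y - x y z5^2 = 0 by 1/x = 1/y
    + z5^2, and they make \<alpha> orthogonal to \<zeta>, hence to the kernel.\<close>
  define c where c: "c = z 1 *\<^sub>R r 1 + z 2 *\<^sub>R r 2 + z 3 *\<^sub>R r 3 + z 4 *\<^sub>R r 4"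
  define a where "a i = (if i = 1 then (2*x) *\<^sub>R (z 5 *\<^sub>R r 1 - z 2 *\<^sub>R t1 - z 3 *\<^sub>R t2 - z 4 *\<^sub>R t3) - (x*y*z 5*z 1) *\<^sub>R c
    else if i = 2 then (2*x) *\<^sub>R (z 5 *\<^sub>R r 2 + z 1 *\<^sub>R t1 - z 3 *\<^sub>R t3 + z 4 *\<^sub>R t2) - (x*y*z 5*z 2) *\<^sub>R c
    else if i = 3 then (2*x) *\<^sub>R (z 5 *\<^sub>R r 3 + z 1 *\<^sub>R t2 + z 2 *\<^sub>R t3 - z 4 *\<^sub>R t1) - (x*y*z 5*z 3) *\<^sub>R c
    else if i = 4 then (2*x) *\<^sub>R (z 5 *\<^sub>R r 4 + z 1 *\<^sub>R t3 - z 2 *\<^sub>R t2 + z 3 *\<^sub>R t1) - (x*y*z 5*z 4) *\<^sub>R c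
    else - (y *\<^sub>R c))" for i :: 5
  define b1 where b1: "b1 = x *\<^sub>R (z 1 *\<^sub>R r 2 - z 2 *\<^sub>R r 1 + z 3 *\<^sub>R r 4 - z 4 *\<^sub>R r 3 - (2 * z 5) *\<^sub>R t1)"
  define b2 where b2: "b2 = x *\<^sub>R (z 1 *\<^sub>R r 3 - z 3 *\<^sub>R r 1 + z 4 *\<^sub>R r 2 - z 2 *\<^sub>R r 4 - (2 * z 5) *\<^sub>R t2)"
  define b3 where b3: "b3 = x *\<^sub>R (z 1 *\<^sub>R r 4 - z 4 *\<^sub>R r 1 + z 2 *\<^sub>R r 3 - z 3 *\<^sub>R r 2 - (2 * z 5) *\<^sub>R t3)"
  define \<alpha> where "\<alpha> = (\<Sum>i\<in>UNIV. tensor1 (coframe i) (a i))"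
  have \<alpha>: "\<alpha> (e $ i) = a i" for i
    by (simp add: \<alpha>_def blinfun.sum_left if_distrib if_distribR cong: if_cong)
  let ?b = "plus_form b1 b2 b3"
  note b = plus_form_mem[of b1 b2 b3]
  have *: "z 5 * (a 1 \<bullet> w) - z 1 * (a 5 \<bullet> w) - z 2 * (b1 \<bullet> w) - z 3 * (b2 \<bullet> w) - z 4 * (b3 \<bullet> w) = r 1 \<bullet> w"
    "z 5 * (a 2 \<bullet> w) - z 2 * (a 5 \<bullet> w) + z 1 * (b1 \<bullet> w) - z 3 * (b3 \<bullet> w) + z 4 * (b2 \<bullet> w) = r 2 \<bullet> w"
    "z 5 * (a 3 \<bullet> w) - z 3 * (a 5 \<bullet> w) + z 1 * (b2 \<bullet> w) + z 2 * (b3 \<bullet> w) - z 4 * (b1 \<bullet> w) = r 3 \<bullet> w"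
    "z 5 * (a 4 \<bullet> w) - z 4 * (a 5 \<bullet> w) + z 1 * (b3 \<bullet> w) - z 2 * (b2 \<bullet> w) + z 3 * (b1 \<bullet> w) = r 4 \<bullet> w"
    "z 1 * (a 2 \<bullet> w) - z 2 * (a 1 \<bullet> w) + z 3 * (a 4 \<bullet> w) - z 4 * (a 3 \<bullet> w) - 2 * z 5 * (b1 \<bullet> w) = 2 * (t1 \<bullet> w)"
    "z 1 * (a 3 \<bullet> w) - z 3 * (a 1 \<bullet> w) + z 4 * (a 2 \<bullet> w) - z 2 * (a 4 \<bullet> w) - 2 * z 5 * (b2 \<bullet> w) = 2 * (t2 \<bullet> w)"
    "z 1 * (a 4 \<bullet> w) - z 4 * (a 1 \<bullet> w) + z 2 * (a 3 \<bullet> w) - z 3 * (a 2 \<bullet> w) - 2 * z 5 * (b3 \<bullet> w) = 2 * (t3 \<bullet> w)" for w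
    by (rule symbol_onto_coordinates[OF xy1[unfolded SM], of "c \<bullet> w" "r 1 \<bullet> w" "r 2 \<bullet> w" "r 3 \<bullet> w" "r 4 \<bullet> w" _ "t1 \<bullet> w" "t2 \<bullet> w" "t3 \<bullet> w"];
        simp add: a_def b1 b2 b3 c inner_simps)+
  have "symbol1 \<zeta> \<alpha> ?b = \<rho>"
  proof (rule form1_eqI_frame)
    have "\<forall>i. symbol1 \<zeta> \<alpha> ?b (e $ i) = \<rho> (e $ i)"
      unfolding forall_5
    proof (intro conjI)
      have g: "X = \<rho> (e $ i)" if "\<And>w. X \<bullet> w = r i \<bullet> w" for i X
        using that vector_eq_rdot[of X "r i"] by (simp add: d(2))
      note s = symbol1_frame(1-4)[OF b, of \<zeta> \<alpha>, unfolded plus_form_frame \<alpha> d(1)[symmetric, THEN fun_cong]]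
      show "symbol1 \<zeta> \<alpha> ?b (e $ 1) = \<rho> (e $ 1)" by (rule g) (simp add: s inner_simps *)
      show "symbol1 \<zeta> \<alpha> ?b (e $ 2) = \<rho> (e $ 2)" by (rule g) (simp add: s inner_simps *)
      show "symbol1 \<zeta> \<alpha> ?b (e $ 3) = \<rho> (e $ 3)" by (rule g) (simp add: s inner_simps *)
      show "symbol1 \<zeta> \<alpha> ?b (e $ 4) = \<rho> (e $ 4)" by (rule g) (simp add: s inner_simps *)
      show "symbol1 \<zeta> \<alpha> ?b (e $ 5) = \<rho> (e $ 5)" unfolding symbol1_frame(5)[OF b] using \<rho> e5 by simp
    qed
    then show "symbol1 \<zeta> \<alpha> ?b (e $ i) = \<rho> (e $ i)" for i by blast
  qed
  moreover have "symbol2 \<zeta> \<alpha> ?b = \<tau>"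
  proof (rule star_plus_eqI[OF symbol2_mem[OF b] \<tau>])
    have g: "X = t" if "\<And>w. 2 * (X \<bullet> w) = 2 * (t \<bullet> w)" for X t :: 'b
      using that vector_eq_rdot[of X t] by simp
    show "symbol2 \<zeta> \<alpha> ?b (e $ 1) (e $ 2) = \<tau> (e $ 1) (e $ 2)"
      unfolding symbol2_frame plus_form_frame \<alpha> d(3)[symmetric]
      by (rule g, subst *(5)[symmetric]) (simp add: inner_simps d(1) algebra_simps)
    show "symbol2 \<zeta> \<alpha> ?b (e $ 1) (e $ 3) = \<tau> (e $ 1) (e $ 3)"
      unfolding symbol2_frame plus_form_frame \<alpha> d(4)[symmetric]
      by (rule g, subst *(6)[symmetric]) (simp add: inner_simps d(1) algebra_simps)
    show "symbol2 \<zeta> \<alpha> ?b (e $ 1) (e $ 4) = \<tau> (e $ 1) (e $ 4)"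
      unfolding symbol2_frame plus_form_frame \<alpha> d(5)[symmetric]
      by (rule g, subst *(7)[symmetric]) (simp add: inner_simps d(1) algebra_simps)
  qed
  ultimately show ?thesis using b by blast
qed

end

section \<open>Lie groups and principal bundles\<close>

text \<open>The derivative in the product of the preferred charts of the factors. The chart
  preferred by \<open>prod_atlas\<close> at the same point may be a different one, so
  \<open>tangent_map\<close> would not split into components.\<close>

definition product_deriv ::
  "('m, 'e::real_normed_vector) chart set \<Rightarrow> ('n, 'f::real_normed_vector) chart set \<Rightarrow>
   ('k, 'h::real_normed_vector) chart set \<Rightarrow> ('m \<times> 'n \<Rightarrow> 'k) \<Rightarrow> 'm \<Rightarrow> 'n \<Rightarrow> 'e \<times> 'f \<Rightarrow> 'h" where
  "product_deriv M N K f x a = frechet_derivative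
     ((\<lambda>y. snd (chart_at K (f (x, a))) (f y)) \<circ>
        inv_into (fst (chart_at M x) \<times> fst (chart_at N a)) (map_prod (snd (chart_at M x)) (snd (chart_at N a))))
     (at (snd (chart_at M x) x, snd (chart_at N a) a))"

lemma has_mderiv_Pair:
  "has_mderiv M f x D \<Longrightarrow> has_mderiv M h x E \<Longrightarrow> has_mderiv M (\<lambda>x. (f x, h x)) x (\<lambda>u. (D u, E u))"
  by (auto simp: has_mderiv_def o_def intro: has_derivative_Pair)

lemma has_mderiv_compose_derivative:
  assumes "topological_atlas M" "has_mderiv M f x D" "(h has_derivative E) (at (f x))"
  shows "has_mderiv M (\<lambda>y. h (f y)) x (\<lambda>u. E (D u))"
proof -
  have "(h has_derivative E) (at ((f \<circ> cinv (chart_at M x)) (snd (chart_at M x) x)))"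
    using assms(3) cinv_chart[OF assms(1) chart_at[OF assms(1)]] by simp
  from has_derivative_compose[OF assms(2)[unfolded has_mderiv_def] this]
  show ?thesis by (simp add: has_mderiv_def o_def)
qed

text \<open>The chain rule for a map of two manifold-valued variables. With one of the two tangent
  components equal to zero it yields the partial derivatives compared in
  \<open>dproj_kernel\<close>.\<close>

lemma tangent_map_product:
  fixes M :: "('m::topological_space, 'e::real_normed_vector) chart set"
    and N :: "('n::topological_space, 'f::real_normed_vector) chart set"
    and K :: "('k::topological_space, 'h::real_normed_vector) chart set"
    and Q :: "('q::topological_space, 'i::real_normed_vector) chart set"
  assumes M: "topological_atlas M" and N: "topological_atlas N" and K: "topological_atlas K" and Q: "topological_atlas Q"
    and f: "smooth_map_on (prod_atlas M N) K T f" and T: "open T" "(\<alpha> p, \<beta> p) \<in> T"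
    and \<alpha>: "smooth_map_on Q M S \<alpha>" and \<beta>: "smooth_map_on Q N S \<beta>" and S: "open S" "p \<in> S"
  shows "tangent_map Q K (\<lambda>q. f (\<alpha> q, \<beta> q)) p u =
    product_deriv M N K f (\<alpha> p) (\<beta> p) (tangent_map Q M \<alpha> p u, tangent_map Q N \<beta> p u)"
proof -
  note P = topological_atlas_prod[OF M N]
  let ?c = "chart_at M (\<alpha> p)" and ?d = "chart_at N (\<beta> p)" and ?e = "chart_at K (f (\<alpha> p, \<beta> p))"
  note c = chart_at[OF M, of "\<alpha> p"] and d = chart_at[OF N, of "\<beta> p"] and e = chart_at[OF K, of "f (\<alpha> p, \<beta> p)"]
  let ?k = "(fst ?c \<times> fst ?d, map_prod (snd ?c) (snd ?d))"
  have k: "?k \<in> prod_atlas M N" "(\<alpha> p, \<beta> p) \<in> fst ?k"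
    using c d unfolding prod_atlas_def by (blast, simp)
  have cf: "continuous_on T f" using f unfolding smooth_map_on_def by blast
  have o: "open (T \<inter> f -` fst ?e)" by (rule continuous_open_preimage[OF cf T(1) chart_open[OF K e(1)]])
  have F: "((\<lambda>y. snd ?e (f y)) \<circ> cinv ?k has_derivative product_deriv M N K f (\<alpha> p) (\<beta> p)) (at (snd ?k (\<alpha> p, \<beta> p)))"
    using smooth_fun_on_chart_derivative[OF P smooth_map_on_chart[OF f e(1)] o _ k] T(2) e(2)
    by (simp add: product_deriv_def)
  let ?ab = "\<lambda>q. (snd ?c (\<alpha> q), snd ?d (\<beta> q))"
  have ab: "has_mderiv Q ?ab p (\<lambda>u. (tangent_map Q M \<alpha> p u, tangent_map Q N \<beta> p u))"
    by (rule has_mderiv_Pair[OF tangent_map_has_mderiv[OF Q M \<alpha> S] tangent_map_has_mderiv[OF Q N \<beta> S]])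
  have F': "(((\<lambda>y. snd ?e (f y)) \<circ> cinv ?k) has_derivative product_deriv M N K f (\<alpha> p) (\<beta> p)) (at (?ab p))"
    using F by simp
  note 1 = has_mderiv_compose_derivative[OF Q ab F']
  let ?U = "(S \<inter> \<alpha> -` fst ?c) \<inter> (S \<inter> \<beta> -` fst ?d)"
  have c\<alpha>: "continuous_on S \<alpha>" and c\<beta>: "continuous_on S \<beta>" using \<alpha> \<beta> unfolding smooth_map_on_def by blast+
  have U: "open ?U"
    by (intro open_Int continuous_open_preimage[OF c\<alpha> S(1)] continuous_open_preimage[OF c\<beta> S(1)]
        chart_open[OF M c(1)] chart_open[OF N d(1)])
  have "has_mderiv Q (\<lambda>q. snd ?e (f (\<alpha> q, \<beta> q))) p
     (\<lambda>u. product_deriv M N K f (\<alpha> p) (\<beta> p) (tangent_map Q M \<alpha> p u, tangent_map Q N \<beta> p u))"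
  proof (rule has_mderiv_cong[OF Q 1 U])
    show "p \<in> ?U" using S(2) c(2) d(2) by simp
    show "((\<lambda>y. snd ?e (f y)) \<circ> cinv ?k) (?ab q) = snd ?e (f (\<alpha> q, \<beta> q))" if "q \<in> ?U" for q
      using that prod_atlas_cinv[OF M N c(1) d(1), of "snd ?c (\<alpha> q)" "snd ?d (\<beta> q)"]
      by (simp add: cinv_chart[OF M c(1)] cinv_chart[OF N d(1)])
  qed
  from has_mderiv_deriv_fun[OF this] show ?thesis
    by (simp add: tangent_map_def o_def)
qed

section \<open>Lie groups and the adjoint representation\<close>

context
  fixes G :: "('g::{t2_space,second_countable_topology}) monoid"
    and L :: "('g, 'l::finite_dim_inner) chart set"
  assumes lie: "lie_group G L"
begin

lemma lie_atlas: "smooth_atlas L"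
  using lie by (simp add: lie_group_def)

lemmas lie_top = smooth_atlas_topological[OF lie_atlas]

lemma lie_group_laws:
  "(a \<otimes>\<^bsub>G\<^esub> b) \<otimes>\<^bsub>G\<^esub> c = a \<otimes>\<^bsub>G\<^esub> (b \<otimes>\<^bsub>G\<^esub> c)" "\<one>\<^bsub>G\<^esub> \<otimes>\<^bsub>G\<^esub> a = a" "a \<otimes>\<^bsub>G\<^esub> \<one>\<^bsub>G\<^esub> = a"
  "inv\<^bsub>G\<^esub> a \<otimes>\<^bsub>G\<^esub> a = \<one>\<^bsub>G\<^esub>" "a \<otimes>\<^bsub>G\<^esub> inv\<^bsub>G\<^esub> a = \<one>\<^bsub>G\<^esub>" "inv\<^bsub>G\<^esub> (a \<otimes>\<^bsub>G\<^esub> b) = inv\<^bsub>G\<^esub> b \<otimes>\<^bsub>G\<^esub> inv\<^bsub>G\<^esub> a"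
  "inv\<^bsub>G\<^esub> \<one>\<^bsub>G\<^esub> = \<one>\<^bsub>G\<^esub>" "inv\<^bsub>G\<^esub> (inv\<^bsub>G\<^esub> a) = a"
proof -
  interpret group G using lie by (simp add: lie_group_def)
  have *: "x \<in> carrier G" for x using lie by (simp add: lie_group_def)
  show "(a \<otimes>\<^bsub>G\<^esub> b) \<otimes>\<^bsub>G\<^esub> c = a \<otimes>\<^bsub>G\<^esub> (b \<otimes>\<^bsub>G\<^esub> c)" by (rule m_assoc[OF * * *])
  show "\<one>\<^bsub>G\<^esub> \<otimes>\<^bsub>G\<^esub> a = a" "a \<otimes>\<^bsub>G\<^esub> \<one>\<^bsub>G\<^esub> = a" "inv\<^bsub>G\<^esub> a \<otimes>\<^bsub>G\<^esub> a = \<one>\<^bsub>G\<^esub>" "a \<otimes>\<^bsub>G\<^esub> inv\<^bsub>G\<^esub> a = \<one>\<^bsub>G\<^esub>"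
    "inv\<^bsub>G\<^esub> (a \<otimes>\<^bsub>G\<^esub> b) = inv\<^bsub>G\<^esub> b \<otimes>\<^bsub>G\<^esub> inv\<^bsub>G\<^esub> a" "inv\<^bsub>G\<^esub> \<one>\<^bsub>G\<^esub> = \<one>\<^bsub>G\<^esub>" "inv\<^bsub>G\<^esub> (inv\<^bsub>G\<^esub> a) = a"
    using * by (simp_all add: inv_mult_group)
qed

lemma lie_smooth_mult:
  assumes M: "topological_atlas M" and f: "smooth_map_on M L S f" and h: "smooth_map_on M L S h" and S: "open S"
  shows "smooth_map_on M L S (\<lambda>x. f x \<otimes>\<^bsub>G\<^esub> h x)"
proof -
  have m: "smooth_map_on (prod_atlas L L) L UNIV (\<lambda>(a, b). a \<otimes>\<^bsub>G\<^esub> b)"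
    using lie by (simp add: lie_group_def)
  show ?thesis
    using smooth_map_on_compose[OF M topological_atlas_prod[OF lie_top lie_top] lie_top
        smooth_map_on_Pair[OF M lie_top lie_top f h S] m S open_UNIV] by simp
qed

lemma lie_smooth_inv:
  assumes M: "topological_atlas M" and f: "smooth_map_on M L S f" and S: "open S"
  shows "smooth_map_on M L S (\<lambda>x. inv\<^bsub>G\<^esub> f x)"
proof -
  have i: "smooth_map_on L L UNIV (\<lambda>a. inv\<^bsub>G\<^esub> a)"
    using lie by (simp add: lie_group_def)
  show ?thesis using smooth_map_on_compose[OF M lie_top lie_top f i S open_UNIV] by simp
qed

lemma lie_smooth_conj: "smooth_map_on L L UNIV (\<lambda>b. a \<otimes>\<^bsub>G\<^esub> b \<otimes>\<^bsub>G\<^esub> inv\<^bsub>G\<^esub> a)"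
  by (intro lie_smooth_mult lie_top smooth_map_on_const smooth_map_on_id lie_atlas open_UNIV)

lemma Ad_linear: "linear (Ad G L a)"
  unfolding Ad_def by (rule linear_tangent_map[OF lie_top lie_top lie_smooth_conj open_UNIV UNIV_I])

lemma Ad_mult: "Ad G L (a \<otimes>\<^bsub>G\<^esub> b) Y = Ad G L a (Ad G L b Y)"
  using tangent_map_compose[OF lie_top lie_top lie_top lie_smooth_conj[of b] open_UNIV UNIV_I
      lie_smooth_conj[of a] open_UNIV UNIV_I, of "\<one>\<^bsub>G\<^esub>" Y]
  unfolding Ad_def by (simp add: lie_group_laws)

lemma Ad_one: "Ad G L \<one>\<^bsub>G\<^esub> Y = Y"
  unfolding Ad_def by (simp add: lie_group_laws tangent_map_id[OF lie_atlas])

text \<open>As a function of a, Ad(a) Y is the partial derivative in b, at the identity, of the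
  smooth map (a, b) \<mapsto> a b a^(-1), and partial derivatives of smooth functions are smooth.
  Conjugation fixes the identity, so the same chart \<open>?d\<close> serves in source and
  target.\<close>

lemma Ad_smooth: "smooth_fun_on L UNIV (\<lambda>a. Ad G L a Y)"
  unfolding smooth_fun_on_def
proof
  fix c assume c: "c \<in> L"
  note P = topological_atlas_prod[OF lie_top lie_top]
  let ?d = "chart_at L \<one>\<^bsub>G\<^esub>"
  note d = chart_at[OF lie_top, of "\<one>\<^bsub>G\<^esub>"]
  let ?conj = "\<lambda>p. fst p \<otimes>\<^bsub>G\<^esub> snd p \<otimes>\<^bsub>G\<^esub> inv\<^bsub>G\<^esub> (fst p)"
  have conj: "smooth_map_on (prod_atlas L L) L UNIV ?conj"
    by (intro lie_smooth_mult lie_smooth_inv P smooth_map_on_fst smooth_map_on_snd lie_atlas open_UNIV)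
  let ?k = "(fst c \<times> fst ?d, map_prod (snd c) (snd ?d))"
  have k: "?k \<in> prod_atlas L L" using c d(1) unfolding prod_atlas_def by blast
  let ?F = "snd ?d \<circ> ?conj \<circ> cinv ?k" let ?V = "snd ?k ` (fst ?k \<inter> (UNIV \<inter> ?conj -` fst ?d))"
  have V: "open ?V"
    using conj unfolding smooth_map_on_def
    by (intro chart_image_open[OF P k] continuous_open_preimage chart_open[OF lie_top d(1)]) auto
  have "smooth_on (snd ?k ` (fst ?k \<inter> UNIV \<inter> ?conj -` fst ?d)) ?F"
    using conj k d(1) unfolding smooth_map_on_def by blast
  then have F: "smooth_on ?V ?F" by (simp only: Int_assoc)
  let ?z = "snd ?d \<one>\<^bsub>G\<^esub>" let ?S = "snd c ` (fst c \<inter> UNIV)"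
  have S: "open ?S" by (rule chart_image_open[OF lie_top c open_UNIV])
  have inV: "(y, ?z) \<in> ?V" if "y \<in> ?S" for y
  proof -
    obtain a where a: "a \<in> fst c" "y = snd c a" using \<open>y \<in> ?S\<close> by blast
    have "(a, \<one>\<^bsub>G\<^esub>) \<in> fst ?k \<inter> (UNIV \<inter> ?conj -` fst ?d)"
      using a d(2) by (simp add: lie_group_laws)
    then have "snd ?k (a, \<one>\<^bsub>G\<^esub>) \<in> ?V" by (rule imageI)
    then show ?thesis using a by simp
  qed
  have "smooth_on ?S (\<lambda>y. frechet_derivative ?F (at (y, ?z)) (0, Y))"
    by (rule smooth_on_compose[OF smooth_on_Pair[OF S smooth_on_id[OF S] smooth_on_const[OF S]] smooth_on_derivative[OF F] _ S V])
      (use inV in blast)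
  moreover have "frechet_derivative ?F (at (y, ?z)) (0, Y) = ((\<lambda>a. Ad G L a Y) \<circ> cinv c) y" if y: "y \<in> ?S" for y
  proof -
    obtain a where a: "a \<in> fst c" "y = snd c a" using y by blast
    have ay: "cinv c y = a" using a cinv_chart[OF lie_top c] by simp
    have "((\<lambda>z. (y, z)) has_derivative (\<lambda>u. (0, u))) (at ?z)"
      by (auto intro!: derivative_eq_intros)
    from has_derivative_compose[OF this smooth_on_has_derivative[OF F V inV[OF y]]]
    have "((\<lambda>z. ?F (y, z)) has_derivative (\<lambda>u. frechet_derivative ?F (at (y, ?z)) (0, u))) (at ?z)" .
    then have "((snd ?d \<circ> (\<lambda>b. a \<otimes>\<^bsub>G\<^esub> b \<otimes>\<^bsub>G\<^esub> inv\<^bsub>G\<^esub> a)) \<circ> cinv ?d has_derivative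
        (\<lambda>u. frechet_derivative ?F (at (y, ?z)) (0, u))) (at ?z)"
    proof (rule has_derivative_transform_within_open)
      show "open (snd ?d ` (fst ?d \<inter> UNIV))" by (rule chart_image_open[OF lie_top d(1) open_UNIV])
      show "?z \<in> snd ?d ` (fst ?d \<inter> UNIV)" using d(2) by blast
      show "?F (y, z) = ((snd ?d \<circ> (\<lambda>b. a \<otimes>\<^bsub>G\<^esub> b \<otimes>\<^bsub>G\<^esub> inv\<^bsub>G\<^esub> a)) \<circ> cinv ?d) z"
        if "z \<in> snd ?d ` (fst ?d \<inter> UNIV)" for z
        using prod_atlas_cinv[OF lie_top lie_top c d(1), of y z] that y ay by simp
    qed
    from fun_cong[OF frechet_derivative_at[OF this], of Y] show ?thesis
      unfolding comp_apply ay Ad_def tangent_map_def deriv_fun_def by (simp add: lie_group_laws o_def)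
  qed
  ultimately show "smooth_on ?S ((\<lambda>a. Ad G L a Y) \<circ> cinv c)"
    using smooth_on_cong[OF _ S] by blast
qed

lemma lie_bracket_bilinear: "bilinear (lie_bracket G L)"
proof -
  have d: "has_mderiv L (\<lambda>a. Ad G L a Y) \<one>\<^bsub>G\<^esub> (\<lambda>X. lie_bracket G L X Y)" for Y
    unfolding lie_bracket_def by (rule smooth_fun_on_has_mderiv[OF lie_top Ad_smooth open_UNIV UNIV_I])
  have "lie_bracket G L X (Y + Z) = lie_bracket G L X Y + lie_bracket G L X Z" for X Y Z
    using has_mderiv_deriv_fun[OF has_mderiv_add[OF d[of Y] d[of Z]]] unfolding lie_bracket_def
    by (simp add: linear_add[OF Ad_linear])
  moreover have "lie_bracket G L X (r *\<^sub>R Y) = r *\<^sub>R lie_bracket G L X Y" for X Y r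
    using has_mderiv_deriv_fun[OF has_mderiv_bounded_linear[OF bounded_linear_scaleR_right d[of Y], of r]] unfolding lie_bracket_def
    by (simp add: linear_scale[OF Ad_linear])
  ultimately show ?thesis
    unfolding bilinear_def using has_mderiv_linear[OF d] by (auto intro: linearI)
qed

end

section \<open>Vertical vectors and horizontal lifts on the bundle\<close>

context gauge_five_manifold
begin

lemma base_atlas: "smooth_atlas W"
  using oriented_base by (simp add: oriented_atlas_def)

lemma bundle_atlas: "smooth_atlas P"
  using principal by (simp add: principal_bundle_def)

lemmas base_top = smooth_atlas_topological[OF base_atlas]
lemmas bundle_top = smooth_atlas_topological[OF bundle_atlas]
lemmas group_atlas = lie_atlas[OF structure_group]
lemmas group_top = lie_top[OF structure_group]
lemmas group_laws = lie_group_laws[OF structure_group]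

lemma proj_smooth: "smooth_map_on P W UNIV \<pi>"
  using principal by (simp add: principal_bundle_def)

lemma proj_continuous: "continuous_on UNIV \<pi>"
  using proj_smooth by (simp add: smooth_map_on_def)

lemma proj_preimage_open: "open U \<Longrightarrow> open (\<pi> -` U)"
  using proj_continuous by (simp add: continuous_on_open_vimage)

lemma act_one: "act p \<one>\<^bsub>G\<^esub> = p" and act_act: "act (act p a) b = act p (a \<otimes>\<^bsub>G\<^esub> b)"
  and proj_act: "\<pi> (act p a) = \<pi> p"
  using principal by (simp_all add: principal_bundle_def)

lemma act_smooth: "smooth_map_on L P UNIV (act p)"
proof -
  have "smooth_map_on (prod_atlas P L) P UNIV (\<lambda>(p, a). act p a)"
    using principal by (simp add: principal_bundle_def)
  from smooth_map_on_compose[OF group_top topological_atlas_prod[OF bundle_top group_top] bundle_top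
      smooth_map_on_Pair[OF group_top bundle_top group_top smooth_map_on_const[OF group_top open_UNIV] smooth_map_on_id[OF group_atlas] open_UNIV]
      this open_UNIV open_UNIV, of p]
  show ?thesis by simp
qed

lemma trivialization:
  obtains U \<phi> \<psi> where "open U" "x \<in> U" "smooth_map_on P L (\<pi> -` U) \<phi>" "smooth_map_on (prod_atlas W L) P (U \<times> UNIV) \<psi>"
    "\<And>q. \<pi> q \<in> U \<Longrightarrow> \<psi> (\<pi> q, \<phi> q) = q" "\<And>q a. \<pi> q \<in> U \<Longrightarrow> \<phi> (act q a) = \<phi> q \<otimes>\<^bsub>G\<^esub> a"
    "\<And>y a. y \<in> U \<Longrightarrow> \<pi> (\<psi> (y, a)) = y" "\<And>y a. y \<in> U \<Longrightarrow> \<phi> (\<psi> (y, a)) = a"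
proof -
  have "\<exists>U \<phi> \<psi>. open U \<and> x \<in> U \<and>
        smooth_map_on P L (\<pi> -` U) \<phi> \<and> smooth_map_on (prod_atlas W L) P (U \<times> UNIV) \<psi> \<and>
        (\<forall>q\<in>\<pi> -` U. \<psi> (\<pi> q, \<phi> q) = q \<and> (\<forall>a. \<phi> (act q a) = \<phi> q \<otimes>\<^bsub>G\<^esub> a)) \<and>
        (\<forall>y\<in>U. \<forall>a. \<pi> (\<psi> (y, a)) = y \<and> \<phi> (\<psi> (y, a)) = a)"
    using principal unfolding principal_bundle_def by blast
  then show ?thesis using that by auto
qed

abbreviation dproj :: "'p \<Rightarrow> 'k \<Rightarrow> real^5" where
  "dproj \<equiv> tangent_map P W \<pi>"

lemma linear_dproj: "linear (dproj p)"
  by (rule linear_tangent_map[OF bundle_top base_top proj_smooth open_UNIV UNIV_I])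

lemma linear_fundamental: "linear (\<lambda>X. fundamental_field X p)"
  unfolding fundamental_field_def
  using linear_tangent_map[OF group_top bundle_top act_smooth open_UNIV UNIV_I] by simp

lemma dproj_fundamental: "dproj p (fundamental_field X p) = 0"
  using tangent_map_compose[OF group_top bundle_top base_top act_smooth[of p] open_UNIV UNIV_I proj_smooth open_UNIV UNIV_I, of "\<one>\<^bsub>G\<^esub>" X]
  by (simp add: proj_act act_one tangent_map_const fundamental_field_def)

text \<open>The local section y \<mapsto> \<psi>(y, \<phi> p) passes through p; its derivative is a
  right inverse of \<open>dproj p\<close>.\<close>

lemma dproj_surj: "\<exists>u. dproj p u = X"
proof -
  obtain U \<phi> \<psi> where t: "open U" "\<pi> p \<in> U" "smooth_map_on P L (\<pi> -` U) \<phi>" "smooth_map_on (prod_atlas W L) P (U \<times> UNIV) \<psi>"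
    "\<And>q. \<pi> q \<in> U \<Longrightarrow> \<psi> (\<pi> q, \<phi> q) = q" "\<And>q a. \<pi> q \<in> U \<Longrightarrow> \<phi> (act q a) = \<phi> q \<otimes>\<^bsub>G\<^esub> a"
    "\<And>y a. y \<in> U \<Longrightarrow> \<pi> (\<psi> (y, a)) = y" "\<And>y a. y \<in> U \<Longrightarrow> \<phi> (\<psi> (y, a)) = a"
    by (rule trivialization[of "\<pi> p"]) (rule that; assumption)
  let ?s = "\<lambda>y. \<psi> (y, \<phi> p)"
  have "smooth_map_on W (prod_atlas W L) U (\<lambda>y. (y, \<phi> p))"
    by (intro smooth_map_on_Pair base_top group_top smooth_map_on_id base_atlas smooth_map_on_const t(1))
  then have s: "smooth_map_on W P U ?s"
    by (rule smooth_map_on_compose[OF base_top topological_atlas_prod[OF base_top group_top] bundle_top _ t(4) t(1)])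
      (auto intro: open_Times t(1))
  have "tangent_map W W (\<lambda>y. \<pi> (?s y)) (\<pi> p) X = X"
    using tangent_map_cong[OF base_top base_top smooth_map_on_id[OF base_atlas] t(1,2), of "\<lambda>y. \<pi> (?s y)"]
    by (simp add: t(7) tangent_map_id[OF base_atlas])
  moreover have "tangent_map W W (\<lambda>y. \<pi> (?s y)) (\<pi> p) X = dproj p (tangent_map W P ?s (\<pi> p) X)"
    using tangent_map_compose[OF base_top bundle_top base_top s t(1,2) proj_smooth open_UNIV UNIV_I, of X]
    by (simp add: t(2,5))
  ultimately show ?thesis by (intro exI) (rule trans[OF sym])
qed

text \<open>The identity of P is locally q \<mapsto> \<psi>(\<pi> q, \<phi> q). If d\<pi> kills u,
  only the group component of u remains; left translation by the inverse of \<phi> p carries it to a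
  Lie algebra element X, and its fundamental vector is u because p b = \<psi>(\<pi> p, \<phi> p
  b).\<close>

lemma dproj_kernel:
  assumes "dproj p u = 0"
  shows "\<exists>X. u = fundamental_field X p"
proof -
  obtain U \<phi> \<psi> where t: "open U" "\<pi> p \<in> U" "smooth_map_on P L (\<pi> -` U) \<phi>" "smooth_map_on (prod_atlas W L) P (U \<times> UNIV) \<psi>"
    "\<And>q. \<pi> q \<in> U \<Longrightarrow> \<psi> (\<pi> q, \<phi> q) = q" "\<And>q a. \<pi> q \<in> U \<Longrightarrow> \<phi> (act q a) = \<phi> q \<otimes>\<^bsub>G\<^esub> a"
    "\<And>y a. y \<in> U \<Longrightarrow> \<pi> (\<psi> (y, a)) = y" "\<And>y a. y \<in> U \<Longrightarrow> \<phi> (\<psi> (y, a)) = a"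
    by (rule trivialization[of "\<pi> p"]) (rule that; assumption)
  let ?x = "\<pi> p" and ?a = "\<phi> p"
  have oU: "open (\<pi> -` U)" "p \<in> \<pi> -` U" using proj_preimage_open[OF t(1)] t(2) by auto
  have oT: "open (U \<times> (UNIV :: 'g set))" by (simp add: open_Times t(1))
  let ?D = "product_deriv W L P \<psi> ?x ?a"
  have "u = tangent_map P P (\<lambda>q. \<psi> (\<pi> q, \<phi> q)) p u"
    using tangent_map_cong[OF bundle_top bundle_top smooth_map_on_id[OF bundle_atlas] oU, of "\<lambda>q. \<psi> (\<pi> q, \<phi> q)"]
    by (simp add: t(5) tangent_map_id[OF bundle_atlas])
  also have "\<dots> = ?D (dproj p u, tangent_map P L \<phi> p u)"
    using t(2) by (intro tangent_map_product[OF base_top group_top bundle_top bundle_top t(4) oT _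
          smooth_map_on_subset[OF proj_smooth subset_UNIV] t(3) oU]) simp
  also have "\<dots> = ?D (0, tangent_map P L \<phi> p u)" using assms by simp
  finally have 1: "u = ?D (0, tangent_map P L \<phi> p u)" .
  have 2: "tangent_map L P (\<lambda>a. \<psi> (?x, a)) ?a w = ?D (0, w)" for w
    using tangent_map_product[OF base_top group_top bundle_top group_top t(4) oT _ smooth_map_on_const[OF group_top open_UNIV]
        smooth_map_on_id[OF group_atlas] open_UNIV UNIV_I, of ?x ?a w] t(2)
    by (simp add: tangent_map_const tangent_map_id[OF group_atlas])
  have sx: "smooth_map_on L P UNIV (\<lambda>a. \<psi> (?x, a))"
    by (rule smooth_map_on_compose[OF group_top topological_atlas_prod[OF base_top group_top] bundle_top
          smooth_map_on_Pair[OF group_top base_top group_top smooth_map_on_const[OF group_top open_UNIV] smooth_map_on_id[OF group_atlas] open_UNIV]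
          t(4) open_UNIV oT]) (use t(2) in auto)
  have lm: "smooth_map_on L L UNIV (\<lambda>b. g \<otimes>\<^bsub>G\<^esub> b)" for g
    by (intro lie_smooth_mult[OF structure_group] group_top smooth_map_on_const smooth_map_on_id group_atlas open_UNIV)
  have act: "act p b = \<psi> (?x, ?a \<otimes>\<^bsub>G\<^esub> b)" for b
    using t(5)[of "act p b"] t(2,6) by (simp add: proj_act)
  define X where "X = tangent_map L L (\<lambda>b. inv\<^bsub>G\<^esub> ?a \<otimes>\<^bsub>G\<^esub> b) ?a (tangent_map P L \<phi> p u)"
  have "tangent_map L L (\<lambda>b. ?a \<otimes>\<^bsub>G\<^esub> b) \<one>\<^bsub>G\<^esub> X = tangent_map P L \<phi> p u"
    using tangent_map_compose[OF group_top group_top group_top lm[of "inv\<^bsub>G\<^esub> ?a"] open_UNIV UNIV_I lm[of ?a] open_UNIV UNIV_I, of ?a "tangent_map P L \<phi> p u"]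
    by (simp add: X_def group_laws group_laws(1)[symmetric] tangent_map_id[OF group_atlas])
  then have "fundamental_field X p = ?D (0, tangent_map P L \<phi> p u)"
    using tangent_map_compose[OF group_top group_top bundle_top lm[of ?a] open_UNIV UNIV_I sx open_UNIV UNIV_I, of "\<one>\<^bsub>G\<^esub>" X]
    unfolding fundamental_field_def act 2[symmetric] by (simp add: group_laws)
  then show ?thesis using 1 by (intro exI[of _ X]) simp
qed

lemma translate_apply: "translate A \<alpha> p u = A p u + \<alpha> p (dproj p u)"
  by (simp add: translate_def blinfun.bilinear_simps Blinfun_apply linear_dproj)

text \<open>The assumption concerns vertical vectors at the single point p. Translates of a
  connection inherit it, so the results apply along the whole curve of translates.\<close>

context
  fixes A :: "'p \<Rightarrow> 'k \<Rightarrow>\<^sub>L 'l" and p :: 'p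
  assumes A: "\<And>X. A p (fundamental_field X p) = X"
begin

lemma horizontal_unique: "dproj p u = dproj p w \<Longrightarrow> A p u = A p w \<Longrightarrow> u = w"
proof -
  assume a: "dproj p u = dproj p w" "A p u = A p w"
  then have "dproj p (u - w) = 0" by (simp add: linear_diff[OF linear_dproj])
  then obtain X where X: "u - w = fundamental_field X p" using dproj_kernel by blast
  have "X = A p (u - w)" unfolding X A ..
  then have "X = 0" using a(2) by (simp add: blinfun.diff_right)
  then show "u = w" using X linear_0[OF linear_fundamental] by simp
qed

lemma horizontal_lift_eqI: "dproj p u = X \<Longrightarrow> A p u = 0 \<Longrightarrow> horizontal_lift A p X = u"
  unfolding horizontal_lift_def by (rule the_equality) (auto intro: horizontal_unique)

lemma horizontal_lift: "dproj p (horizontal_lift A p X) = X" "A p (horizontal_lift A p X) = 0"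
proof -
  obtain u where u: "dproj p u = X" using dproj_surj by blast
  \<comment> \<open>Any preimage of X, corrected by its vertical part.\<close>
  let ?w = "u - fundamental_field (A p u) p"
  have w: "dproj p ?w = X" "A p ?w = 0"
    by (simp_all add: linear_diff[OF linear_dproj] dproj_fundamental u blinfun.diff_right A)
  show "dproj p (horizontal_lift A p X) = X" "A p (horizontal_lift A p X) = 0"
    unfolding horizontal_lift_eqI[OF w] by (rule w)+
qed

lemma linear_horizontal_lift: "linear (horizontal_lift A p)"
  by (intro linearI horizontal_lift_eqI)
    (simp_all add: linear_add[OF linear_dproj] linear_scale[OF linear_dproj] horizontal_lift blinfun.bilinear_simps)

lemma translate_fundamental: "translate A \<alpha> p (fundamental_field X p) = X"
  by (simp add: translate_apply A dproj_fundamental)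

end

text \<open>The lift for A + \<pi>^*\<alpha> must cancel the new contribution \<alpha>(X), and a
  fundamental vector does so without changing the projection. The lift is thus affine in
  \<alpha>.\<close>

lemma horizontal_lift_translate:
  fixes A :: "'p \<Rightarrow> 'k \<Rightarrow>\<^sub>L 'l" and \<alpha> :: "'p \<Rightarrow> 'l form1"
  assumes A: "\<And>X. A p (fundamental_field X p) = X"
  shows "horizontal_lift (translate A \<alpha>) p X = horizontal_lift A p X - fundamental_field (\<alpha> p X) p"
proof (rule horizontal_lift_eqI[where A = "translate A \<alpha>"])
  note l = horizontal_lift[where A = A and p = p, OF A]
  show "translate A \<alpha> p (fundamental_field X p) = X" for X
    by (rule translate_fundamental[where A = A and p = p, OF A])
  show "dproj p (horizontal_lift A p X - fundamental_field (\<alpha> p X) p) = X"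
    by (simp add: linear_diff[OF linear_dproj] dproj_fundamental l)
  show "translate A \<alpha> p (horizontal_lift A p X - fundamental_field (\<alpha> p X) p) = 0"
    by (simp add: translate_apply linear_diff[OF linear_dproj] dproj_fundamental l blinfun.diff_right A)
qed

end

section \<open>Sections with prescribed value at a point\<close>

lemma smooth_fun_on_continuous:
  "topological_atlas M \<Longrightarrow> open S \<Longrightarrow> smooth_fun_on M S f \<Longrightarrow> continuous_on S f"
  using smooth_map_on_vec[of M S f] unfolding smooth_map_on_def by blast

lemma continuous_on_det:
  fixes A :: "'a::topological_space \<Rightarrow> real^'n^'n"
  assumes "\<And>i j. continuous_on S (\<lambda>y. A y $ i $ j)"
  shows "continuous_on S (\<lambda>y. det (A y))"
  unfolding det_def by (intro continuous_intros assms)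

context gauge_five_manifold
begin

lemma metric_inner_product: "inner_product (g x)"
  using metric_base by (simp add: riemannian_metric_def inner_product_def)

subsection \<open>Smooth adapted frames\<close>

text \<open>The components are taken in one fixed chart c, because the preferred charts, in which X
  is given, may vary discontinuously.\<close>

definition smooth_field_on :: "('w, real^5) chart \<Rightarrow> 'w set \<Rightarrow> ('w \<Rightarrow> real^5) \<Rightarrow> bool" where
  "smooth_field_on c V X \<longleftrightarrow> smooth_fun_on W V (\<lambda>y. deriv_fun W (snd c) y (X y))"

context
  fixes c :: "('w, real^5) chart" and V :: "'w set"
  assumes c: "c \<in> W" and V: "open V" "V \<subseteq> fst c"
begin

lemma chart_deriv_linear: "y \<in> V \<Longrightarrow> linear (deriv_fun W (snd c) y)"
  using has_mderiv_linear[OF smooth_fun_on_has_mderiv[OF base_top smooth_fun_on_chart[OF base_atlas c] chart_open[OF base_top c]]] V(2)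
  by blast

text \<open>\<open>riemannian_metric\<close> asserts smoothness on coordinate fields only, so both
  fields are expanded in the coordinate fields of c.\<close>

lemma smooth_field_on_inner:
  assumes X: "smooth_field_on c V X" and Y: "smooth_field_on c V Y"
  shows "smooth_fun_on W V (\<lambda>y. g y (X y) (Y y))"
proof -
  let ?\<xi> = "\<lambda>X y. deriv_fun W (snd c) y (X y)"
  have comp: "smooth_fun_on W V (\<lambda>y. ?\<xi> X y $ i)" if "smooth_field_on c V X" for X i
    using smooth_fun_on_smooth[OF base_top V(1) that[unfolded smooth_field_on_def]
        smooth_on_linear[OF bounded_linear_vec_nth open_UNIV] open_UNIV] by simp
  have gs: "smooth_fun_on W V (\<lambda>y. g y (coord_field W c (axis i 1) y) (coord_field W c (axis j 1) y))" for i j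
    using metric_base c V(2) unfolding riemannian_metric_def by (blast intro: smooth_fun_on_subset)
  have "smooth_fun_on W V (\<lambda>y. \<Sum>i\<in>UNIV. \<Sum>j\<in>UNIV. (?\<xi> X y $ i * ?\<xi> Y y $ j) *
      g y (coord_field W c (axis i 1) y) (coord_field W c (axis j 1) y))"
    by (intro smooth_fun_on_sum[OF base_top V(1)] smooth_fun_on_bounded_bilinear[OF base_top V(1) bounded_bilinear_mult] comp X Y gs)
  then show ?thesis
  proof (rule smooth_fun_on_cong[OF base_top V(1)])
    fix y assume y: "y \<in> V"
    have yc: "y \<in> fst c" using y V(2) by blast
    note l = linear_coord_field[OF base_atlas c yc]
    have e: "Z = (\<Sum>i\<in>UNIV. (deriv_fun W (snd c) y Z $ i) *\<^sub>R coord_field W c (axis i 1) y)" for Z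
    proof -
      have "Z = coord_field W c (\<Sum>i\<in>UNIV. deriv_fun W (snd c) y Z $ i *\<^sub>R axis i 1) y"
        unfolding vec_axis_expansion[symmetric] by (rule coord_field_deriv_fun[OF base_atlas c yc, symmetric])
      then show ?thesis by (simp add: linear_sum[OF l] linear_scale[OF l])
    qed
    note ip = ip_simps[OF metric_inner_product]
    have "g y (X y) (Y y) = g y (\<Sum>i\<in>UNIV. ?\<xi> X y $ i *\<^sub>R coord_field W c (axis i 1) y)
        (\<Sum>j\<in>UNIV. ?\<xi> Y y $ j *\<^sub>R coord_field W c (axis j 1) y)"
      using e by simp
    also have "\<dots> = (\<Sum>j\<in>UNIV. \<Sum>i\<in>UNIV. (?\<xi> X y $ i * ?\<xi> Y y $ j) * g y (coord_field W c (axis i 1) y) (coord_field W c (axis j 1) y))"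
      by (simp add: ip sum_distrib_left mult_ac)
    also have "\<dots> = (\<Sum>i\<in>UNIV. \<Sum>j\<in>UNIV. (?\<xi> X y $ i * ?\<xi> Y y $ j) * g y (coord_field W c (axis i 1) y) (coord_field W c (axis j 1) y))"
      by (rule sum.swap)
    finally show "(\<Sum>i\<in>UNIV. \<Sum>j\<in>UNIV. (?\<xi> X y $ i * ?\<xi> Y y $ j) * g y (coord_field W c (axis i 1) y) (coord_field W c (axis j 1) y)) = g y (X y) (Y y)"
      by simp
  qed
qed

lemma smooth_field_on_scale:
  assumes f: "smooth_fun_on W V f" and X: "smooth_field_on c V X"
  shows "smooth_field_on c V (\<lambda>y. f y *\<^sub>R X y)"
  unfolding smooth_field_on_def
  by (rule smooth_fun_on_cong[OF base_top V(1)
        smooth_fun_on_bounded_bilinear[OF base_top V(1) bounded_bilinear_scaleR f X[unfolded smooth_field_on_def]]])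
    (simp add: linear_scale[OF chart_deriv_linear])

lemma smooth_field_on_diff:
  assumes X: "smooth_field_on c V X" and Y: "smooth_field_on c V Y"
  shows "smooth_field_on c V (\<lambda>y. X y - Y y)"
  unfolding smooth_field_on_def
  by (rule smooth_fun_on_cong[OF base_top V(1)
        smooth_fun_on_diff[OF base_top V(1) X[unfolded smooth_field_on_def] Y[unfolded smooth_field_on_def]]])
    (simp add: linear_diff[OF chart_deriv_linear])

lemma smooth_field_on_sum:
  assumes X: "\<And>j. j \<in> J \<Longrightarrow> smooth_field_on c V (X j)"
  shows "smooth_field_on c V (\<lambda>y. \<Sum>j\<in>J. X j y)"
  unfolding smooth_field_on_def
  by (rule smooth_fun_on_cong[OF base_top V(1)
        smooth_fun_on_sum[OF base_top V(1) X[unfolded smooth_field_on_def]]])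
    (simp_all add: linear_sum[OF chart_deriv_linear])

lemma smooth_field_on_coord:
  assumes d: "d \<in> W" "V \<subseteq> fst d"
  shows "smooth_field_on c V (coord_field W d u)"
  unfolding smooth_field_on_def
proof (rule smooth_fun_on_cong[OF base_top V(1)])
  show "smooth_fun_on W V (\<lambda>y. frechet_derivative (snd c \<circ> cinv d) (at (snd d y)) u)"
    by (rule smooth_fun_on_subset[OF smooth_fun_on_transition_derivative[OF base_atlas d(1) c]]) (use V d in blast)
  fix y assume y: "y \<in> V"
  then have yc: "y \<in> fst c" "y \<in> fst d" using V(2) d(2) by blast+
  show "frechet_derivative (snd c \<circ> cinv d) (at (snd d y)) u = deriv_fun W (snd c) y (coord_field W d u y)"
    using coord_field_change[OF base_atlas d(1) yc(2) c yc(1), of u]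
      deriv_fun_coord_field[OF base_atlas c yc(1), of "frechet_derivative (snd c \<circ> cinv d) (at (snd d y)) u"] by simp
qed

end

lemma smooth_field_on_subset: "smooth_field_on c V X \<Longrightarrow> U \<subseteq> V \<Longrightarrow> smooth_field_on c U X"
  unfolding smooth_field_on_def by (rule smooth_fun_on_subset)

text \<open>Gram-Schmidt over a neighbourhood, applied to v and the coordinate fields with value
  \<open>e0 $ i\<close> at x. As e0 is already orthonormal, nothing changes at x: N is 1 there and
  remains positive on a smaller open set. The value e0 at x is kept so that a fibre element expanded
  in e0 can be extended.\<close>

lemma local_orthonormal_fields:
  fixes e0 :: "real^5^5"
  assumes e0: "orthonormal_on (g x) UNIV e0" "e0 $ 5 = v x" and J: "finite J"
  shows "\<exists>V E. open V \<and> x \<in> V \<and> V \<subseteq> fst (chart_at W x) \<and> (\<forall>j\<in>insert 5 J. smooth_field_on (chart_at W x) V (\<lambda>y. E y $ j) \<and> E x $ j = e0 $ j) \<and>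
     (\<forall>y\<in>V. orthonormal_on (g y) (insert 5 J) (E y) \<and> E y $ 5 = v y)"
  using J
proof (induction J rule: finite_induct)
  let ?c = "chart_at W x"
  note c = chart_at[OF base_top, of x]
  note oc = chart_open[OF base_top c(1)]
  {
    case empty
    have "smooth_field_on ?c (fst ?c) v"
      unfolding smooth_field_on_def using smooth_field c(1) unfolding smooth_vector_field_def by blast
    then show ?case
      using oc c(2) e0(2) unit_length
      by (intro exI[of _ "fst ?c"] exI[of _ "\<lambda>y. \<chi> j. v y"]) (simp add: orthonormal_on_def)
  next
    case (insert i J)
    then obtain V E where V: "open V" "x \<in> V" "V \<subseteq> fst ?c"
      and E: "\<And>j. j \<in> insert 5 J \<Longrightarrow> smooth_field_on ?c V (\<lambda>y. E y $ j)" "\<And>j. j \<in> insert 5 J \<Longrightarrow> E x $ j = e0 $ j"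
      and on: "\<And>y. y \<in> V \<Longrightarrow> orthonormal_on (g y) (insert 5 J) (E y)" "\<And>y. y \<in> V \<Longrightarrow> E y $ 5 = v y"
      by blast
    show ?case
    proof (cases "i \<in> insert 5 J")
      case True
      then have "insert 5 (insert i J) = insert 5 J" by auto
      then show ?thesis using V E on by (intro exI[of _ V] exI[of _ E]) simp
    next
      case False
      define w where "w = coord_field W ?c (e0 $ i)"
      define u where "u y = w y - (\<Sum>j\<in>insert 5 J. g y (E y $ j) (w y) *\<^sub>R E y $ j)" for y
      define N where "N y = g y (u y) (u y)" for y
      note cV = c(1) V(1,3)
      have sw: "smooth_field_on ?c V w" unfolding w_def by (rule smooth_field_on_coord[OF cV c(1) V(3)])
      have su: "smooth_field_on ?c V u"
        unfolding u_def
        by (intro smooth_field_on_diff[OF cV] smooth_field_on_sum[OF cV] smooth_field_on_scale[OF cV]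
            smooth_field_on_inner[OF cV] sw E(1))
      have sN: "smooth_fun_on W V N" unfolding N_def by (rule smooth_field_on_inner[OF cV su su])
      have wx: "w x = e0 $ i" unfolding w_def by (rule coord_field_chart_at[OF base_atlas])
      have "g x (E x $ j) (w x) *\<^sub>R E x $ j = 0" if "j \<in> insert 5 J" for j
      proof -
        have "j \<noteq> i" using that False by blast
        then have "g x (e0 $ j) (e0 $ i) = 0" using e0(1) by (simp add: orthonormal_on_def)
        then show ?thesis unfolding wx E(2)[OF that] by simp
      qed
      then have ux: "u x = e0 $ i" unfolding u_def wx by (simp only: sum.neutral_const sum.cong diff_zero)
      then have Nx: "N x = 1" using e0(1) by (simp add: N_def orthonormal_on_def)
      define V' where "V' = V \<inter> N -` {0<..}"
      have cN: "continuous_on V N" by (rule smooth_fun_on_continuous[OF base_top V(1) sN])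
      have V': "open V'" unfolding V'_def by (rule continuous_open_preimage[OF cN V(1)]) simp
      have V'V: "V' \<subseteq> V" "V' \<subseteq> fst ?c" using V(3) by (auto simp: V'_def)
      have "smooth_fun_on W V' (\<lambda>y. 1 / sqrt (N y))"
      proof -
        have "smooth_on {0<..} (\<lambda>t. inverse (sqrt t))"
          by (rule smooth_on_compose[OF smooth_on_sqrt smooth_on_inverse]) (auto simp: open_Collect_neq)
        from smooth_fun_on_smooth[OF base_top V' smooth_fun_on_subset[OF sN V'V(1)] this]
        show ?thesis by (auto simp: V'_def inverse_eq_divide)
      qed
      from smooth_field_on_scale[OF c(1) V' V'V(2) this smooth_field_on_subset[OF su V'V(1)]]
      have sEi: "smooth_field_on ?c V' (\<lambda>y. (1 / sqrt (N y)) *\<^sub>R u y)" .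
      define E' where "E' y = (\<chi> j. if j = i then (1 / sqrt (g y (u y) (u y))) *\<^sub>R u y else E y $ j)" for y
      have "orthonormal_on (g y) (insert 5 (insert i J)) (E' y)" if y: "y \<in> V'" for y
      proof -
        have "g y (u y) (u y) > 0" "y \<in> V" using y by (auto simp: V'_def N_def)
        from gram_schmidt_step[OF metric_inner_product on(1)[OF this(2)] False u_def this(1)]
        show ?thesis unfolding E'_def by (simp only: insert_commute)
      qed
      moreover have "E' y $ 5 = v y" if "y \<in> V'" for y
        using False on(2) that V'V(1) by (auto simp: E'_def)
      moreover have "smooth_field_on ?c V' (\<lambda>y. E' y $ j) \<and> E' x $ j = e0 $ j" if j: "j \<in> insert 5 (insert i J)" for j
      proof (cases "j = i")
        case True
        then show ?thesis using sEi Nx ux unfolding E'_def N_def by simp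
      next
        case False
        then have "j \<in> insert 5 J" using j by blast
        then show ?thesis using False smooth_field_on_subset[OF E(1) V'V(1)] E(2) unfolding E'_def by simp
      qed
      moreover have "x \<in> V'" using V(2) Nx by (simp add: V'_def)
      ultimately show ?thesis using V' V'V(2) by (intro exI[of _ V'] exI[of _ E']) blast
    qed
  }
qed

lemma local_adapted_frame:
  fixes e0 :: "real^5^5"
  assumes e0: "oriented_frame (g x) e0" "e0 $ 5 = v x"
  shows "\<exists>V E. open V \<and> x \<in> V \<and> V \<subseteq> fst (chart_at W x) \<and> (\<forall>j. smooth_field_on (chart_at W x) V (\<lambda>y. E y $ j)) \<and>
    (\<forall>y\<in>V. adapted_frame (g y) (v y) (E y)) \<and> E x = e0"
proof -
  let ?c = "chart_at W x"
  note c = chart_at[OF base_top, of x]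
  obtain V E where V: "open V" "x \<in> V" "V \<subseteq> fst ?c"
    and E: "\<And>j. smooth_field_on ?c V (\<lambda>y. E y $ j)" "\<And>j. E x $ j = e0 $ j"
    and on: "\<And>y. y \<in> V \<Longrightarrow> orthonormal_on (g y) UNIV (E y)" "\<And>y. y \<in> V \<Longrightarrow> E y $ 5 = v y"
    using local_orthonormal_fields[OF e0(1)[unfolded oriented_frame_orthonormal, THEN conjunct1] e0(2) finite, of UNIV, unfolded insert_UNIV]
    by blast
  \<comment> \<open>The rows of \<open>E y\<close> are components in the chart preferred at y, so
    det (E y) need not be continuous. These are the components in a fixed chart, whose determinant
    is.\<close>
  let ?\<xi> = "\<lambda>y. \<chi> i. deriv_fun W (snd ?c) y (E y $ i)"
  have cont: "continuous_on V (\<lambda>y. det (?\<xi> y))"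
  proof (rule continuous_on_det)
    fix i j
    have "continuous_on V (\<lambda>y. deriv_fun W (snd ?c) y (E y $ i))"
      by (rule smooth_fun_on_continuous[OF base_top V(1) E(1)[unfolded smooth_field_on_def]])
    then show "continuous_on V (\<lambda>y. ?\<xi> y $ i $ j)" by (simp add: continuous_on_component)
  qed
  define V' where "V' = V \<inter> (\<lambda>y. det (?\<xi> y)) -` {0<..}"
  have V': "open V'" unfolding V'_def by (rule continuous_open_preimage[OF cont V(1)]) simp
  have Ex: "E x = e0" using E(2) by (simp add: vec_eq_iff)
  have "deriv_fun W (snd ?c) x X = X" for X
    using deriv_fun_coord_field[OF base_atlas c, of X] by (simp add: coord_field_chart_at[OF base_atlas])
  then have "?\<xi> x = e0" by (simp add: Ex vec_eq_iff)
  then have "x \<in> V'" using V(2) e0(1) by (simp add: V'_def oriented_frame_def)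
  moreover have "adapted_frame (g y) (v y) (E y)" if y: "y \<in> V'" for y
  proof
    have yV: "y \<in> V" "det (?\<xi> y) > 0" using y by (auto simp: V'_def)
    have yc: "y \<in> fst ?c" using yV(1) V(3) by blast
    show "inner_product (g y)" by (rule metric_inner_product)
    show "E y $ 5 = v y" by (rule on(2)[OF yV(1)])
    let ?D = "frechet_derivative (snd (chart_at W y) \<circ> cinv ?c) (at (snd ?c y))"
    note d = chart_at[OF base_top, of y]
    have lD: "linear ?D"
      using linear_coord_field[OF base_atlas c(1) yc] unfolding coord_field_def .
    have detD: "det (matrix ?D) > 0"
      using oriented_base c(1) d yc unfolding oriented_atlas_def by blast
    \<comment> \<open>Passing to the chart preferred at y multiplies the determinant by that of the
      transition map, which is positive because the atlas is oriented.\<close>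
    have row: "E y $ i = matrix ?D *v (?\<xi> y $ i)" for i
      using coord_field_deriv_fun[OF base_atlas c(1) yc, of "E y $ i"] fun_cong[OF matrix_vector_mul(2)[OF lD]] by (simp add: coord_field_def)
    have "E y = ?\<xi> y ** transpose (matrix ?D)"
      unfolding vec_eq_iff
    proof (intro allI)
      fix i j
      have "E y $ i $ j = (matrix ?D *v (?\<xi> y $ i)) $ j" by (simp only: row[symmetric])
      then show "E y $ i $ j = (?\<xi> y ** transpose (matrix ?D)) $ i $ j"
        by (simp add: matrix_vector_mult_def matrix_matrix_mult_def transpose_def mult.commute)
    qed
    then have "det (E y) = det (?\<xi> y ** transpose (matrix ?D))" by (rule arg_cong)
    then have "det (E y) = det (?\<xi> y) * det (matrix ?D)" by (simp only: det_mul det_transpose)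
    then show "oriented_frame (g y) (E y)"
      using on(1)[OF yV(1)] yV(2) detD by (simp add: oriented_frame_orthonormal)
  qed
  moreover have "smooth_field_on ?c V' (\<lambda>y. E y $ j)" for j
    by (rule smooth_field_on_subset[OF E(1)]) (auto simp: V'_def)
  moreover have "V' \<subseteq> fst ?c" using V(3) by (auto simp: V'_def)
  ultimately show ?thesis using V' Ex by blast
qed

subsection \<open>Equivariant extension of an element of the fibre\<close>

text \<open>In a trivialization \<phi> the factor Ad(\<phi>(q)^(-1) \<phi>(p)) carries a Lie algebra
  element from p to q. It is the identity at q = p, and \<phi>(q a) = \<phi>(q) a turns into the
  required equivariance.\<close>

lemma exists_twist:
  obtains U \<tau> where "open U" "\<pi> p \<in> U" "\<And>y. smooth_fun_on P (\<pi> -` U) (\<lambda>q. \<tau> q y)"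
    "\<And>q a y. \<pi> q \<in> U \<Longrightarrow> \<tau> (act q a) y = Ad G L (inv\<^bsub>G\<^esub> a) (\<tau> q y)" "\<And>q. linear (\<tau> q)" "\<And>y. \<tau> p y = y"
proof -
  obtain U \<phi> \<psi> where t: "open U" "\<pi> p \<in> U" "smooth_map_on P L (\<pi> -` U) \<phi>" "smooth_map_on (prod_atlas W L) P (U \<times> UNIV) \<psi>"
    "\<And>q. \<pi> q \<in> U \<Longrightarrow> \<psi> (\<pi> q, \<phi> q) = q" "\<And>q a. \<pi> q \<in> U \<Longrightarrow> \<phi> (act q a) = \<phi> q \<otimes>\<^bsub>G\<^esub> a"
    "\<And>y a. y \<in> U \<Longrightarrow> \<pi> (\<psi> (y, a)) = y" "\<And>y a. y \<in> U \<Longrightarrow> \<phi> (\<psi> (y, a)) = a"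
    by (rule trivialization[of "\<pi> p"]) (rule that; assumption)
  note oU = proj_preimage_open[OF t(1)]
  let ?\<tau> = "\<lambda>q y. Ad G L (inv\<^bsub>G\<^esub> (\<phi> q) \<otimes>\<^bsub>G\<^esub> \<phi> p) y"
  have "smooth_map_on P L (\<pi> -` U) (\<lambda>q. inv\<^bsub>G\<^esub> (\<phi> q) \<otimes>\<^bsub>G\<^esub> \<phi> p)"
    by (intro lie_smooth_mult[OF structure_group] lie_smooth_inv[OF structure_group] bundle_top t(3) smooth_map_on_const oU)
  then have 1: "smooth_fun_on P (\<pi> -` U) (\<lambda>q. ?\<tau> q y)" for y
    using smooth_fun_on_compose[OF bundle_top group_top _ Ad_smooth[OF structure_group] oU open_UNIV] by simp
  have 2: "?\<tau> (act q a) y = Ad G L (inv\<^bsub>G\<^esub> a) (?\<tau> q y)" if "\<pi> q \<in> U" for q a y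
    by (simp add: t(6)[OF that] group_laws Ad_mult[OF structure_group])
  show ?thesis
    by (rule that[OF t(1,2) 1 2 Ad_linear[OF structure_group]]) (simp_all add: group_laws Ad_one[OF structure_group])
qed

text \<open>The twist is controlled over U alone. Where f vanishes identically, off the closed set
  Z, the product is zero, and the preimages of U and of the complement of Z cover.\<close>

lemma twisted_smooth:
  assumes U: "open U" and Z: "closed Z" "Z \<subseteq> U" and S: "open S"
    and \<tau>: "smooth_fun_on P (\<pi> -` U) (\<lambda>q. \<tau> q y)"
    and f: "smooth_fun_on W (S \<inter> U) f" and zero: "\<And>y. y \<in> S \<Longrightarrow> y \<notin> Z \<Longrightarrow> f y = (0::real)"
  shows "smooth_fun_on P (\<pi> -` S) (\<lambda>q. f (\<pi> q) *\<^sub>R \<tau> q y)"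
proof (rule smooth_fun_on_local[OF bundle_top])
  fix q assume q: "q \<in> \<pi> -` S"
  show "\<exists>V. open V \<and> q \<in> V \<and> smooth_fun_on P V (\<lambda>q. f (\<pi> q) *\<^sub>R \<tau> q y)"
  proof (cases "\<pi> q \<in> Z")
    case True
    let ?V = "\<pi> -` (S \<inter> U)"
    have V: "open ?V" by (intro proj_preimage_open open_Int S U)
    have "smooth_fun_on P ?V (\<lambda>q. f (\<pi> q))"
      by (rule smooth_fun_on_compose[OF bundle_top base_top smooth_map_on_subset[OF proj_smooth subset_UNIV] f V open_Int[OF S U]]) auto
    moreover have "smooth_fun_on P ?V (\<lambda>q. \<tau> q y)"
      by (rule smooth_fun_on_subset[OF \<tau>]) auto
    ultimately have "smooth_fun_on P ?V (\<lambda>q. f (\<pi> q) *\<^sub>R \<tau> q y)"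
      by (rule smooth_fun_on_bounded_bilinear[OF bundle_top V bounded_bilinear_scaleR])
    then show ?thesis using V q True Z(2) by blast
  next
    case False
    let ?V = "\<pi> -` (S \<inter> - Z)"
    have V: "open ?V" using Z(1) by (intro proj_preimage_open open_Int S) (simp add: open_Compl)
    have "smooth_fun_on P ?V (\<lambda>q. f (\<pi> q) *\<^sub>R \<tau> q y)"
      by (rule smooth_fun_on_cong[OF bundle_top V smooth_fun_on_const[OF bundle_top V, of 0]]) (simp add: zero)
    then show ?thesis using V q False by blast
  qed
qed

lemma exists_Omega0: "\<exists>s\<in>Omega0. s p = y"
proof -
  obtain U \<tau> where U: "open U" "\<pi> p \<in> U" and \<tau>: "\<And>y. smooth_fun_on P (\<pi> -` U) (\<lambda>q. \<tau> q y)"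
    "\<And>q a y. \<pi> q \<in> U \<Longrightarrow> \<tau> (act q a) y = Ad G L (inv\<^bsub>G\<^esub> a) (\<tau> q y)" "\<And>q. linear (\<tau> q)" "\<And>y. \<tau> p y = y"
    by (rule exists_twist[of p]) (rule that; assumption)
  obtain \<beta> Z where \<beta>: "smooth_fun_on W UNIV \<beta>" "\<beta> (\<pi> p) = (1::real)" "closed Z" "Z \<subseteq> U" "\<And>y. y \<notin> Z \<Longrightarrow> \<beta> y = 0"
    using manifold_bump[OF base_atlas U] by blast
  let ?s = "\<lambda>q. \<beta> (\<pi> q) *\<^sub>R \<tau> q y"
  have "smooth_fun_on P (\<pi> -` UNIV) ?s"
    using \<beta>(5) by (intro twisted_smooth[OF U(1) \<beta>(3,4) open_UNIV \<tau>(1)] smooth_fun_on_subset[OF \<beta>(1)]) auto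
  moreover have "?s (act q a) = Ad G L (inv\<^bsub>G\<^esub> a) (?s q)" for q a
  proof (cases "\<pi> q \<in> U")
    case True
    then show ?thesis by (simp add: proj_act \<tau>(2) linear_scale[OF Ad_linear[OF structure_group]])
  next
    case False
    then have "\<beta> (\<pi> q) = 0" using \<beta>(4,5) by blast
    then show ?thesis by (simp add: proj_act linear_0[OF Ad_linear[OF structure_group]])
  qed
  ultimately have "?s \<in> Omega0" unfolding Omega0_def by simp
  then show ?thesis using \<beta>(2) \<tau>(4) by (intro bexI[of _ ?s]) simp_all
qed

lemma exists_Omega1: "\<exists>s\<in>Omega1. s p = (\<alpha> :: 'l form1)"
proof -
  obtain U \<tau> where U: "open U" "\<pi> p \<in> U" and \<tau>: "\<And>y. smooth_fun_on P (\<pi> -` U) (\<lambda>q. \<tau> q y)"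
    "\<And>q a y. \<pi> q \<in> U \<Longrightarrow> \<tau> (act q a) y = Ad G L (inv\<^bsub>G\<^esub> a) (\<tau> q y)" "\<And>q. linear (\<tau> q)" "\<And>y. \<tau> p y = y"
    by (rule exists_twist[of p]) (rule that; assumption)
  let ?c = "chart_at W (\<pi> p)"
  note c = chart_at[OF base_top, of "\<pi> p"]
  define U' where "U' = U \<inter> fst ?c"
  have U': "open U'" "\<pi> p \<in> U'" "U' \<subseteq> fst ?c" "U' \<subseteq> U" using U c(2) chart_open[OF base_top c(1)] by (auto simp: U'_def)
  obtain \<beta> Z where \<beta>: "smooth_fun_on W UNIV \<beta>" "\<beta> (\<pi> p) = (1::real)" "closed Z" "Z \<subseteq> U'" "\<And>y. y \<notin> Z \<Longrightarrow> \<beta> y = 0"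
    using manifold_bump[OF base_atlas U'(1,2)] by blast
  \<comment> \<open>A cut-off coordinate covector. Outside \<open>U'\<close> the chart derivative is
    not known to be linear, so \<open>Blinfun\<close> is applied on \<open>U'\<close> only; \<beta>
    vanishes elsewhere.\<close>
  define \<theta> where "\<theta> i y = (if y \<in> U' then Blinfun (\<lambda>X. \<beta> y * deriv_fun W (snd ?c) y X $ i) else 0)" for i y
  have \<theta>: "\<theta> i y X = \<beta> y * deriv_fun W (snd ?c) y X $ i" for i y X
  proof (cases "y \<in> U'")
    case True
    then have "linear (\<lambda>X. \<beta> y * deriv_fun W (snd ?c) y X $ i)"
      using chart_deriv_linear[OF c(1) U'(1,3) True] by (intro linearI) (simp_all add: linear_add linear_scale algebra_simps)
    then show ?thesis using True by (simp add: \<theta>_def Blinfun_apply)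
  next
    case False
    then have "\<beta> y = 0" using \<beta>(4,5) by blast
    then show ?thesis using False by (simp add: \<theta>_def)
  qed
  define s where "s q = (\<Sum>i\<in>UNIV. tensor1 (\<theta> i (\<pi> q)) (\<tau> q (\<alpha> (axis i 1))))" for q
  have s: "s q X = (\<Sum>i\<in>UNIV. (\<beta> (\<pi> q) * deriv_fun W (snd ?c) (\<pi> q) X $ i) *\<^sub>R \<tau> q (\<alpha> (axis i 1)))" for q X
    by (simp add: s_def blinfun.sum_left \<theta>)
  have "smooth_fun_on P (\<pi> -` fst d) (\<lambda>q. s q (coord_field W d u (\<pi> q)))" if d: "d \<in> W" for d u
    unfolding s
  proof (rule smooth_fun_on_sum[OF bundle_top proj_preimage_open[OF chart_open[OF base_top d]]])
    fix i :: 5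
    note od = chart_open[OF base_top d]
    have o: "open (fst d \<inter> U')" by (intro open_Int od U')
    have "smooth_fun_on W (fst d \<inter> U') (\<lambda>y. deriv_fun W (snd ?c) y (coord_field W d u y))"
      using smooth_field_on_coord[OF c(1) o _ d, of u] U'(3) unfolding smooth_field_on_def by blast
    then have "smooth_fun_on W (fst d \<inter> U') (\<lambda>y. deriv_fun W (snd ?c) y (coord_field W d u y) $ i)"
      using smooth_fun_on_smooth[OF base_top o _ smooth_on_linear[OF bounded_linear_vec_nth open_UNIV] open_UNIV] by simp
    then have "smooth_fun_on W (fst d \<inter> U') (\<lambda>y. \<beta> y * deriv_fun W (snd ?c) y (coord_field W d u y) $ i)"
      by (intro smooth_fun_on_bounded_bilinear[OF base_top o bounded_bilinear_mult] smooth_fun_on_subset[OF \<beta>(1)]) auto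
    moreover have "smooth_fun_on P (\<pi> -` U') (\<lambda>q. \<tau> q (\<alpha> (axis i 1)))"
      by (rule smooth_fun_on_subset[OF \<tau>(1)]) (use U'(4) in blast)
    ultimately show "smooth_fun_on P (\<pi> -` fst d) (\<lambda>q. (\<beta> (\<pi> q) * deriv_fun W (snd ?c) (\<pi> q) (coord_field W d u (\<pi> q)) $ i) *\<^sub>R \<tau> q (\<alpha> (axis i 1)))"
      using \<beta>(5) by (intro twisted_smooth[OF U'(1) \<beta>(3,4) od]) auto
  qed
  moreover have "s (act q a) X = Ad G L (inv\<^bsub>G\<^esub> a) (s q X)" for q a X
  proof (cases "\<pi> q \<in> U'")
    case True
    then have "\<pi> q \<in> U" using U'(4) by blast
    then show ?thesis by (simp add: s proj_act \<tau>(2) linear_sum[OF Ad_linear[OF structure_group]] linear_scale[OF Ad_linear[OF structure_group]])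
  next
    case False
    then have "\<beta> (\<pi> q) = 0" using \<beta>(4,5) by blast
    then show ?thesis by (simp add: s proj_act linear_0[OF Ad_linear[OF structure_group]])
  qed
  ultimately have "s \<in> Omega1" unfolding Omega1_def by simp
  moreover have "s p = \<alpha>"
  proof (rule blinfun_eqI)
    fix X
    have "deriv_fun W (snd ?c) (\<pi> p) X = X"
      using deriv_fun_coord_field[OF base_atlas c, of X] by (simp add: coord_field_chart_at[OF base_atlas])
    then have "s p X = \<alpha> (\<Sum>i\<in>UNIV. X $ i *\<^sub>R axis i 1)"
      by (simp add: s \<beta>(2) \<tau>(4) blinfun.bilinear_simps blinfun.sum_right)
    then show "s p X = \<alpha> X" by (simp only: vec_axis_expansion[symmetric])
  qed
  ultimately show ?thesis by blast
qed

text \<open>Self-duality must hold at every point and depends on g and v there. So the components of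
  b are spread along a smooth adapted frame, in place of the coordinate frame used for
  1-forms.\<close>

lemma exists_Omega2_plus:
  fixes b :: "'l form2"
  assumes b: "b \<in> Lambda2_plus p"
  shows "\<exists>s\<in>Omega2_plus. s p = b"
proof -
  obtain U \<tau> where U: "open U" "\<pi> p \<in> U" and \<tau>: "\<And>y. smooth_fun_on P (\<pi> -` U) (\<lambda>q. \<tau> q y)"
    "\<And>q a y. \<pi> q \<in> U \<Longrightarrow> \<tau> (act q a) y = Ad G L (inv\<^bsub>G\<^esub> a) (\<tau> q y)" "\<And>q. linear (\<tau> q)" "\<And>y. \<tau> p y = y"
    by (rule exists_twist[of p]) (rule that; assumption)
  let ?c = "chart_at W (\<pi> p)"
  note c = chart_at[OF base_top, of "\<pi> p"]
  obtain e0 where e0: "oriented_frame (g (\<pi> p)) e0" "e0 $ 5 = v (\<pi> p)"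
    using exists_adapted_frame[OF metric_inner_product unit_length] by blast
  obtain V E where V: "open V" "\<pi> p \<in> V" "V \<subseteq> fst ?c" and E: "\<And>j. smooth_field_on ?c V (\<lambda>y. E y $ j)"
    "\<And>y. y \<in> V \<Longrightarrow> adapted_frame (g y) (v y) (E y)" "E (\<pi> p) = e0"
    using local_adapted_frame[OF e0] by blast
  define U' where "U' = U \<inter> V"
  have U': "open U'" "\<pi> p \<in> U'" "U' \<subseteq> fst ?c" "U' \<subseteq> U" "U' \<subseteq> V" using U V by (auto simp: U'_def)
  obtain \<beta> Z where \<beta>: "smooth_fun_on W UNIV \<beta>" "\<beta> (\<pi> p) = (1::real)" "closed Z" "Z \<subseteq> U'" "\<And>y. y \<notin> Z \<Longrightarrow> \<beta> y = 0"
    using manifold_bump[OF base_atlas U'(1,2)] by blast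
  have zero: "\<beta> y = 0" if "y \<notin> U'" for y using that \<beta>(4,5) by blast
  let ?b = "\<lambda>k. b (e0 $ 1) (e0 $ k)"
  define s where "s q = (if \<pi> q \<in> U' then \<beta> (\<pi> q) *\<^sub>R adapted_frame.plus_form (g (\<pi> q)) (E (\<pi> q)) (\<tau> q (?b 2)) (\<tau> q (?b 3)) (\<tau> q (?b 4)) else 0)" for q
  define \<omega> where "\<omega> i j y X Y = g y (E y $ i) X * g y (E y $ j) Y - g y (E y $ j) X * g y (E y $ i) Y" for i j y X Y
  \<comment> \<open>One formula for all q: off \<open>U'\<close> both sides vanish with \<beta>. It
    reduces smoothness to the terms \<beta> \<omega> \<tau>.\<close>
  have s: "s q X Y = (\<beta> (\<pi> q) * \<omega> 1 2 (\<pi> q) X Y) *\<^sub>R \<tau> q (?b 2) + (\<beta> (\<pi> q) * \<omega> 3 4 (\<pi> q) X Y) *\<^sub>R \<tau> q (?b 2)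
    + ((\<beta> (\<pi> q) * \<omega> 1 3 (\<pi> q) X Y) *\<^sub>R \<tau> q (?b 3) + (\<beta> (\<pi> q) * \<omega> 4 2 (\<pi> q) X Y) *\<^sub>R \<tau> q (?b 3))
    + ((\<beta> (\<pi> q) * \<omega> 1 4 (\<pi> q) X Y) *\<^sub>R \<tau> q (?b 4) + (\<beta> (\<pi> q) * \<omega> 2 3 (\<pi> q) X Y) *\<^sub>R \<tau> q (?b 4))" for q X Y
  proof (cases "\<pi> q \<in> U'")
    case True
    then interpret adapted_frame "g (\<pi> q)" "v (\<pi> q)" "E (\<pi> q)" using E(2) U'(5) by blast
    show ?thesis using True
      by (simp add: s_def plus_form_def skew_apply coframe_apply \<omega>_def blinfun.add_left blinfun.scaleR_left scaleR_add_right)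
  next
    case False
    then show ?thesis using zero by (simp add: s_def)
  qed
  have mem: "s q \<in> Lambda2_plus q" for q
  proof (cases "\<pi> q \<in> U'")
    case True
    then interpret adapted_frame "g (\<pi> q)" "v (\<pi> q)" "E (\<pi> q)" using E(2) U'(5) by blast
    show ?thesis
      using True plus_form_mem[of "\<tau> q (?b 2)" "\<tau> q (?b 3)" "\<tau> q (?b 4)"]
      unfolding s_def Lambda2_plus_def star_plus_iff by (simp add: blinfun.scaleR_left alternating_def)
  next
    case False
    obtain e where e: "oriented_frame (g (\<pi> q)) e" "e $ 5 = v (\<pi> q)"
      using exists_adapted_frame[OF metric_inner_product unit_length] by blast
    interpret adapted_frame "g (\<pi> q)" "v (\<pi> q)" e by standard (rule metric_inner_product e)+
    show ?thesis using False unfolding s_def Lambda2_plus_def star_plus_iff by (simp add: alternating_def)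
  qed
  have term_smooth: "smooth_fun_on P (\<pi> -` fst d) (\<lambda>q. (\<beta> (\<pi> q) * \<omega> i j (\<pi> q) (coord_field W d u (\<pi> q)) (coord_field W d w (\<pi> q))) *\<^sub>R \<tau> q y)"
    if d: "d \<in> W" for d u w y i j
  proof -
    note od = chart_open[OF base_top d]
    have o: "open (fst d \<inter> U')" and oc: "fst d \<inter> U' \<subseteq> fst ?c" using od U'(1,3) by auto
    note si = smooth_field_on_inner[OF c(1) o oc] smooth_field_on_coord[OF c(1) o oc d]
    have Es: "smooth_field_on ?c (fst d \<inter> U') (\<lambda>y. E y $ j)" for j
      by (rule smooth_field_on_subset[OF E(1)]) (use U'(5) in blast)
    have "smooth_fun_on W (fst d \<inter> U') (\<lambda>y. \<beta> y * \<omega> i j y (coord_field W d u y) (coord_field W d w y))"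
      unfolding \<omega>_def
      by (intro smooth_fun_on_bounded_bilinear[OF base_top o bounded_bilinear_mult] smooth_fun_on_subset[OF \<beta>(1)]
          smooth_fun_on_diff[OF base_top o] si Es subset_UNIV Int_lower1)
    moreover have "smooth_fun_on P (\<pi> -` U') (\<lambda>q. \<tau> q y)"
      by (rule smooth_fun_on_subset[OF \<tau>(1)]) (use U'(4) in blast)
    ultimately show ?thesis
      using \<beta>(5) by (intro twisted_smooth[OF U'(1) \<beta>(3,4) od]) auto
  qed
  have add: "smooth_fun_on P (\<pi> -` fst d) f \<Longrightarrow> smooth_fun_on P (\<pi> -` fst d) f' \<Longrightarrow> smooth_fun_on P (\<pi> -` fst d) (\<lambda>q. f q + f' q)"
    if "d \<in> W" for d and f f' :: "'p \<Rightarrow> 'l"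
    using smooth_fun_on_sum[OF bundle_top proj_preimage_open[OF chart_open[OF base_top that]], of "{True, False}" "\<lambda>i. if i then f else f'"]
    by simp
  have "smooth_fun_on P (\<pi> -` fst d) (\<lambda>q. s q (coord_field W d u (\<pi> q)) (coord_field W d w (\<pi> q)))" if d: "d \<in> W" for d u w
    unfolding s by (intro add[OF d] term_smooth[OF d])
  moreover have "s (act q a) X Y = Ad G L (inv\<^bsub>G\<^esub> a) (s q X Y)" for q a X Y
  proof (cases "\<pi> q \<in> U'")
    case True
    then have "\<pi> q \<in> U" using U'(4) by blast
    then show ?thesis
      by (simp add: s proj_act \<tau>(2) linear_add[OF Ad_linear[OF structure_group]] linear_scale[OF Ad_linear[OF structure_group]])
  next
    case False
    then show ?thesis using zero by (simp add: s proj_act linear_0[OF Ad_linear[OF structure_group]])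
  qed
  moreover have "alternating (s q)" for q
    using mem[of q] unfolding Lambda2_plus_def star_eigenforms_def by blast
  ultimately have "s \<in> Omega2_plus"
    using mem unfolding Omega2_plus_def Omega2_def by simp
  moreover have "s p = b"
  proof -
    interpret adapted_frame "g (\<pi> p)" "v (\<pi> p)" e0 by standard (rule metric_inner_product e0)+
    show ?thesis
      using star_plus_eq_plus_form[OF b[unfolded Lambda2_plus_def]] U'(2) by (simp add: s_def \<beta>(2) \<tau>(4) E(3))
  qed
  ultimately show ?thesis by blast
qed

lemma exists_Omega1_Omega2_plus:
  assumes "e \<in> UNIV \<times> Lambda2_plus p"
  shows "\<exists>s\<in>Omega1_Omega2_plus. s p = e"
proof -
  obtain a where a: "a \<in> Omega1" "a p = fst e" using exists_Omega1 by blast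
  obtain b where b: "b \<in> Omega2_plus" "b p = snd e" using exists_Omega2_plus[of "snd e" p] assms by auto
  show ?thesis
    using a b by (intro bexI[of _ "\<lambda>q. (a q, b q)"]) (simp_all add: Omega1_Omega2_plus_def o_def)
qed

end

section \<open>The principal symbols\<close>

text \<open>If there were no f with differential \<zeta> or no s through e, every y would satisfy
  the description vacuously. One such pair makes the value unique.\<close>

lemma principal_symbol_eqI:
  fixes M :: "('w::{t2_space,second_countable_topology}, 'e::euclidean_space) chart set"
  assumes M: "smooth_atlas M" and s: "\<exists>s\<in>\<Gamma>. s p = e"
    and y: "\<And>f s. smooth_fun_on M UNIV f \<Longrightarrow> deriv_fun M f (\<pi> p) = blinfun_apply \<zeta> \<Longrightarrow> s \<in> \<Gamma> \<Longrightarrow> s p = e \<Longrightarrow>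
      D (\<lambda>q. f (\<pi> q) *\<^sub>R s q) p - f (\<pi> p) *\<^sub>R D s p = y"
  shows "principal_symbol M \<pi> \<Gamma> D p \<zeta> e = y"
  unfolding principal_symbol_def
proof (rule the_equality)
  show "\<forall>f s. smooth_fun_on M UNIV f \<and> deriv_fun M f (\<pi> p) = blinfun_apply \<zeta> \<and> s \<in> \<Gamma> \<and> s p = e \<longrightarrow>
     D (\<lambda>q. f (\<pi> q) *\<^sub>R s q) p - f (\<pi> p) *\<^sub>R D s p = y"
    using y by blast
  fix y' assume y': "\<forall>f s. smooth_fun_on M UNIV f \<and> deriv_fun M f (\<pi> p) = blinfun_apply \<zeta> \<and> s \<in> \<Gamma> \<and> s p = e \<longrightarrow>
     D (\<lambda>q. f (\<pi> q) *\<^sub>R s q) p - f (\<pi> p) *\<^sub>R D s p = y'"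
  obtain f where "smooth_fun_on M UNIV f" "deriv_fun M f (\<pi> p) = blinfun_apply \<zeta>"
    using exists_smooth_differential[OF M] by blast
  moreover obtain s where "s \<in> \<Gamma>" "s p = e" using s by blast
  ultimately show "y' = y" using y y' by blast
qed

text \<open>Degree three is what the curvature requires: the exterior derivative of the translated
  connection is affine in t and is evaluated on two lifts that are affine in t.\<close>

lemma has_vector_derivative_cubic:
  fixes \<phi> :: "real \<Rightarrow> 'b::real_normed_vector"
  assumes "\<And>t. \<phi> t = a + t *\<^sub>R b + (t * t) *\<^sub>R c + (t * t * t) *\<^sub>R d"
  shows "(\<phi> has_vector_derivative b) (at 0)"
proof -
  have "((\<lambda>t. a + t *\<^sub>R b + (t * t) *\<^sub>R c + (t * t * t) *\<^sub>R d) has_vector_derivative b) (at 0)"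
    by (auto intro!: derivative_eq_intros)
  then show ?thesis using assms by presburger
qed

context gauge_five_manifold
begin

subsection \<open>The Levi-Civita connection\<close>

text \<open>The description is met by exactly one map, given by the Koszul formula. The symbol uses
  only bilinearity, without which the \<open>Form2\<close> in \<open>nabla_form\<close> could not be
  evaluated.\<close>

lemma bilinear_christoffel: "bilinear (christoffel W g x)"
proof -
  let ?c = "chart_at W x"
  note c = chart_at[OF base_top, of x]
  note oc = chart_open[OF base_top c(1)]
  define D where "D u w z = deriv_fun W (\<lambda>y. g y (coord_field W ?c w y) (coord_field W ?c z y)) x u" for u w z
  have d: "has_mderiv W (\<lambda>y. g y (coord_field W ?c w y) (coord_field W ?c z y)) x (\<lambda>u. D u w z)" for w z
  proof -
    have "smooth_fun_on W (fst ?c) (\<lambda>y. g y (coord_field W ?c w y) (coord_field W ?c z y))"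
      using metric_base c(1) unfolding riemannian_metric_def by blast
    from smooth_fun_on_has_mderiv[OF base_top this oc c(2)] show ?thesis unfolding D_def .
  qed
  note ip = ip_simps[OF metric_inner_product]
  note lc = linear_coord_field[OF base_atlas c(1)]
  have D1: "linear (\<lambda>u. D u w z)" for w z by (rule has_mderiv_linear[OF d])
  have sym: "D u w z = D u z w" for u w z
    unfolding D_def by (simp add: ip_sym[OF metric_inner_product, of _ "coord_field W ?c w _"])
  have D3: "linear (D u w)" for u w
  proof (rule linearI)
    fix z z' :: "real^5" and r :: real
    have "has_mderiv W (\<lambda>y. g y (coord_field W ?c w y) (coord_field W ?c (z + z') y)) x (\<lambda>u. D u w z + D u w z')"
      by (rule has_mderiv_cong[OF base_top has_mderiv_add[OF d[of w z] d[of w z']] oc c(2)]) (simp add: linear_add[OF lc] ip)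
    from has_mderiv_deriv_fun[OF this] show "D u w (z + z') = D u w z + D u w z'" unfolding D_def by meson
    have "has_mderiv W (\<lambda>y. g y (coord_field W ?c w y) (coord_field W ?c (r *\<^sub>R z) y)) x (\<lambda>u. r *\<^sub>R D u w z)"
      by (rule has_mderiv_cong[OF base_top has_mderiv_bounded_linear[OF bounded_linear_scaleR_right d[of w z]] oc c(2)])
        (simp add: linear_scale[OF lc] ip)
    from has_mderiv_deriv_fun[OF this] show "D u w (r *\<^sub>R z) = r *\<^sub>R D u w z" unfolding D_def by meson
  qed
  have D2: "linear (\<lambda>w. D u w z)" for u z using D3[of u z] by (simp add: sym[of u _ z])
  \<comment> \<open>The Koszul formula for coordinate fields, whose brackets vanish;
    \<open>\<Gamma>\<close> below is its dual with respect to the metric.\<close>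
  define k where "k u w z = (1/2) * (D u w z + D w u z - D z u w)" for u w z
  note l = linear_add[OF D1] linear_add[OF D2] linear_add[OF D3] linear_scale[OF D1] linear_scale[OF D2] linear_scale[OF D3]
  have k_lin: "linear (k u w)" for u w
    by (rule linearI) (simp_all add: k_def l algebra_simps)
  obtain e where "oriented_frame (g x) e" using exists_adapted_frame[OF metric_inner_product unit_length] by blast
  then have e: "orthonormal_on (g x) UNIV e" by (simp add: oriented_frame_orthonormal)
  define \<Gamma> where "\<Gamma> u w = (\<Sum>i\<in>UNIV. k u w (e $ i) *\<^sub>R e $ i)" for u w
  have \<Gamma>k: "g x (\<Gamma> u w) z = k u w z" for u w z
  proof -
    have "g x (\<Gamma> u w) z = (\<Sum>i\<in>UNIV. g x (e $ i) z *\<^sub>R k u w (e $ i))"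
      by (simp add: \<Gamma>_def ip mult.commute)
    also have "\<dots> = k u w (\<Sum>i\<in>UNIV. g x (e $ i) z *\<^sub>R e $ i)"
      by (simp add: linear_sum[OF k_lin] linear_scale[OF k_lin])
    finally show ?thesis by (simp only: frame_expansion[OF metric_inner_product e, symmetric])
  qed
  let ?P = "\<lambda>\<Gamma>. bilinear \<Gamma> \<and> (\<forall>u w. \<Gamma> u w = \<Gamma> w u) \<and> (\<forall>u w z. D u w z = g x (\<Gamma> u w) z + g x w (\<Gamma> u z))"
  have "?P \<Gamma>"
  proof (intro conjI allI)
    have "k (u + u') w z = k u w z + k u' w z" "k (r *\<^sub>R u) w z = r * k u w z"
      "k u (w + w') z = k u w z + k u w' z" "k u (r *\<^sub>R w) z = r * k u w z" for u u' w w' z r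
      by (simp_all add: k_def l algebra_simps)
    then show "bilinear \<Gamma>"
      by (simp add: bilinear_def linear_iff \<Gamma>_def scaleR_add_left sum.distrib scaleR_sum_right)
    have "k u w z = k w u z" for u w z by (simp add: k_def sym[of z u w])
    then show "\<Gamma> u w = \<Gamma> w u" for u w unfolding \<Gamma>_def by presburger
    show "D u w z = g x (\<Gamma> u w) z + g x w (\<Gamma> u z)" for u w z
    proof -
      have "g x w (\<Gamma> u z) = k u z w" using ip_sym[OF metric_inner_product, of x w "\<Gamma> u z"] \<Gamma>k by simp
      moreover have "k u w z + k u z w = D u w z" unfolding k_def sym[of u z w] by (simp add: field_simps)
      ultimately show ?thesis by (simp add: \<Gamma>k)
    qed
  qed
  moreover have "\<Gamma>' = \<Gamma>" if P: "?P \<Gamma>'" for \<Gamma>'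
  proof (intro ext)
    fix u w
    have s: "\<Gamma>' a b = \<Gamma>' b a" and m: "D a b z = g x (\<Gamma>' a b) z + g x b (\<Gamma>' a z)" for a b z using P by blast+
    \<comment> \<open>Compatibility turns the three derivatives in k into six terms; by symmetry
      four cancel in pairs and the other two agree.\<close>
    have "g x (\<Gamma>' u w) z = k u w z" for z
      unfolding k_def m[of u w z] m[of w u z] m[of z u w] s[of w u] s[of z u] s[of z w]
        ip_sym[OF metric_inner_product, of x w "\<Gamma>' u z"] by simp
    then have "g x (\<Gamma>' u w - \<Gamma> u w) z = 0" for z by (simp add: ip \<Gamma>k)
    then show "\<Gamma>' u w = \<Gamma> u w"
      using ip_pos[OF metric_inner_product, of "\<Gamma>' u w - \<Gamma> u w" x] by force
  qed
  ultimately have "(THE \<Gamma>. ?P \<Gamma>) = \<Gamma>" by (intro the_equality) blast+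
  then have "christoffel W g x = \<Gamma>" unfolding christoffel_def D_def .
  then show ?thesis using \<open>?P \<Gamma>\<close> by simp
qed

subsection \<open>Exterior derivatives\<close>

lemma proj_has_mderiv:
  assumes f: "smooth_fun_on W UNIV f" and \<zeta>: "deriv_fun W f (\<pi> p) = blinfun_apply \<zeta>"
  shows "has_mderiv P (\<lambda>q. f (\<pi> q)) p (\<lambda>u. \<zeta> (dproj p u))"
  using has_mderiv_compose[OF bundle_top base_top proj_smooth open_UNIV UNIV_I
      smooth_fun_on_has_mderiv[OF base_top f open_UNIV UNIV_I], of p] unfolding \<zeta> .

text \<open>Differentiability at p of exactly the coefficients that \<open>ext_deriv\<close>
  differentiates there. It passes to linear combinations, as needed along the curve of
  translates.\<close>

definition differentiable_form :: "('p \<Rightarrow> 'k \<Rightarrow>\<^sub>L 'l) \<Rightarrow> 'p \<Rightarrow> bool" where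
  "differentiable_form A p \<longleftrightarrow> (\<forall>w. has_mderiv P (\<lambda>q. A q (coord_field P (chart_at P p) w q)) p
     (deriv_fun P (\<lambda>q. A q (coord_field P (chart_at P p) w q)) p))"

lemma differentiable_formI:
  fixes A :: "'p \<Rightarrow> 'k \<Rightarrow>\<^sub>L 'l"
  shows "(\<And>w. \<exists>D. has_mderiv P (\<lambda>q. A q (coord_field P (chart_at P p) w q)) p D) \<Longrightarrow> differentiable_form A p"
  unfolding differentiable_form_def using has_mderiv_deriv_fun by metis

lemma ext_deriv_apply:
  fixes A :: "'p \<Rightarrow> 'k \<Rightarrow>\<^sub>L 'l"
  shows "ext_deriv A p u w = deriv_fun P (\<lambda>q. A q (coord_field P (chart_at P p) w q)) p u -
     deriv_fun P (\<lambda>q. A q (coord_field P (chart_at P p) u q)) p w"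
  by (simp add: ext_deriv_def Let_def)

lemma ext_deriv_bilinear:
  assumes A: "differentiable_form A p"
  shows "bilinear (ext_deriv A p)"
proof -
  let ?c = "chart_at P p"
  note c = chart_at[OF bundle_top, of p]
  note oc = chart_open[OF bundle_top c(1)]
  note lc = linear_coord_field[OF bundle_atlas c(1)]
  define D where "D w = deriv_fun P (\<lambda>q. A q (coord_field P ?c w q)) p" for w
  have d: "has_mderiv P (\<lambda>q. A q (coord_field P ?c w q)) p (D w)" for w
    using A unfolding differentiable_form_def D_def by blast
  have 1: "linear (D w)" for w by (rule has_mderiv_linear[OF d])
  have "has_mderiv P (\<lambda>q. A q (coord_field P ?c (w + w') q)) p (\<lambda>u. D w u + D w' u)" for w w'
    by (rule has_mderiv_cong[OF bundle_top has_mderiv_add[OF d[of w] d[of w']] oc c(2)])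
      (simp add: linear_add[OF lc] blinfun.bilinear_simps)
  from has_mderiv_deriv_fun[OF this] have 2: "D (w + w') = (\<lambda>u. D w u + D w' u)" for w w' unfolding D_def .
  have "has_mderiv P (\<lambda>q. A q (coord_field P ?c (r *\<^sub>R w) q)) p (\<lambda>u. r *\<^sub>R D w u)" for w r
    by (rule has_mderiv_cong[OF bundle_top has_mderiv_bounded_linear[OF bounded_linear_scaleR_right d[of w]] oc c(2)])
      (simp add: linear_scale[OF lc] blinfun.bilinear_simps)
  from has_mderiv_deriv_fun[OF this] have 3: "D (r *\<^sub>R w) = (\<lambda>u. r *\<^sub>R D w u)" for w r unfolding D_def .
  show ?thesis
    unfolding bilinear_def linear_iff ext_deriv_apply D_def[symmetric]
    by (simp add: 2 3 linear_add[OF 1] linear_scale[OF 1] algebra_simps)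
qed

lemma ext_deriv_alternating: "ext_deriv A p u u = 0"
  by (simp add: ext_deriv_apply)

lemma ext_deriv_add_scale:
  assumes A: "differentiable_form A p" and A': "differentiable_form A' p"
  shows "differentiable_form (\<lambda>q. A q + r *\<^sub>R A' q) p"
    and "ext_deriv (\<lambda>q. A q + r *\<^sub>R A' q) p u w = ext_deriv A p u w + r *\<^sub>R ext_deriv A' p u w"
proof -
  let ?cf = "coord_field P (chart_at P p)"
  let ?D = "\<lambda>A w. deriv_fun P (\<lambda>q. A q (?cf w q)) p"
  have d: "has_mderiv P (\<lambda>q. (A q + r *\<^sub>R A' q) (?cf w q)) p (\<lambda>u. ?D A w u + r *\<^sub>R ?D A' w u)" for w
    using has_mderiv_add[OF A[unfolded differentiable_form_def, rule_format, of w]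
        has_mderiv_bounded_linear[OF bounded_linear_scaleR_right A'[unfolded differentiable_form_def, rule_format, of w]], of r]
    by (simp add: blinfun.bilinear_simps)
  then show "differentiable_form (\<lambda>q. A q + r *\<^sub>R A' q) p" by (intro differentiable_formI) blast
  show "ext_deriv (\<lambda>q. A q + r *\<^sub>R A' q) p u w = ext_deriv A p u w + r *\<^sub>R ext_deriv A' p u w"
    unfolding ext_deriv_apply has_mderiv_deriv_fun[OF d] by (simp add: algebra_simps)
qed

text \<open>The pull-back \<pi>^*\<alpha>, so that \<open>translate A\<close> applied to \<alpha> is
  A + \<pi>^*\<alpha>.\<close>

definition pull :: "('p \<Rightarrow> 'l form1) \<Rightarrow> 'p \<Rightarrow> 'k \<Rightarrow>\<^sub>L 'l" where
  "pull \<alpha> p = \<alpha> p o\<^sub>L Blinfun (dproj p)"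

lemma pull_apply: "pull \<alpha> p u = \<alpha> p (dproj p u)"
  by (simp add: pull_def Blinfun_apply linear_dproj)

lemma translate_scale: "translate A (\<lambda>q. t *\<^sub>R \<alpha> q) = (\<lambda>q. A q + t *\<^sub>R pull \<alpha> q)"
  by (intro ext blinfun_eqI) (simp add: translate_apply pull_apply blinfun.bilinear_simps)

lemma connection_differentiable: "A \<in> connections \<Longrightarrow> differentiable_form A p"
proof (rule differentiable_formI)
  fix w assume A: "A \<in> connections"
  note c = chart_at[OF bundle_top, of p]
  have "smooth_fun_on P (fst (chart_at P p)) (\<lambda>q. A q (coord_field P (chart_at P p) w q))"
    using A c(1) unfolding connections_def by blast
  from smooth_fun_on_has_mderiv[OF bundle_top this chart_open[OF bundle_top c(1)] c(2)]
  show "\<exists>D. has_mderiv P (\<lambda>q. A q (coord_field P (chart_at P p) w q)) p D" by blast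
qed

lemma connection_fundamental:
  fixes A :: "'p \<Rightarrow> 'k \<Rightarrow>\<^sub>L 'l"
  shows "A \<in> connections \<Longrightarrow> A p (fundamental_field X p) = X"
  unfolding connections_def by blast

text \<open>\<open>Omega1\<close> tests smoothness on coordinate fields of W, whereas here
  coordinate fields of P are inserted. The projection of such a field is expanded in the coordinate
  fields of W, with smooth coefficients taken from the derivative of \<pi> in charts.\<close>

lemma pull_differentiable:
  assumes \<alpha>: "\<alpha> \<in> Omega1"
  shows "differentiable_form (pull \<alpha>) p"
proof (rule differentiable_formI)
  fix w
  let ?c = "chart_at P p" and ?d = "chart_at W (\<pi> p)"
  note c = chart_at[OF bundle_top, of p] and d = chart_at[OF base_top, of "\<pi> p"]
  let ?V = "fst ?c \<inter> \<pi> -` fst ?d"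
  have V: "open ?V" by (intro open_Int chart_open[OF bundle_top c(1)] proj_preimage_open chart_open[OF base_top d(1)])
  have pV: "p \<in> ?V" using c(2) d(2) by simp
  have h: "smooth_fun_on P (\<pi> -` fst ?d) (\<lambda>q. snd ?d (\<pi> q))"
    using smooth_map_on_chart[OF proj_smooth d(1)] by simp
  let ?\<eta> = "\<lambda>q. frechet_derivative ((\<lambda>q. snd ?d (\<pi> q)) \<circ> cinv ?c) (at (snd ?c q)) w"
  have s\<eta>: "smooth_fun_on P ?V ?\<eta>"
  proof -
    have "smooth_on (snd ?c ` (fst ?c \<inter> \<pi> -` fst ?d)) ((\<lambda>q. snd ?d (\<pi> q)) \<circ> cinv ?c)"
      using h c(1) unfolding smooth_fun_on_def by blast
    then have "smooth_on (snd ?c ` ?V) (\<lambda>y. frechet_derivative ((\<lambda>q. snd ?d (\<pi> q)) \<circ> cinv ?c) (at y) w)"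
      by (rule smooth_on_derivative)
    moreover have "smooth_fun_on P ?V (snd ?c)"
      by (rule smooth_fun_on_subset[OF smooth_fun_on_chart[OF bundle_atlas c(1)]]) simp
    moreover have "open (snd ?c ` ?V)"
      by (rule chart_image_open[OF bundle_top c(1) proj_preimage_open[OF chart_open[OF base_top d(1)]]])
    ultimately show ?thesis
      using smooth_fun_on_smooth[OF bundle_top V, of "snd ?c" "snd ?c ` ?V" "\<lambda>y. frechet_derivative ((\<lambda>q. snd ?d (\<pi> q)) \<circ> cinv ?c) (at y) w"]
      by simp
  qed
  have dp: "dproj q (coord_field P ?c w q) = coord_field W ?d (?\<eta> q) (\<pi> q)" if q: "q \<in> ?V" for q
  proof -
    have qc: "q \<in> fst ?c" "\<pi> q \<in> fst ?d" using q by auto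
    have "has_mderiv W (snd ?d) (\<pi> q) (deriv_fun W (snd ?d) (\<pi> q))"
      by (rule smooth_fun_on_has_mderiv[OF base_top smooth_fun_on_chart[OF base_atlas d(1)] chart_open[OF base_top d(1)] qc(2)])
    from has_mderiv_chart[OF bundle_atlas has_mderiv_compose[OF bundle_top base_top proj_smooth open_UNIV UNIV_I this] c(1) qc(1)]
    have "?\<eta> q = deriv_fun W (snd ?d) (\<pi> q) (dproj q (coord_field P ?c w q))"
      by (rule fun_cong[OF frechet_derivative_at[symmetric]])
    then show ?thesis using coord_field_deriv_fun[OF base_atlas d(1) qc(2)] by simp
  qed
  have "smooth_fun_on P ?V (\<lambda>q. \<Sum>i\<in>UNIV. ?\<eta> q $ i *\<^sub>R \<alpha> q (coord_field W ?d (axis i 1) (\<pi> q)))"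
  proof (intro smooth_fun_on_sum[OF bundle_top V] smooth_fun_on_bounded_bilinear[OF bundle_top V bounded_bilinear_scaleR])
    show "smooth_fun_on P ?V (\<lambda>q. ?\<eta> q $ i)" for i
      using smooth_fun_on_smooth[OF bundle_top V s\<eta> smooth_on_linear[OF bounded_linear_vec_nth open_UNIV] open_UNIV] by simp
    have "smooth_fun_on P (\<pi> -` fst ?d) (\<lambda>q. \<alpha> q (coord_field W ?d (axis i 1) (\<pi> q)))" for i
      using \<alpha> d(1) unfolding Omega1_def by blast
    then show "smooth_fun_on P ?V (\<lambda>q. \<alpha> q (coord_field W ?d (axis i 1) (\<pi> q)))" for i
      by (rule smooth_fun_on_subset) simp
  qed
  then have "smooth_fun_on P ?V (\<lambda>q. pull \<alpha> q (coord_field P ?c w q))"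
  proof (rule smooth_fun_on_cong[OF bundle_top V])
    fix q assume q: "q \<in> ?V"
    then have qd: "\<pi> q \<in> fst ?d" by simp
    note l = linear_coord_field[OF base_atlas d(1) qd]
    have "pull \<alpha> q (coord_field P ?c w q) = \<alpha> q (coord_field W ?d (\<Sum>i\<in>UNIV. ?\<eta> q $ i *\<^sub>R axis i 1) (\<pi> q))"
      unfolding vec_axis_expansion[symmetric] pull_apply dp[OF q] ..
    then show "(\<Sum>i\<in>UNIV. ?\<eta> q $ i *\<^sub>R \<alpha> q (coord_field W ?d (axis i 1) (\<pi> q))) = pull \<alpha> q (coord_field P ?c w q)"
      by (simp add: linear_sum[OF l] linear_scale[OF l] blinfun.sum_right blinfun.scaleR_right)
  qed
  from smooth_fun_on_has_mderiv[OF bundle_top this V pV]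
  show "\<exists>D. has_mderiv P (\<lambda>q. pull \<alpha> q (coord_field P ?c w q)) p D" by blast
qed

text \<open>The last bracket is df \<and> \<alpha> from the Leibniz rule, and the origin of \<zeta>
  \<and> \<alpha> in the symbol.\<close>

lemma ext_deriv_pull_scale:
  assumes \<alpha>: "differentiable_form (pull \<alpha>) p"
    and f: "smooth_fun_on W UNIV f" and \<zeta>: "deriv_fun W f (\<pi> p) = blinfun_apply \<zeta>"
  shows "differentiable_form (pull (\<lambda>q. f (\<pi> q) *\<^sub>R \<alpha> q)) p"
    and "ext_deriv (pull (\<lambda>q. f (\<pi> q) *\<^sub>R \<alpha> q)) p u w = f (\<pi> p) *\<^sub>R ext_deriv (pull \<alpha>) p u w
      + (\<zeta> (dproj p u) *\<^sub>R \<alpha> p (dproj p w) - \<zeta> (dproj p w) *\<^sub>R \<alpha> p (dproj p u))"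
proof -
  let ?cf = "coord_field P (chart_at P p)"
  let ?D = "\<lambda>w. deriv_fun P (\<lambda>q. pull \<alpha> q (?cf w q)) p"
  have d: "has_mderiv P (\<lambda>q. pull (\<lambda>q. f (\<pi> q) *\<^sub>R \<alpha> q) q (?cf w q)) p
      (\<lambda>u. f (\<pi> p) *\<^sub>R ?D w u + \<zeta> (dproj p u) *\<^sub>R \<alpha> p (dproj p w))" for w
    using has_mderiv_bilinear[OF bundle_top bounded_bilinear_scaleR proj_has_mderiv[OF f \<zeta>]
        \<alpha>[unfolded differentiable_form_def, rule_format, of w]]
    by (simp add: pull_apply blinfun.bilinear_simps coord_field_chart_at[OF bundle_atlas])
  then show "differentiable_form (pull (\<lambda>q. f (\<pi> q) *\<^sub>R \<alpha> q)) p" by (intro differentiable_formI) blast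
  show "ext_deriv (pull (\<lambda>q. f (\<pi> q) *\<^sub>R \<alpha> q)) p u w = f (\<pi> p) *\<^sub>R ext_deriv (pull \<alpha>) p u w
      + (\<zeta> (dproj p u) *\<^sub>R \<alpha> p (dproj p w) - \<zeta> (dproj p w) *\<^sub>R \<alpha> p (dproj p u))"
    unfolding ext_deriv_apply has_mderiv_deriv_fun[OF d] by (simp add: algebra_simps)
qed

text \<open>A vanishes on horizontal lifts, so the bracket term of the structure equation drops
  out.\<close>

lemma curvature_apply:
  fixes A :: "'p \<Rightarrow> 'k \<Rightarrow>\<^sub>L 'l"
  assumes A: "\<And>X. A p (fundamental_field X p) = X" "differentiable_form A p"
  shows "curvature A p X Y = ext_deriv A p (horizontal_lift A p X) (horizontal_lift A p Y)"
proof -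
  note h = horizontal_lift(2)[where A = A and p = p, OF A(1)]
  note l = linear_horizontal_lift[where A = A and p = p, OF A(1)]
  note b = ext_deriv_bilinear[OF A(2)]
  have "bilinear (\<lambda>X Y. ext_deriv A p (horizontal_lift A p X) (horizontal_lift A p Y))"
    by (simp add: bilinear_def linear_iff linear_add[OF l] linear_scale[OF l] bilinear_ladd[OF b] bilinear_radd[OF b]
        bilinear_lmul[OF b] bilinear_rmul[OF b])
  then show ?thesis
    unfolding curvature_def Let_def h bilinear_lzero[OF lie_bracket_bilinear[OF structure_group]] add_0_right
    by (rule Form2_apply)
qed

lemma alternating_curvature:
  fixes A :: "'p \<Rightarrow> 'k \<Rightarrow>\<^sub>L 'l"
  assumes "\<And>X. A p (fundamental_field X p) = X" "differentiable_form A p"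
  shows "alternating (curvature A p)"
  by (simp add: alternating_def curvature_apply[where A = A and p = p, OF assms] ext_deriv_alternating)

subsection \<open>The covariant derivative\<close>

text \<open>The differentiating part of \<open>nabla_form\<close>, with the direction on P left free
  because the horizontal lift varies with the connection.\<close>

definition form2_deriv :: "('p \<Rightarrow> 'l form2) \<Rightarrow> 'p \<Rightarrow> real^5 \<Rightarrow> real^5 \<Rightarrow> 'k \<Rightarrow> 'l" where
  "form2_deriv B p Y Z = deriv_fun P (\<lambda>q. B q (coord_field W (chart_at W (\<pi> p)) Y (\<pi> q)) (coord_field W (chart_at W (\<pi> p)) Z (\<pi> q))) p"

definition differentiable_form2 :: "('p \<Rightarrow> 'l form2) \<Rightarrow> 'p \<Rightarrow> bool" where
  "differentiable_form2 B p \<longleftrightarrow> (\<forall>Y Z. has_mderiv P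
     (\<lambda>q. B q (coord_field W (chart_at W (\<pi> p)) Y (\<pi> q)) (coord_field W (chart_at W (\<pi> p)) Z (\<pi> q))) p (form2_deriv B p Y Z))"

lemma Omega2_differentiable: "B \<in> Omega2 \<Longrightarrow> differentiable_form2 B p"
  unfolding differentiable_form2_def form2_deriv_def
proof (intro allI)
  fix Y Z assume B: "B \<in> Omega2"
  let ?c = "chart_at W (\<pi> p)"
  note c = chart_at[OF base_top, of "\<pi> p"]
  have "smooth_fun_on P (\<pi> -` fst ?c) (\<lambda>q. B q (coord_field W ?c Y (\<pi> q)) (coord_field W ?c Z (\<pi> q)))"
    using B c(1) unfolding Omega2_def by blast
  from smooth_fun_on_has_mderiv[OF bundle_top this proj_preimage_open[OF chart_open[OF base_top c(1)]]]
  show "has_mderiv P (\<lambda>q. B q (coord_field W ?c Y (\<pi> q)) (coord_field W ?c Z (\<pi> q))) p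
     (deriv_fun P (\<lambda>q. B q (coord_field W ?c Y (\<pi> q)) (coord_field W ?c Z (\<pi> q))) p)"
    using c(2) by simp
qed

lemma form2_deriv_linear: "differentiable_form2 B p \<Longrightarrow> linear (form2_deriv B p Y Z)"
  unfolding differentiable_form2_def by (elim allE) (rule has_mderiv_linear)

lemma form2_deriv_bilinear:
  assumes B: "differentiable_form2 B p"
  shows "bilinear (\<lambda>Y Z. form2_deriv B p Y Z u)"
proof -
  let ?c = "chart_at W (\<pi> p)"
  note c = chart_at[OF base_top, of "\<pi> p"]
  note o = proj_preimage_open[OF chart_open[OF base_top c(1)]]
  note lc = linear_coord_field[OF base_atlas c(1)]
  note d = B[unfolded differentiable_form2_def, rule_format]
  note s = bounded_linear_scaleR_right
  have p: "p \<in> \<pi> -` fst ?c" using c(2) by simp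
  let ?b = "\<lambda>Y Z q. B q (coord_field W ?c Y (\<pi> q)) (coord_field W ?c Z (\<pi> q))"
  have "has_mderiv P (?b (Y + Y') Z) p (\<lambda>u. form2_deriv B p Y Z u + form2_deriv B p Y' Z u)" for Y Y' Z
    by (rule has_mderiv_cong[OF bundle_top has_mderiv_add[OF d[of Y Z] d[of Y' Z]] o p]) (simp add: linear_add[OF lc] blinfun.bilinear_simps)
  from has_mderiv_deriv_fun[OF this] have 1: "form2_deriv B p (Y + Y') Z = (\<lambda>u. form2_deriv B p Y Z u + form2_deriv B p Y' Z u)" for Y Y' Z
    unfolding form2_deriv_def .
  have "has_mderiv P (?b Y (Z + Z')) p (\<lambda>u. form2_deriv B p Y Z u + form2_deriv B p Y Z' u)" for Y Z' Z
    by (rule has_mderiv_cong[OF bundle_top has_mderiv_add[OF d[of Y Z] d[of Y Z']] o p]) (simp add: linear_add[OF lc] blinfun.bilinear_simps)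
  from has_mderiv_deriv_fun[OF this] have 2: "form2_deriv B p Y (Z + Z') = (\<lambda>u. form2_deriv B p Y Z u + form2_deriv B p Y Z' u)" for Y Z Z'
    unfolding form2_deriv_def .
  have "has_mderiv P (?b (r *\<^sub>R Y) Z) p (\<lambda>u. r *\<^sub>R form2_deriv B p Y Z u)" for Y Z r
    by (rule has_mderiv_cong[OF bundle_top has_mderiv_bounded_linear[OF s d[of Y Z]] o p]) (simp add: linear_scale[OF lc] blinfun.bilinear_simps)
  from has_mderiv_deriv_fun[OF this] have 3: "form2_deriv B p (r *\<^sub>R Y) Z = (\<lambda>u. r *\<^sub>R form2_deriv B p Y Z u)" for Y Z r
    unfolding form2_deriv_def .
  have "has_mderiv P (?b Y (r *\<^sub>R Z)) p (\<lambda>u. r *\<^sub>R form2_deriv B p Y Z u)" for Y Z r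
    by (rule has_mderiv_cong[OF bundle_top has_mderiv_bounded_linear[OF s d[of Y Z]] o p]) (simp add: linear_scale[OF lc] blinfun.bilinear_simps)
  from has_mderiv_deriv_fun[OF this] have 4: "form2_deriv B p Y (r *\<^sub>R Z) = (\<lambda>u. r *\<^sub>R form2_deriv B p Y Z u)" for Y Z r
    unfolding form2_deriv_def .
  show ?thesis
    unfolding bilinear_def linear_iff by (simp add: 1 2 3 4)
qed

lemma form2_deriv_add_scale:
  assumes B: "differentiable_form2 B p" and b: "differentiable_form2 b p"
  shows "differentiable_form2 (\<lambda>q. B q + r *\<^sub>R b q) p"
    and "form2_deriv (\<lambda>q. B q + r *\<^sub>R b q) p Y Z u = form2_deriv B p Y Z u + r *\<^sub>R form2_deriv b p Y Z u"
proof -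
  let ?cf = "\<lambda>Y q. coord_field W (chart_at W (\<pi> p)) Y (\<pi> q)"
  have d: "has_mderiv P (\<lambda>q. (B q + r *\<^sub>R b q) (?cf Y q) (?cf Z q)) p (\<lambda>u. form2_deriv B p Y Z u + r *\<^sub>R form2_deriv b p Y Z u)" for Y Z
    using has_mderiv_add[OF B[unfolded differentiable_form2_def, rule_format, of Y Z]
        has_mderiv_bounded_linear[OF bounded_linear_scaleR_right b[unfolded differentiable_form2_def, rule_format, of Y Z]], of r]
    by (simp add: blinfun.bilinear_simps)
  have eq: "form2_deriv (\<lambda>q. B q + r *\<^sub>R b q) p Y Z = (\<lambda>u. form2_deriv B p Y Z u + r *\<^sub>R form2_deriv b p Y Z u)" for Y Z
    using has_mderiv_deriv_fun[OF d[of Y Z]] unfolding form2_deriv_def .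
  show "differentiable_form2 (\<lambda>q. B q + r *\<^sub>R b q) p" unfolding differentiable_form2_def eq using d by blast
  show "form2_deriv (\<lambda>q. B q + r *\<^sub>R b q) p Y Z u = form2_deriv B p Y Z u + r *\<^sub>R form2_deriv b p Y Z u" by (simp add: eq)
qed

lemma form2_deriv_scale:
  assumes b: "differentiable_form2 b p"
    and f: "smooth_fun_on W UNIV f" and \<zeta>: "deriv_fun W f (\<pi> p) = blinfun_apply \<zeta>"
  shows "differentiable_form2 (\<lambda>q. f (\<pi> q) *\<^sub>R b q) p"
    and "form2_deriv (\<lambda>q. f (\<pi> q) *\<^sub>R b q) p Y Z u = f (\<pi> p) *\<^sub>R form2_deriv b p Y Z u + \<zeta> (dproj p u) *\<^sub>R b p Y Z"
proof -
  let ?cf = "\<lambda>Y q. coord_field W (chart_at W (\<pi> p)) Y (\<pi> q)"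
  have d: "has_mderiv P (\<lambda>q. (f (\<pi> q) *\<^sub>R b q) (?cf Y q) (?cf Z q)) p (\<lambda>u. f (\<pi> p) *\<^sub>R form2_deriv b p Y Z u + \<zeta> (dproj p u) *\<^sub>R b p Y Z)" for Y Z
    using has_mderiv_bilinear[OF bundle_top bounded_bilinear_scaleR proj_has_mderiv[OF f \<zeta>]
        b[unfolded differentiable_form2_def, rule_format, of Y Z]]
    by (simp add: blinfun.bilinear_simps coord_field_chart_at[OF base_atlas])
  have eq: "form2_deriv (\<lambda>q. f (\<pi> q) *\<^sub>R b q) p Y Z = (\<lambda>u. f (\<pi> p) *\<^sub>R form2_deriv b p Y Z u + \<zeta> (dproj p u) *\<^sub>R b p Y Z)" for Y Z
    using has_mderiv_deriv_fun[OF d[of Y Z]] unfolding form2_deriv_def .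
  show "differentiable_form2 (\<lambda>q. f (\<pi> q) *\<^sub>R b q) p" unfolding differentiable_form2_def eq using d by blast
  show "form2_deriv (\<lambda>q. f (\<pi> q) *\<^sub>R b q) p Y Z u = f (\<pi> p) *\<^sub>R form2_deriv b p Y Z u + \<zeta> (dproj p u) *\<^sub>R b p Y Z" by (simp add: eq)
qed

lemma linear_h_proj: "linear (h_proj x)"
  by (rule linearI) (simp_all add: h_proj_def ip_simps[OF metric_inner_product] algebra_simps)

lemma nabla_apply:
  assumes B: "differentiable_form2 B p"
  shows "nabla A B p X Y Z = form2_deriv B p (h_proj (\<pi> p) Y) (h_proj (\<pi> p) Z) (horizontal_lift A p X)
    - B p (christoffel W g (\<pi> p) X (h_proj (\<pi> p) Y)) (h_proj (\<pi> p) Z)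
    - B p (h_proj (\<pi> p) Y) (christoffel W g (\<pi> p) X (h_proj (\<pi> p) Z))"
proof -
  note c = bilinear_christoffel[of "\<pi> p"]
  note d = form2_deriv_bilinear[OF B]
  let ?F = "\<lambda>Y Z. form2_deriv B p Y Z (horizontal_lift A p X)
    - B p (christoffel W g (\<pi> p) X Y) Z - B p Y (christoffel W g (\<pi> p) X Z)"
  have F: "bilinear ?F"
    unfolding bilinear_def linear_iff
    by (simp add: bilinear_ladd[OF d] bilinear_radd[OF d] bilinear_lmul[OF d] bilinear_rmul[OF d]
        bilinear_radd[OF c] bilinear_rmul[OF c] blinfun.bilinear_simps algebra_simps)
  have 1: "nabla_form A B p X Y Z = ?F Y Z" for Y Z
    unfolding nabla_form_def Let_def form2_deriv_def[symmetric] by (rule Form2_apply[OF F])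
  have "bilinear (\<lambda>Y Z. ?F (h_proj (\<pi> p) Y) (h_proj (\<pi> p) Z))"
    using F linear_h_proj[of "\<pi> p"] by (simp add: bilinear_def linear_iff)
  then show ?thesis
    unfolding nabla_def 1 by (rule Form2_apply)
qed

end

subsection \<open>The quadratic term\<close>

lemma sd_component_linear:
  "sd_component h e k (\<xi> + r *\<^sub>R \<xi>') = sd_component h e k \<xi> + r *\<^sub>R sd_component h e k \<xi>'"
  by (simp add: sd_component_def blinfun.bilinear_simps scaleR_add_right sum.distrib scaleR_sum_right mult_ac)

lemma sigma_apply:
  fixes \<xi> :: "'b::real_normed_vector form2"
  assumes h: "inner_product h"
  shows "sigma h n br \<xi> \<zeta> X Y = (let e = SOME e. oriented_frame h e \<and> e $ 5 = n in
     (1/2) *\<^sub>R (\<Sum>i\<in>UNIV. \<Sum>j\<in>UNIV. \<Sum>k\<in>UNIV.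
        (cross3 (axis i 1) (axis j 1) $ k * sd_basis h e k X Y) *\<^sub>R
          br (sd_component h e i \<xi>) (sd_component h e j \<zeta>)))"
proof -
  have b: "bilinear (sd_basis h e k)" for e k
    unfolding bilinear_def linear_iff sd_basis_def Let_def
    by (auto simp: wedge11_def ip_simps[OF h] algebra_simps add_divide_distrib diff_divide_distrib)
  show ?thesis
    unfolding sigma_def Let_def
    by (rule Form2_apply)
      (simp add: bilinear_def linear_iff bilinear_ladd[OF b] bilinear_radd[OF b] bilinear_lmul[OF b] bilinear_rmul[OF b]
        algebra_simps add_divide_distrib scaleR_add_left scaleR_add_right sum.distrib scaleR_sum_right)
qed

text \<open>The frame chosen in \<open>sigma\<close> depends on h and n alone, so it is the same on
  both sides and linearity is checked with it fixed.\<close>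

lemma sigma_bilinear:
  fixes \<xi> :: "'b::real_normed_vector form2"
  assumes h: "inner_product h" and br: "bilinear br"
  shows "sigma h n br (\<xi> + r *\<^sub>R \<xi>') \<zeta> = sigma h n br \<xi> \<zeta> + r *\<^sub>R sigma h n br \<xi>' \<zeta>"
    and "sigma h n br \<zeta> (\<xi> + r *\<^sub>R \<xi>') = sigma h n br \<zeta> \<xi> + r *\<^sub>R sigma h n br \<zeta> \<xi>'"
  by (rule form2_eqI; simp add: blinfun.bilinear_simps sigma_apply[OF h] Let_def sd_component_linear
      bilinear_ladd[OF br] bilinear_radd[OF br] bilinear_lmul[OF br] bilinear_rmul[OF br]
      scaleR_add_right sum.distrib scaleR_sum_right mult_ac)+

context gauge_five_manifold
begin

subsection \<open>Linearization\<close>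

context
  fixes A :: "'p \<Rightarrow> 'k \<Rightarrow>\<^sub>L 'l" and B :: "'p \<Rightarrow> 'l form2" and p :: 'p
  assumes A: "A \<in> connections" and B: "B \<in> Omega2_plus"
begin

lemmas A_fund = connection_fundamental[OF A, of p]
lemmas A_diff = connection_differentiable[OF A, of p]
lemmas lift_linear = linear_horizontal_lift[where A = A and p = p, OF A_fund]

lemma B_diff: "differentiable_form2 B p"
  using B Omega2_differentiable unfolding Omega2_plus_def by blast

text \<open>The derivative of the curvature along \<open>\<alpha>\<close>; the last two terms come from the variation of the
  horizontal lift and are algebraic in \<open>\<alpha>\<close>.\<close>

definition curvature_deriv :: "('p \<Rightarrow> 'l form1) \<Rightarrow> 'l form2" where
  "curvature_deriv \<alpha> = Form2 (\<lambda>X Y. ext_deriv (pull \<alpha>) p (horizontal_lift A p X) (horizontal_lift A p Y)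
     - ext_deriv A p (fundamental_field (\<alpha> p X) p) (horizontal_lift A p Y)
     - ext_deriv A p (horizontal_lift A p X) (fundamental_field (\<alpha> p Y) p))"

lemma curvature_deriv_apply:
  assumes \<alpha>: "differentiable_form (pull \<alpha>) p"
  shows "curvature_deriv \<alpha> X Y = ext_deriv (pull \<alpha>) p (horizontal_lift A p X) (horizontal_lift A p Y)
     - ext_deriv A p (fundamental_field (\<alpha> p X) p) (horizontal_lift A p Y)
     - ext_deriv A p (horizontal_lift A p X) (fundamental_field (\<alpha> p Y) p)"
proof -
  note b = ext_deriv_bilinear[OF A_diff] and b' = ext_deriv_bilinear[OF \<alpha>]
  note F = linear_fundamental[of p]
  show ?thesis
    unfolding curvature_deriv_def
    by (rule Form2_apply)
      (simp add: bilinear_def linear_iff bilinear_ladd[OF b] bilinear_radd[OF b] bilinear_lmul[OF b] bilinear_rmul[OF b]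
        bilinear_ladd[OF b'] bilinear_radd[OF b'] bilinear_lmul[OF b'] bilinear_rmul[OF b'] blinfun.bilinear_simps
        linear_add[OF F] linear_scale[OF F] linear_add[OF lift_linear] linear_scale[OF lift_linear] algebra_simps)
qed

lemma ext_deriv_skew: "ext_deriv A p u w = - ext_deriv A p w u"
  by (simp add: ext_deriv_apply)

lemma alternating_curvature_deriv:
  assumes \<alpha>: "differentiable_form (pull \<alpha>) p"
  shows "alternating (curvature_deriv \<alpha>)"
  unfolding alternating_def curvature_deriv_apply[OF \<alpha>]
  by (simp add: ext_deriv_alternating ext_deriv_skew[of "horizontal_lift A p _"])

lemma curvature_has_derivative:
  assumes \<alpha>: "differentiable_form (pull \<alpha>) p"
  shows "((\<lambda>t. curvature (translate A (\<lambda>q. t *\<^sub>R \<alpha> q)) p X Y) has_vector_derivative curvature_deriv \<alpha> X Y) (at 0)"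
    and "alternating (curvature (translate A (\<lambda>q. t *\<^sub>R \<alpha> q)) p)"
proof -
  let ?A = "\<lambda>t. translate A (\<lambda>q. t *\<^sub>R \<alpha> q)"
  have f: "?A t p (fundamental_field X p) = X" for t X
    by (rule translate_fundamental[where A = A and p = p, OF A_fund])
  have d: "differentiable_form (?A t) p" for t
    unfolding translate_scale by (rule ext_deriv_add_scale(1)[OF A_diff \<alpha>])
  show "alternating (curvature (?A t) p)" by (rule alternating_curvature[where A = "?A t" and p = p, OF f d])
  note b = ext_deriv_bilinear[OF A_diff] and b' = ext_deriv_bilinear[OF \<alpha>]
  note F = linear_fundamental[of p]
  let ?h = "horizontal_lift A p" and ?F = "\<lambda>X. fundamental_field (\<alpha> p X) p"
  let ?E = "ext_deriv A p" and ?E' = "ext_deriv (pull \<alpha>) p"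
  have h: "horizontal_lift (?A t) p X = ?h X - t *\<^sub>R ?F X" for t X
    by (simp add: horizontal_lift_translate[where A = A and p = p, OF A_fund] blinfun.scaleR_left linear_scale[OF F])
  \<comment> \<open>The form dA + t d(\<pi>^*\<alpha>) evaluated on the two moved lifts and sorted
    by powers of t.\<close>
  have "curvature (?A t) p X Y = ?E (?h X) (?h Y) + t *\<^sub>R curvature_deriv \<alpha> X Y
      + (t * t) *\<^sub>R (?E (?F X) (?F Y) - ?E' (?F X) (?h Y) - ?E' (?h X) (?F Y))
      + (t * t * t) *\<^sub>R ?E' (?F X) (?F Y)" for t
  proof -
    have "curvature (?A t) p X Y = ?E (?h X - t *\<^sub>R ?F X) (?h Y - t *\<^sub>R ?F Y) + t *\<^sub>R ?E' (?h X - t *\<^sub>R ?F X) (?h Y - t *\<^sub>R ?F Y)"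
      unfolding curvature_apply[where A = "?A t" and p = p, OF f d] h unfolding translate_scale ext_deriv_add_scale(2)[OF A_diff \<alpha>] ..
    then show ?thesis
      unfolding curvature_deriv_apply[OF \<alpha>]
      by (simp add: bilinear_lsub[OF b] bilinear_rsub[OF b] bilinear_lmul[OF b] bilinear_rmul[OF b]
          bilinear_lsub[OF b'] bilinear_rsub[OF b'] bilinear_lmul[OF b'] bilinear_rmul[OF b'] algebra_simps)
  qed
  then show "((\<lambda>t. curvature (?A t) p X Y) has_vector_derivative curvature_deriv \<alpha> X Y) (at 0)"
    by (rule has_vector_derivative_cubic)
qed

text \<open>The subtracted term comes from the variation of the lift: it differentiates B but
  contains \<alpha> without derivatives.\<close>

definition nabla_deriv :: "('p \<Rightarrow> 'l form1) \<Rightarrow> ('p \<Rightarrow> 'l form2) \<Rightarrow> real^5 \<Rightarrow> 'l form2" where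
  "nabla_deriv \<alpha> b X = nabla A b p X - Form2 (\<lambda>Y Z. form2_deriv B p (h_proj (\<pi> p) Y) (h_proj (\<pi> p) Z) (fundamental_field (\<alpha> p X) p))"

lemma nabla_deriv_apply:
  assumes b: "differentiable_form2 b p"
  shows "nabla_deriv \<alpha> b X Y Z = nabla A b p X Y Z - form2_deriv B p (h_proj (\<pi> p) Y) (h_proj (\<pi> p) Z) (fundamental_field (\<alpha> p X) p)"
proof -
  have "bilinear (\<lambda>Y Z. form2_deriv B p (h_proj (\<pi> p) Y) (h_proj (\<pi> p) Z) (fundamental_field (\<alpha> p X) p))"
    using form2_deriv_bilinear[OF B_diff] linear_h_proj[of "\<pi> p"] by (simp add: bilinear_def linear_iff)
  then show ?thesis by (simp add: nabla_deriv_def blinfun.diff_left Form2_apply)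
qed

lemma nabla_has_derivative:
  assumes b: "differentiable_form2 b p"
  shows "((\<lambda>t. nabla (translate A (\<lambda>q. t *\<^sub>R \<alpha> q)) (\<lambda>q. B q + t *\<^sub>R b q) p X Y Z) has_vector_derivative nabla_deriv \<alpha> b X Y Z) (at 0)"
proof -
  let ?A = "\<lambda>t. translate A (\<lambda>q. t *\<^sub>R \<alpha> q)"
  note F = linear_fundamental[of p]
  let ?h = "horizontal_lift A p" and ?F = "\<lambda>X. fundamental_field (\<alpha> p X) p"
  let ?pY = "h_proj (\<pi> p) Y" and ?pZ = "h_proj (\<pi> p) Z"
  have h: "horizontal_lift (?A t) p X = ?h X - t *\<^sub>R ?F X" for t X
    by (simp add: horizontal_lift_translate[where A = A and p = p, OF A_fund] blinfun.scaleR_left linear_scale[OF F])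
  note l = form2_deriv_linear[OF B_diff] and l' = form2_deriv_linear[OF b]
  have "nabla (?A t) (\<lambda>q. B q + t *\<^sub>R b q) p X Y Z = nabla A B p X Y Z + t *\<^sub>R nabla_deriv \<alpha> b X Y Z
      + (t * t) *\<^sub>R (- form2_deriv b p ?pY ?pZ (?F X)) + (t * t * t) *\<^sub>R 0" for t
    unfolding nabla_deriv_apply[OF b] nabla_apply[OF form2_deriv_add_scale(1)[OF B_diff b]] nabla_apply[OF B_diff] nabla_apply[OF b]
      form2_deriv_add_scale(2)[OF B_diff b] h
    by (simp add: linear_diff[OF l] linear_scale[OF l] linear_diff[OF l'] linear_scale[OF l'] blinfun.bilinear_simps algebra_simps)
  then show ?thesis by (rule has_vector_derivative_cubic)
qed

text \<open>\<open>delta_plus\<close> is minus a trace and enters \<open>Phi\<close> negatively,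
  hence the plus sign before the sum. The frame is literally the one chosen in
  \<open>delta_plus\<close>.\<close>

definition dPhi_formula :: "('p \<Rightarrow> 'l form1) \<Rightarrow> ('p \<Rightarrow> 'l form2) \<Rightarrow> 'l form1 \<times> 'l form2" where
  "dPhi_formula \<alpha> b = (let e = SOME e. oriented_frame (g (\<pi> p)) e; n = v (\<pi> p) in
     (curvature_deriv \<alpha> n + (\<Sum>i\<in>UNIV. nabla_deriv \<alpha> b (e $ i) (e $ i)),
      plus_part (g (\<pi> p)) n (curvature_deriv \<alpha>) - nabla_deriv \<alpha> b n
        - (sigma (g (\<pi> p)) n bracket (B p) (b p) + sigma (g (\<pi> p)) n bracket (b p) (B p))))"

lemma dPhi_eq:
  assumes \<alpha>: "differentiable_form (pull (\<lambda>q. fst (s q))) p" and b: "differentiable_form2 (\<lambda>q. snd (s q)) p"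
  shows "dPhi A B s p = dPhi_formula (\<lambda>q. fst (s q)) (\<lambda>q. snd (s q))"
proof -
  let ?n = "v (\<pi> p)" and ?g = "g (\<pi> p)"
  obtain e0 where e0: "oriented_frame ?g e0" "e0 $ 5 = ?n"
    using exists_adapted_frame[OF metric_inner_product unit_length] by blast
  interpret adapted_frame ?g ?n e0 by standard (rule metric_inner_product e0)+
  define e where "e = (SOME e. oriented_frame ?g e)"
  let ?\<alpha> = "\<lambda>q. fst (s q)" and ?b = "\<lambda>q. snd (s q)"
  let ?A = "\<lambda>t. translate A (\<lambda>q. t *\<^sub>R ?\<alpha> q)" and ?B = "\<lambda>t q. B q + t *\<^sub>R ?b q"
  have C: "((\<lambda>t. curvature (?A t) p) has_vector_derivative curvature_deriv ?\<alpha>) (at 0)"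
    by (rule form2_has_vector_derivativeI[OF curvature_has_derivative(1)[OF \<alpha>]])
  have N: "((\<lambda>t. nabla (?A t) (?B t) p X) has_vector_derivative nabla_deriv ?\<alpha> ?b X) (at 0)" for X
    by (rule form2_has_vector_derivativeI[OF nabla_has_derivative[OF b]])
  have ev: "((\<lambda>t. \<phi> t X) has_vector_derivative \<psi> X) (at 0)" if "(\<phi> has_vector_derivative \<psi>) (at 0)"
    for \<phi> and \<psi> :: "'l form2" and X
    by (rule bounded_linear.has_vector_derivative[OF blinfun.bounded_linear_left that])
  note br = lie_bracket_bilinear[OF structure_group]
  have S: "((\<lambda>t. sigma ?g ?n bracket (?B t p) (?B t p)) has_vector_derivative
      sigma ?g ?n bracket (B p) (?b p) + sigma ?g ?n bracket (?b p) (B p)) (at 0)"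
  proof (rule has_vector_derivative_cubic)
    show "sigma ?g ?n bracket (?B t p) (?B t p) = sigma ?g ?n bracket (B p) (B p)
        + t *\<^sub>R (sigma ?g ?n bracket (B p) (?b p) + sigma ?g ?n bracket (?b p) (B p))
        + (t * t) *\<^sub>R sigma ?g ?n bracket (?b p) (?b p) + (t * t * t) *\<^sub>R 0" for t
      unfolding sigma_bilinear[OF metric_inner_product br] by (simp add: algebra_simps)
  qed
  have "((\<lambda>t. Phi (?A t) (?B t) p) has_vector_derivative dPhi_formula ?\<alpha> ?b) (at 0)"
    unfolding Phi_def dPhi_formula_def Let_def delta_plus_def e_def[symmetric] diff_minus_eq_add
    by (intro has_vector_derivative_Pair has_vector_derivative_add has_vector_derivative_diff has_vector_derivative_sum
        plus_part_has_vector_derivative curvature_has_derivative[OF \<alpha>] alternating_curvature_deriv[OF \<alpha>] ev C N S)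
  then show ?thesis unfolding dPhi_def by (rule vector_derivative_at)
qed

text \<open>All terms algebraic in (\<alpha>, b) scale by f(\<pi> p) and cancel in the commutator.
  What is left are the Leibniz terms: \<zeta> \<and> \<alpha> from the curvature and \<zeta>(X) b
  from the covariant derivative in direction X.\<close>

lemma dPhi_formula_scale:
  assumes \<alpha>: "differentiable_form (pull \<alpha>) p" and b: "differentiable_form2 b p" "b p \<in> Lambda2_plus p"
    and f: "smooth_fun_on W UNIV f" and \<zeta>: "deriv_fun W f (\<pi> p) = blinfun_apply \<zeta>"
    and e0: "oriented_frame (g (\<pi> p)) e0" "e0 $ 5 = v (\<pi> p)"
  shows "dPhi_formula (\<lambda>q. f (\<pi> q) *\<^sub>R \<alpha> q) (\<lambda>q. f (\<pi> q) *\<^sub>R b q) - f (\<pi> p) *\<^sub>R dPhi_formula \<alpha> b =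
    (adapted_frame.symbol1 (v (\<pi> p)) e0 \<zeta> (\<alpha> p) (b p),
     adapted_frame.symbol2 (g (\<pi> p)) (v (\<pi> p)) \<zeta> (\<alpha> p) (b p))"
proof -
  let ?n = "v (\<pi> p)" and ?g = "g (\<pi> p)"
  interpret adapted_frame ?g ?n e0 by standard (rule metric_inner_product e0)+
  define e where "e = (SOME e. oriented_frame ?g e)"
  have e: "orthonormal_on ?g UNIV e"
    using someI[of "oriented_frame ?g" e0] e0(1) unfolding e_def oriented_frame_orthonormal by blast
  let ?\<alpha>' = "\<lambda>q. f (\<pi> q) *\<^sub>R \<alpha> q" and ?b' = "\<lambda>q. f (\<pi> q) *\<^sub>R b q"
  note \<alpha>' = ext_deriv_pull_scale[OF \<alpha> f \<zeta>] and b' = form2_deriv_scale[OF b(1) f \<zeta>]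
  note lift = horizontal_lift(1)[where A = A and p = p, OF A_fund]
  note F = linear_fundamental[of p] and bA = ext_deriv_bilinear[OF A_diff]
  have C: "curvature_deriv ?\<alpha>' = f (\<pi> p) *\<^sub>R curvature_deriv \<alpha> + wedge_form (\<alpha> p) \<zeta>"
    by (rule form2_eqI)
      (simp add: curvature_deriv_apply[OF \<alpha>'(1)] curvature_deriv_apply[OF \<alpha>] \<alpha>'(2) blinfun.bilinear_simps lift
        linear_scale[OF F] bilinear_lmul[OF bA] bilinear_rmul[OF bA] algebra_simps)
  \<comment> \<open>A self-dual form annihilates v, so the projections in \<open>nabla\<close> do
    not alter the Leibniz term.\<close>
  have hor: "b p (h_proj (\<pi> p) Y) (h_proj (\<pi> p) Z) = b p Y Z" for Y Z
  proof -
    have alt: "alternating (b p)" and z: "b p (e0 $ i) (e0 $ 5) = 0" for i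
      using b(2) unfolding Lambda2_plus_def star_plus_iff by blast+
    have "b p X ?n = 0" for X
    proof -
      have "b p X ?n = (\<Sum>i\<in>UNIV. ?g (e0 $ i) X *\<^sub>R b p (e0 $ i) ?n)"
        by (subst expansion[of X]) (simp add: blinfun.sum_left blinfun.sum_right blinfun.scaleR_left blinfun.scaleR_right)
      then show ?thesis using z by (simp add: e0(2))
    qed
    moreover from this have "b p ?n X = 0" for X using alternating_skew[OF alt, of ?n X] by simp
    ultimately show ?thesis by (simp add: h_proj_def blinfun.bilinear_simps)
  qed
  have N: "nabla_deriv ?\<alpha>' ?b' X = f (\<pi> p) *\<^sub>R nabla_deriv \<alpha> b X + \<zeta> X *\<^sub>R b p" for X
    by (rule form2_eqI)
      (simp add: nabla_deriv_apply[OF b'(1)] nabla_deriv_apply[OF b(1)] nabla_apply[OF b'(1)] nabla_apply[OF b(1)] b'(2)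
        blinfun.bilinear_simps lift linear_scale[OF F] linear_scale[OF form2_deriv_linear[OF B_diff]] hor algebra_simps)
  note br = lie_bracket_bilinear[OF structure_group]
  have S: "sigma ?g ?n bracket (B p) (?b' p) = f (\<pi> p) *\<^sub>R sigma ?g ?n bracket (B p) (b p)"
    "sigma ?g ?n bracket (?b' p) (B p) = f (\<pi> p) *\<^sub>R sigma ?g ?n bracket (b p) (B p)"
    using sigma_bilinear[OF metric_inner_product[of "\<pi> p"] br, where n = ?n and \<xi> = 0 and r = "f (\<pi> p)" and \<xi>' = "b p" and \<zeta> = "B p"]
      sigma_bilinear[OF metric_inner_product[of "\<pi> p"] br, where n = ?n and \<xi> = 0 and r = 1 and \<xi>' = 0 and \<zeta> = "B p"]
    by simp_all
  \<comment> \<open>\<open>delta_plus\<close> uses a chosen oriented frame, \<open>symbol1\<close>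
    the adapted one; the contraction is a trace and agrees for both.\<close>
  have trace: "(\<Sum>i\<in>UNIV. \<zeta> (e $ i) *\<^sub>R b p (e $ i)) = (\<Sum>i\<in>UNIV. \<zeta> (e0 $ i) *\<^sub>R b p (e0 $ i))"
    by (rule frame_trace[OF metric_inner_product e orthonormal]) (simp add: bilinear_def linear_iff blinfun.bilinear_simps algebra_simps)
  have w: "wedge_form (\<alpha> p) \<zeta> ?n = \<zeta> ?n *\<^sub>R \<alpha> p - tensor1 \<zeta> (\<alpha> p ?n)"
    by (rule blinfun_eqI) (simp add: blinfun.bilinear_simps)
  have alt: "alternating (curvature_deriv ?\<alpha>')" by (rule alternating_curvature_deriv[OF \<alpha>'(1)])
  have pl: "plus_part ?g ?n (curvature_deriv ?\<alpha>') - f (\<pi> p) *\<^sub>R plus_part ?g ?n (curvature_deriv \<alpha>) = plus_part ?g ?n (wedge_form (\<alpha> p) \<zeta>)"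
    using plus_part_combination[OF alt alternating_curvature_deriv[OF \<alpha>], of "f (\<pi> p)"] by (simp add: C)
  have fst: "curvature_deriv ?\<alpha>' ?n + (\<Sum>i\<in>UNIV. nabla_deriv ?\<alpha>' ?b' (e $ i) (e $ i))
     - f (\<pi> p) *\<^sub>R (curvature_deriv \<alpha> ?n + (\<Sum>i\<in>UNIV. nabla_deriv \<alpha> b (e $ i) (e $ i))) = symbol1 \<zeta> (\<alpha> p) (b p)"
    unfolding symbol1_def trace[symmetric] w[symmetric] C N
    by (simp add: blinfun.add_left blinfun.scaleR_left sum.distrib scaleR_sum_right scaleR_add_right)
  have snd: "plus_part ?g ?n (curvature_deriv ?\<alpha>') - nabla_deriv ?\<alpha>' ?b' ?n
        - (sigma ?g ?n bracket (B p) (?b' p) + sigma ?g ?n bracket (?b' p) (B p))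
     - f (\<pi> p) *\<^sub>R (plus_part ?g ?n (curvature_deriv \<alpha>) - nabla_deriv \<alpha> b ?n
        - (sigma ?g ?n bracket (B p) (b p) + sigma ?g ?n bracket (b p) (B p))) = symbol2 \<zeta> (\<alpha> p) (b p)"
    unfolding symbol2_def pl[symmetric] N S by (simp add: algebra_simps)
  show ?thesis
    using fst snd unfolding dPhi_formula_def Let_def e_def[symmetric] by simp
qed

lemma principal_symbol_dPhi:
  assumes e: "e \<in> UNIV \<times> Lambda2_plus p" and e0: "oriented_frame (g (\<pi> p)) e0" "e0 $ 5 = v (\<pi> p)"
  shows "principal_symbol W \<pi> Omega1_Omega2_plus (dPhi A B) p \<zeta> e =
    (adapted_frame.symbol1 (v (\<pi> p)) e0 \<zeta> (fst e) (snd e),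
     adapted_frame.symbol2 (g (\<pi> p)) (v (\<pi> p)) \<zeta> (fst e) (snd e))"
proof (rule principal_symbol_eqI[OF base_atlas exists_Omega1_Omega2_plus[OF e]])
  fix f s
  assume f: "smooth_fun_on W UNIV f" "deriv_fun W f (\<pi> p) = blinfun_apply \<zeta>" and s: "s \<in> Omega1_Omega2_plus" "s p = e"
  have \<alpha>: "differentiable_form (pull (\<lambda>q. fst (s q))) p"
    using s(1) pull_differentiable unfolding Omega1_Omega2_plus_def by (simp add: o_def)
  have "(\<lambda>q. snd (s q)) \<in> Omega2_plus" using s(1) unfolding Omega1_Omega2_plus_def by (simp add: o_def)
  then have b: "differentiable_form2 (\<lambda>q. snd (s q)) p" "snd (s p) \<in> Lambda2_plus p"
    using Omega2_differentiable unfolding Omega2_plus_def by auto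
  have "dPhi A B (\<lambda>q. f (\<pi> q) *\<^sub>R s q) p = dPhi_formula (\<lambda>q. f (\<pi> q) *\<^sub>R fst (s q)) (\<lambda>q. f (\<pi> q) *\<^sub>R snd (s q))"
    using dPhi_eq[of "\<lambda>q. f (\<pi> q) *\<^sub>R s q"] ext_deriv_pull_scale(1)[OF \<alpha> f] form2_deriv_scale(1)[OF b(1) f] by simp
  then show "dPhi A B (\<lambda>q. f (\<pi> q) *\<^sub>R s q) p - f (\<pi> p) *\<^sub>R dPhi A B s p =
    (adapted_frame.symbol1 (v (\<pi> p)) e0 \<zeta> (fst e) (snd e),
     adapted_frame.symbol2 (g (\<pi> p)) (v (\<pi> p)) \<zeta> (fst e) (snd e))"
    using dPhi_formula_scale[OF \<alpha> b f e0] dPhi_eq[OF \<alpha> b(1)] s(2) by simp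
qed

text \<open>[B, \<xi>] contains no derivative of \<xi> and cancels in the commutator; the Leibniz
  term of d_A is evaluated on a horizontal lift of X, which projects back to X.\<close>

lemma principal_symbol_K:
  "principal_symbol W \<pi> Omega0 (K A B) p \<zeta> \<xi> = (tensor1 \<zeta> \<xi>, 0)"
proof (rule principal_symbol_eqI[OF base_atlas exists_Omega0])
  fix f s
  assume f: "smooth_fun_on W UNIV f" "deriv_fun W f (\<pi> p) = blinfun_apply \<zeta>" and s: "s \<in> Omega0" "s p = \<xi>"
  have ds: "has_mderiv P s p (deriv_fun P s p)"
    using s(1) smooth_fun_on_has_mderiv[OF bundle_top _ open_UNIV UNIV_I] unfolding Omega0_def by blast
  have dfs: "has_mderiv P (\<lambda>q. f (\<pi> q) *\<^sub>R s q) p (\<lambda>u. f (\<pi> p) *\<^sub>R deriv_fun P s p u + \<zeta> (dproj p u) *\<^sub>R s p)"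
    by (rule has_mderiv_bilinear[OF bundle_top bounded_bilinear_scaleR proj_has_mderiv[OF f] ds])
  have d_conn: "d_conn A s' p X = D (horizontal_lift A p X)" if "has_mderiv P s' p D" for s' D X
  proof -
    have "linear (\<lambda>X. D (horizontal_lift A p X))"
      using linear_compose[OF lift_linear has_mderiv_linear[OF that]] by (simp add: o_def)
    then show ?thesis unfolding d_conn_def has_mderiv_deriv_fun[OF that] by (rule Blinfun_apply)
  qed
  note br = lie_bracket_bilinear[OF structure_group]
  have bl: "bilinear (\<lambda>X Y. bracket (B p X Y) y)" for y
    by (simp add: bilinear_def linear_iff blinfun.bilinear_simps bilinear_ladd[OF br] bilinear_lmul[OF br])
  have "d_conn A (\<lambda>q. f (\<pi> q) *\<^sub>R s q) p - f (\<pi> p) *\<^sub>R d_conn A s p = tensor1 \<zeta> \<xi>"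
    by (rule blinfun_eqI)
      (simp add: blinfun.bilinear_simps d_conn[OF dfs] d_conn[OF ds] horizontal_lift(1)[where A = A and p = p, OF A_fund] s(2))
  moreover have "Form2 (\<lambda>X Y. bracket (B p X Y) (f (\<pi> p) *\<^sub>R s p)) - f (\<pi> p) *\<^sub>R Form2 (\<lambda>X Y. bracket (B p X Y) (s p)) = 0"
    by (rule form2_eqI) (simp add: blinfun.diff_left blinfun.scaleR_left Form2_apply[OF bl], simp add: bilinear_rmul[OF br])
  ultimately show "K A B (\<lambda>q. f (\<pi> q) *\<^sub>R s q) p - f (\<pi> p) *\<^sub>R K A B s p = (tensor1 \<zeta> \<xi>, 0)"
    by (simp add: K_def)
qed

lemma symbol_sequence_exact:
  assumes \<zeta>: "\<zeta> \<noteq> 0"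
  defines "s0 \<equiv> principal_symbol W \<pi> Omega0 (K A B) p \<zeta>"
    and "s1 \<equiv> principal_symbol W \<pi> Omega1_Omega2_plus (dPhi A B) p \<zeta>"
  shows "{y \<in> UNIV. s0 y = 0} = {0}"
    and "{e \<in> UNIV \<times> Lambda2_plus p. s1 e = 0} = s0 ` UNIV"
    and "s1 ` (UNIV \<times> Lambda2_plus p) = Lambda1_h p \<times> Lambda2_plus p"
proof -
  obtain e0 where e0: "oriented_frame (g (\<pi> p)) e0" "e0 $ 5 = v (\<pi> p)"
    using exists_adapted_frame[OF metric_inner_product unit_length] by blast
  interpret adapted_frame "g (\<pi> p)" "v (\<pi> p)" e0 by standard (rule metric_inner_product e0)+
  have s0: "s0 y = (tensor1 \<zeta> y, 0)" for y unfolding s0_def by (rule principal_symbol_K)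
  have s1: "s1 (\<alpha>, b) = (symbol1 \<zeta> \<alpha> b, symbol2 \<zeta> \<alpha> b)" if "b \<in> Lambda2_plus p" for \<alpha> b
    unfolding s1_def using principal_symbol_dPhi[OF _ e0, of "(\<alpha>, b)"] that by simp
  have "y = 0" if "s0 y = 0" for y
  proof -
    obtain X where X: "\<zeta> X \<noteq> 0" using \<zeta> blinfun_eqI[of \<zeta> 0] by auto
    have "tensor1 \<zeta> y X = 0" using that unfolding s0 by (simp add: zero_prod_def)
    then show "y = 0" using X by simp
  qed
  then show "{y \<in> UNIV. s0 y = 0} = {0}" by (auto simp: s0 zero_prod_def)
  have L0: "0 \<in> Lambda2_plus p" unfolding Lambda2_plus_def star_plus_iff by (simp add: alternating_def)
  show "{e \<in> UNIV \<times> Lambda2_plus p. s1 e = 0} = s0 ` UNIV"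
  proof (intro equalityI subsetI)
    fix e assume "e \<in> {e \<in> UNIV \<times> Lambda2_plus p. s1 e = 0}"
    then obtain \<alpha> b where eab: "e = (\<alpha>, b)" and b: "b \<in> Lambda2_plus p" and "s1 (\<alpha>, b) = 0" by auto
    then have "symbol1 \<zeta> \<alpha> b = 0 \<and> symbol2 \<zeta> \<alpha> b = 0" by (simp add: s1 zero_prod_def)
    then obtain \<xi> where "\<alpha> = tensor1 \<zeta> \<xi>" "b = 0"
      using symbol_kernel[OF \<zeta> b[unfolded Lambda2_plus_def]] by blast
    then show "e \<in> s0 ` UNIV" by (auto simp: eab s0)
  next
    fix e assume "e \<in> s0 ` UNIV"
    then obtain \<xi> where e: "e = (tensor1 \<zeta> \<xi>, 0)" by (auto simp: s0)
    have "symbol1 \<zeta> (tensor1 \<zeta> \<xi>) 0 = 0 \<and> symbol2 \<zeta> (tensor1 \<zeta> \<xi>) 0 = (0 :: 'l form2)"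
      using symbol_kernel[OF \<zeta> L0[unfolded Lambda2_plus_def], of "tensor1 \<zeta> \<xi>"] by blast
    then show "e \<in> {e \<in> UNIV \<times> Lambda2_plus p. s1 e = 0}" using L0 by (simp add: e s1 zero_prod_def)
  qed
  show "s1 ` (UNIV \<times> Lambda2_plus p) = Lambda1_h p \<times> Lambda2_plus p"
  proof (intro equalityI subsetI)
    fix y assume "y \<in> s1 ` (UNIV \<times> Lambda2_plus p)"
    then obtain \<alpha> b where b: "b \<in> Lambda2_plus p" and y: "y = s1 (\<alpha>, b)" by auto
    have "symbol1 \<zeta> \<alpha> b (v (\<pi> p)) = 0" using symbol1_frame(5)[OF b[unfolded Lambda2_plus_def], of \<zeta> \<alpha>] e0(2) by simp
    then show "y \<in> Lambda1_h p \<times> Lambda2_plus p"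
      using symbol2_mem[OF b[unfolded Lambda2_plus_def], of \<zeta> \<alpha>] unfolding y s1[OF b] Lambda1_h_def Lambda2_plus_def by simp
  next
    fix y assume "y \<in> Lambda1_h p \<times> Lambda2_plus p"
    then obtain \<rho> \<tau> where y: "y = (\<rho>, \<tau>)" and \<rho>: "\<rho> (v (\<pi> p)) = 0" and \<tau>: "\<tau> \<in> Lambda2_plus p"
      unfolding Lambda1_h_def by auto
    obtain \<alpha> b where b: "b \<in> Lambda2_plus p" and "symbol1 \<zeta> \<alpha> b = \<rho>" "symbol2 \<zeta> \<alpha> b = \<tau>"
      using symbol_onto[OF \<zeta> \<rho> \<tau>[unfolded Lambda2_plus_def]] unfolding Lambda2_plus_def by blast
    then have "y = s1 (\<alpha>, b)" by (simp add: y s1)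
    then show "y \<in> s1 ` (UNIV \<times> Lambda2_plus p)" using b by blast
  qed
qed

end

lemma elliptic_complex_dPhi:
  assumes "A \<in> connections" "B \<in> Omega2_plus"
  shows "elliptic_complex W \<pi> (\<lambda>p. UNIV) (\<lambda>p. UNIV \<times> Lambda2_plus p) (\<lambda>p. Lambda1_h p \<times> Lambda2_plus p)
    Omega0 Omega1_Omega2_plus (K A B) (dPhi A B)"
  unfolding elliptic_complex_def Let_def
  by (intro allI impI conjI symbol_sequence_exact[OF assms])

end

theorem lemma3p3:
  fixes W :: "('w::{t2_space,second_countable_topology}, real^5) chart set"
    and g :: "'w \<Rightarrow> real^5 \<Rightarrow> real^5 \<Rightarrow> real"
    and v :: "'w \<Rightarrow> real^5"
    and G :: "('g::{t2_space,second_countable_topology}) monoid"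
    and L :: "('g, 'l::finite_dim_inner) chart set"
    and P :: "('p::{t2_space,second_countable_topology}, 'k::finite_dim_inner) chart set"
    and \<pi> :: "'p \<Rightarrow> 'w"
    and act :: "'p \<Rightarrow> 'g \<Rightarrow> 'p"
    and A :: "'p \<Rightarrow> 'k \<Rightarrow>\<^sub>L 'l"
    and B :: "'p \<Rightarrow> 'l form2"
  assumes "gauge_five_manifold W g v G L P \<pi> act"
    and "A \<in> gauge_five_manifold.connections G L P act"
    and "B \<in> gauge_five_manifold.Omega2_plus W g v G L P \<pi> act"
  shows "elliptic_complex W \<pi>
           (\<lambda>p. UNIV)
           (\<lambda>p. UNIV \<times> gauge_five_manifold.Lambda2_plus g v \<pi> p)
           (\<lambda>p. gauge_five_manifold.Lambda1_h v \<pi> p \<times> gauge_five_manifold.Lambda2_plus g v \<pi> p)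
           (gauge_five_manifold.Omega0 G L P act)
           (gauge_five_manifold.Omega1_Omega2_plus W g v G L P \<pi> act)
           (gauge_five_manifold.K W G L P \<pi> A B)
           (gauge_five_manifold.dPhi W g v G L P \<pi> A B)"
  using gauge_five_manifold.elliptic_complex_dPhi[OF assms] .

end
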